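(* Let $K=K_1\#\cdots\#K_\nu$ and $\overline K=\overline K_1\#\cdots\#\overline K_{\overline\nu}$ be connected sums of algebraic knots. Let $[n^{(i)}_1,\dots,n^{(i)}_{r_i}]$ ($1\le i\le\nu$) and $[\overline n^{(i)}_1,\dots,\overline n^{(i)}_{\overline r_i}]$ ($1\le i\le\overline\nu$) be the multiplicity sequences of the plane curve singularities corresponding to $K_i$ and $\overline K_i$, respectively. If the multiset of all numbers $n^{(i)}_j$ equals the multiset of all numbers $\overline n^{(i)}_j$, then $$\mathbb{H}^0(S^3_{-d}(K),a)\cong\mathbb{H}^0(S^3_{-d}(\overline K),a)$$ for any integer $d>0$ and any Spin$^c$-structure $a\in\{0,\dots,d-1\}$; likewise $\mathrm{eu}\,\mathbb{H}^0(S^3_{-d}(K),a)=\mathrm{eu}\,\mathbb{H}^0(S^3_{-d}(\overline K),a)$ for all such $d$ and $a$.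
   Context: Algebraic knot $K_i$: the link of a locally irreducible plane curve singularity (cusp) $(C_i,0)=\{f_i=0\}\subset(\mathbb{C}^2,0)$. Its multiplicity sequence is the non-increasing sequence of multiplicities of the successive strict transforms under blow-up, with the $1$'s at the end omitted (so all entries are $>1$). A multiset records elements with their numbers of appearances. Lattice cohomology of a weight function: let $w:\mathbb{Z}^s\to\mathbb{Z}$ be bounded below, where $\mathbb{Z}^s$ has fixed basis $\{E_i\}$. A $q$-cube $(l,I)$ ($l\in\mathbb{Z}^s$, $\#I=q$) has vertices $l+\sum_{j\in J}E_j$, $J\subset I$, and $w(\square)$ is the maximum of $w$ on the vertices of $\square$. $S_n$ is the union of all cubes with $w(\square)\le n$. Put $\mathbb{H}^q=\bigoplus_{n\ge\min w}H^q(S_n,\mathbb{Z})$, a $\mathbb{Z}[U]$-module graded by $n$, with $U$ acting by the restrictions induced by $S_n\hookrightarrow S_{n+1}$, and $\mathbb{H}^q_{\mathrm{red}}=\bigoplus_{n\ge\min w}\tilde H^q(S_n,\mathbb{Z})$ (finite rank here). Set $\mathrm{eu}\,\mathbb{H}^0=-\min w+\mathrm{rank}_{\mathbb{Z}}\mathbb{H}^0_{\mathrm{red}}$. The isomorphism in the claim is of graded $\mathbb{Z}[U]$-modules. Lattice cohomology of $S^3_{-d}(K)$: $S^3_{-d}(K)$ is the result of $(-d)$-surgery on $K$. It is the plumbed manifold of the negative definite tree (all genera $0$) obtained from the dual graphs of the minimal good embedded resolutions of the $(C_i,0)$ by adding one vertex $E_+$ joined by an edge to the unique $(-1)$-vertex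 of each of these graphs and with Euler number $-d-\sum_im_i$, where $m_i$ is the multiplicity of the pull-back of $f_i$ along that $(-1)$-curve. Let $L$ be the lattice freely generated by the vertices $E_v$ with intersection form $(\cdot,\cdot)$, let $K_{\mathrm{can}}\in L\otimes\mathbb{Q}$ be given by $(K_{\mathrm{can}},E_v)=-(E_v,E_v)-2$ for all $v$, and $E_+^*\in L\otimes\mathbb{Q}$ by $(E_+^*,E_v)=-1$ if $E_v=E_+$ and $0$ otherwise. The $d$ Spin$^c$-structures are indexed by $a\in\{0,\dots,d-1\}$, with weight function $w_a(l)=-\frac12\big(l,\,l+K_{\mathrm{can}}+2aE_+^*\big)$ on $L$; $a=0$ is the canonical one. $\mathbb{H}^*(S^3_{-d}(K),a)$ is the lattice cohomology associated with $w_a$; it depends only on $S^3_{-d}(K)$ and $a$. *)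

theory Defs
  imports
    "HOL-Analysis.Analysis"
    "HOL-Computational_Algebra.Computational_Algebra"
    "HOL-Homology.Homology"
begin

unbundle no vec_syntax and fps_syntax

section \<open>Plane curve germs\<close>

text \<open>
  A power series \<open>f(x, y)\<close> is represented as a power series in \<open>x\<close> whose coefficients are power
  series in \<open>y\<close>: the coefficient of \<open>x\<^sup>i y\<^sup>j\<close> is \<open>f $ i $ j\<close>.  Hence \<open>x\<close> itself is \<open>fps_X\<close> and
  \<open>y\<close> is \<open>fps_const fps_X\<close>.
\<close>

type_synonym series2 = "complex fps fps"

definition convergent_series :: "series2 \<Rightarrow> bool" where
  "convergent_series f \<longleftrightarrow>
     (\<exists>r>0. (\<lambda>(i, j). norm (f $ i $ j) * r ^ (i + j)) summable_on (UNIV :: (nat \<times> nat) set))"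

definition convergent_unit :: "series2 \<Rightarrow> bool" where
  "convergent_unit f \<longleftrightarrow> convergent_series f \<and> (\<exists>g. convergent_series g \<and> f * g = 1)"

text \<open>Irreducibility is taken in the ring of convergent power series, not in all of \<open>series2\<close>.\<close>

definition irreducible_germ :: "series2 \<Rightarrow> bool" where
  "irreducible_germ f \<longleftrightarrow>
     convergent_series f \<and> f \<noteq> 0 \<and> \<not> convergent_unit f \<and>
     (\<forall>g h. convergent_series g \<longrightarrow> convergent_series h \<longrightarrow> f = g * h \<longrightarrow>
        convergent_unit g \<or> convergent_unit h)"

text \<open>Multiplicity of \<open>{f = 0}\<close> at the origin (0 if the curve does not pass through it).\<close>

definition mult0 :: "series2 \<Rightarrow> nat" where
  "mult0 f = (LEAST n. \<exists>i j. i + j = n \<and> f $ i $ j \<noteq> 0)"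

definition cusp :: "series2 \<Rightarrow> bool" where
  "cusp f \<longleftrightarrow> irreducible_germ f \<and> 2 \<le> mult0 f"

section \<open>Blowing up\<close>

text \<open>
  Local coordinates at a point of the exceptional curve of the blow-up of the origin:
  \<open>Finite_slope c\<close> is centred at the direction \<open>[1 : c]\<close>, with blow-down map
  \<open>(x, y) \<mapsto> (x, x (y + c))\<close> and exceptional curve \<open>x = 0\<close>;
  \<open>Vertical\<close> is centred at \<open>[0 : 1]\<close>, with blow-down map \<open>(x, y) \<mapsto> (x y, y)\<close> and exceptional
  curve \<open>y = 0\<close>.
\<close>

datatype chart = Finite_slope complex | Vertical

primrec exceptional :: "chart \<Rightarrow> series2" where
  "exceptional (Finite_slope c) = fps_X"
| "exceptional Vertical = fps_const fps_X"

text \<open>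
  In the first case the coefficient of \<open>x\<^sup>n\<close> in \<open>\<Sum>i j. g\<^sub>i\<^sub>j x\<^sup>i (x (y + c))\<^sup>j\<close> collects the terms with
  \<open>i + j = n\<close>; in the second case \<open>\<Sum>i j. g\<^sub>i\<^sub>j (x y)\<^sup>i y\<^sup>j\<close> multiplies the coefficient of \<open>x\<^sup>i\<close> by \<open>y\<^sup>i\<close>.
\<close>

primrec pullback :: "chart \<Rightarrow> series2 \<Rightarrow> series2" where
  "pullback (Finite_slope c) g =
     Abs_fps (\<lambda>n. \<Sum>j\<le>n. fps_const (g $ (n - j) $ j) * (fps_X + fps_const c) ^ j)"
| "pullback Vertical g = Abs_fps (\<lambda>i. fps_X ^ i * g $ i)"

definition strict_transform :: "chart \<Rightarrow> series2 \<Rightarrow> series2" where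
  "strict_transform ch g = (THE h. pullback ch g = exceptional ch ^ mult0 g * h)"

text \<open>
  The direction of the tangent cone of \<open>f\<close>, i.e. the zero of its initial form
  \<open>\<Sum>j\<le>m. f\<^sub>m\<^sub>-\<^sub>j\<^sub>,\<^sub>j x\<^sup>m\<^sup>-\<^sup>j y\<^sup>j\<close>, where \<open>m = mult0 f\<close>.  An irreducible germ has exactly one
  tangent direction, so that the choice below is no choice: it is the only point of the
  exceptional curve which lies on the strict transform of \<open>f\<close>.
\<close>

definition tangent_chart :: "series2 \<Rightarrow> chart" where
  "tangent_chart f =
     (let m = mult0 f in
      if f $ 0 $ m = 0 then Vertical
      else Finite_slope (SOME c. (\<Sum>j\<le>m. f $ (m - j) $ j * c ^ j) = 0))"

text \<open>
  Infinitely near points \<open>P\<^sub>0, P\<^sub>1, \<dots>\<close> of the germ \<open>f\<close>: \<open>P\<^sub>0\<close> is the origin, and \<open>P\<^sub>k\<^sub>+\<^sub>1\<close> is the point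
  of the strict transform of \<open>f\<close> on the curve \<open>E\<^sub>k\<close> created by blowing up \<open>P\<^sub>k\<close>.  All equations are
  local equations at \<open>P\<^sub>k\<close>: \<open>strict_eq f k\<close> of the strict transform of \<open>f\<close>, \<open>total_eq f k\<close> of the
  pull-back of \<open>f\<close>, and \<open>exc_eq f k v\<close> (for \<open>v < k\<close>) of the strict transform of \<open>E\<^sub>v\<close>, which is a
  unit if this curve does not pass through \<open>P\<^sub>k\<close>.
\<close>

primrec strict_eq :: "series2 \<Rightarrow> nat \<Rightarrow> series2" where
  "strict_eq f 0 = f"
| "strict_eq f (Suc k) = strict_transform (tangent_chart (strict_eq f k)) (strict_eq f k)"

definition chart_at :: "series2 \<Rightarrow> nat \<Rightarrow> chart" where
  "chart_at f k = tangent_chart (strict_eq f k)"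

primrec total_eq :: "series2 \<Rightarrow> nat \<Rightarrow> series2" where
  "total_eq f 0 = f"
| "total_eq f (Suc k) = pullback (chart_at f k) (total_eq f k)"

primrec exc_eq :: "series2 \<Rightarrow> nat \<Rightarrow> nat \<Rightarrow> series2" where
  "exc_eq f 0 v = 1"
| "exc_eq f (Suc k) v =
     (if v = k then exceptional (chart_at f k) else strict_transform (chart_at f k) (exc_eq f k v))"

definition passes_through :: "series2 \<Rightarrow> nat \<Rightarrow> nat \<Rightarrow> bool" where
  "passes_through f k v \<longleftrightarrow> v < k \<and> exc_eq f k v $ 0 $ 0 = 0"

definition multiplicity_sequence :: "series2 \<Rightarrow> nat list" where
  "multiplicity_sequence f =
     map (\<lambda>k. mult0 (strict_eq f k)) [0..<(LEAST n. \<forall>k\<ge>n. mult0 (strict_eq f k) = 1)]"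

section \<open>The minimal good embedded resolution\<close>

definition transversal :: "series2 \<Rightarrow> series2 \<Rightarrow> bool" where
  "transversal g h \<longleftrightarrow> g $ 1 $ 0 * h $ 0 $ 1 - g $ 0 $ 1 * h $ 1 $ 0 \<noteq> 0"

text \<open>
  The total transform of \<open>f\<close> has normal crossings at \<open>P\<^sub>k\<close>.  The exceptional curves always have
  normal crossings among themselves, so only the points \<open>P\<^sub>k\<close> on the strict transform matter; hence
  the minimal good embedded resolution consists in blowing up \<open>P\<^sub>0, P\<^sub>1, \<dots>\<close> as long as normal
  crossings fail.
\<close>

definition normal_crossing_at :: "series2 \<Rightarrow> nat \<Rightarrow> bool" where
  "normal_crossing_at f k \<longleftrightarrow>
     mult0 (strict_eq f k) = 1 \<and>
     card {v. passes_through f k v} \<le> 1 \<and>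
     (\<forall>v. passes_through f k v \<longrightarrow> transversal (strict_eq f k) (exc_eq f k v))"

definition blow_up_count :: "series2 \<Rightarrow> nat" where
  "blow_up_count f = (LEAST k. normal_crossing_at f k)"

record 'v plumbing =
  verts :: "'v set"
  euler_number :: "'v \<Rightarrow> int"
  adjacent :: "'v \<Rightarrow> 'v \<Rightarrow> bool"

text \<open>
  Self-intersections, and pairs of intersecting curves, among (the strict transforms of)
  \<open>E\<^sub>0, \<dots>, E\<^sub>k\<^sub>-\<^sub>1\<close> after blowing up \<open>P\<^sub>0, \<dots>, P\<^sub>k\<^sub>-\<^sub>1\<close>.  The exceptional curves are smooth and meet
  transversally, in at most one point.
\<close>

primrec exc_self_int :: "series2 \<Rightarrow> nat \<Rightarrow> nat \<Rightarrow> int" where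
  "exc_self_int f 0 v = 0"
| "exc_self_int f (Suc k) v =
     (if v = k then - 1 else exc_self_int f k v - (if passes_through f k v then 1 else 0))"

primrec exc_meet :: "series2 \<Rightarrow> nat \<Rightarrow> nat \<Rightarrow> nat \<Rightarrow> bool" where
  "exc_meet f 0 v w \<longleftrightarrow> False"
| "exc_meet f (Suc k) v w \<longleftrightarrow>
     (if v = k then passes_through f k w
      else if w = k then passes_through f k v
      else exc_meet f k v w \<and> \<not> (passes_through f k v \<and> passes_through f k w))"

definition resolution_graph :: "series2 \<Rightarrow> nat plumbing" where
  "resolution_graph f =
     \<lparr>verts = {..<blow_up_count f},
      euler_number = exc_self_int f (blow_up_count f),
      adjacent = exc_meet f (blow_up_count f)\<rparr>"

definition minus_one_vertex :: "'v plumbing \<Rightarrow> 'v" where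
  "minus_one_vertex G = (THE v. v \<in> verts G \<and> euler_number G v = - 1)"

text \<open>Multiplicity of the pull-back of \<open>f\<close> along \<open>E\<^sub>v\<close>, computed at the point \<open>P\<^sub>v\<^sub>+\<^sub>1\<close> of \<open>E\<^sub>v\<close>.\<close>

definition pullback_mult :: "series2 \<Rightarrow> nat \<Rightarrow> nat" where
  "pullback_mult f v = (GREATEST n. exc_eq f (Suc v) v ^ n dvd total_eq f (Suc v))"

section \<open>The plumbing graph of the surgery\<close>

text \<open>A connected sum of algebraic knots is given by the list of the germs of its summands.\<close>

datatype vertex = Plus | Exc nat nat

definition surgery_graph :: "int \<Rightarrow> series2 list \<Rightarrow> vertex plumbing" where
  "surgery_graph d fs =
     \<lparr>verts = insert Plus {Exc i v |i v. i < length fs \<and> v \<in> verts (resolution_graph (fs ! i))},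
      euler_number = (\<lambda>p. case p of
          Plus \<Rightarrow> - d - (\<Sum>f\<leftarrow>fs. int (pullback_mult f (minus_one_vertex (resolution_graph f))))
        | Exc i v \<Rightarrow> euler_number (resolution_graph (fs ! i)) v),
      adjacent = (\<lambda>p q. case (p, q) of
          (Plus, Plus) \<Rightarrow> False
        | (Plus, Exc i v) \<Rightarrow> v = minus_one_vertex (resolution_graph (fs ! i))
        | (Exc i v, Plus) \<Rightarrow> v = minus_one_vertex (resolution_graph (fs ! i))
        | (Exc i v, Exc j w) \<Rightarrow> i = j \<and> adjacent (resolution_graph (fs ! i)) v w)\<rparr>"

text \<open>
  \<open>lattice V\<close> is the free abelian group on the finite set \<open>V\<close> (integral functions vanishing
  off \<open>V\<close>), and \<open>lattice_rat V\<close> its tensor product with the rationals.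
\<close>

definition lattice :: "'v set \<Rightarrow> ('v \<Rightarrow> int) set" where
  "lattice V = {l. \<forall>v. v \<notin> V \<longrightarrow> l v = 0}"

definition lattice_rat :: "'v set \<Rightarrow> ('v \<Rightarrow> rat) set" where
  "lattice_rat V = {l. \<forall>v. v \<notin> V \<longrightarrow> l v = 0}"

definition basis_rat :: "'v \<Rightarrow> 'v \<Rightarrow> rat" where
  "basis_rat v = (\<lambda>u. if u = v then 1 else 0)"

definition intersection_form :: "'v plumbing \<Rightarrow> ('v \<Rightarrow> rat) \<Rightarrow> ('v \<Rightarrow> rat) \<Rightarrow> rat" where
  "intersection_form G x y =
     (\<Sum>v\<in>verts G. \<Sum>w\<in>verts G. x v * y w *
        (if v = w then of_int (euler_number G v) else if adjacent G v w then 1 else 0))"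

definition canonical_class :: "'v plumbing \<Rightarrow> 'v \<Rightarrow> rat" where
  "canonical_class G = (THE k. k \<in> lattice_rat (verts G) \<and>
     (\<forall>v\<in>verts G. intersection_form G k (basis_rat v)
        = - intersection_form G (basis_rat v) (basis_rat v) - 2))"

definition dual_vertex :: "'v plumbing \<Rightarrow> 'v \<Rightarrow> 'v \<Rightarrow> rat" where
  "dual_vertex G u = (THE k. k \<in> lattice_rat (verts G) \<and>
     (\<forall>v\<in>verts G. intersection_form G k (basis_rat v) = (if v = u then - 1 else 0)))"

text \<open>
  The rational number inside the floor is an integer, because \<open>(l, l + K)\<close> is even for the
  canonical class \<open>K\<close>; the floor only changes the type.
\<close>

definition spinc_weight :: "'v plumbing \<Rightarrow> 'v \<Rightarrow> int \<Rightarrow> ('v \<Rightarrow> int) \<Rightarrow> int" where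
  "spinc_weight G u a l =
     \<lfloor>- (1 / 2) * intersection_form G (\<lambda>v. of_int (l v))
        (\<lambda>v. of_int (l v) + canonical_class G v + 2 * of_int a * dual_vertex G u v)\<rfloor>"

section \<open>Singular cohomology in degree zero\<close>

definition cochain_group :: "nat \<Rightarrow> 'a topology \<Rightarrow> ('a chain \<Rightarrow> int) monoid" where
  "cochain_group p X =
     \<lparr>carrier = hom (chain_group p X) integer_group \<inter> extensional (singular_chain_set p X),
      monoid.mult = (\<lambda>\<phi> \<psi>. \<lambda>c\<in>singular_chain_set p X. \<phi> c + \<psi> c),
      one = (\<lambda>c\<in>singular_chain_set p X. 0)\<rparr>"

definition coboundary :: "nat \<Rightarrow> 'a topology \<Rightarrow> ('a chain \<Rightarrow> int) \<Rightarrow> 'a chain \<Rightarrow> int" where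
  "coboundary p X \<phi> = (\<lambda>c\<in>singular_chain_set (Suc p) X. \<phi> (chain_boundary (Suc p) c))"

text \<open>There are no coboundaries in degree 0, so that \<open>H\<^sup>0(X, \<int>)\<close> is the group of cocycles.\<close>

definition cohomology0 :: "'a topology \<Rightarrow> ('a chain \<Rightarrow> int) monoid" where
  "cohomology0 X = cochain_group 0 X
     \<lparr>carrier := kernel (cochain_group 0 X) (cochain_group 1 X) (coboundary 0 X)\<rparr>"

text \<open>The coboundaries of degree 0 in the augmented cochain complex.\<close>

definition augmentation_cochains :: "'a topology \<Rightarrow> ('a chain \<Rightarrow> int) set" where
  "augmentation_cochains X =
     range (\<lambda>k. \<lambda>c\<in>singular_chain_set 0 X. k * (\<Sum>s\<in>Poly_Mapping.keys c. Poly_Mapping.lookup c s))"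

definition reduced_cohomology0 :: "'a topology \<Rightarrow> ('a chain \<Rightarrow> int) set monoid" where
  "reduced_cohomology0 X = cohomology0 X Mod augmentation_cochains X"

text \<open>Rank of an abelian group, provided that it is finite.\<close>

definition int_independent :: "('a, 'b) monoid_scheme \<Rightarrow> 'a set \<Rightarrow> bool" where
  "int_independent G B \<longleftrightarrow> finite B \<and> B \<subseteq> carrier G \<and>
     (\<forall>c :: 'a \<Rightarrow> int. finprod G (\<lambda>x. x [^]\<^bsub>G\<^esub> c x) B = \<one>\<^bsub>G\<^esub> \<longrightarrow> (\<forall>x\<in>B. c x = 0))"

definition abelian_rank :: "('a, 'b) monoid_scheme \<Rightarrow> nat" where
  "abelian_rank G = Sup {card B |B. int_independent G B}"

section \<open>Lattice cohomology in degree zero\<close>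

text \<open>A weight function \<open>w\<close> on \<open>lattice V\<close>; it is assumed to be bounded below throughout.\<close>

definition cube :: "('v \<Rightarrow> int) \<Rightarrow> 'v set \<Rightarrow> ('v \<Rightarrow> real) set" where
  "cube l I = {x. (\<forall>v\<in>I. of_int (l v) \<le> x v \<and> x v \<le> of_int (l v) + 1) \<and>
                  (\<forall>v. v \<notin> I \<longrightarrow> x v = of_int (l v))}"

definition cube_weight :: "(('v \<Rightarrow> int) \<Rightarrow> int) \<Rightarrow> ('v \<Rightarrow> int) \<Rightarrow> 'v set \<Rightarrow> int" where
  "cube_weight w l I = Max ((\<lambda>J. w (\<lambda>v. l v + (if v \<in> J then 1 else 0))) ` Pow I)"

definition sublevel :: "'v set \<Rightarrow> (('v \<Rightarrow> int) \<Rightarrow> int) \<Rightarrow> int \<Rightarrow> ('v \<Rightarrow> real) topology" where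
  "sublevel V w n = subtopology (powertop_real UNIV)
     (\<Union>{cube l I |l I. l \<in> lattice V \<and> I \<subseteq> V \<and> cube_weight w l I \<le> n})"

definition min_weight :: "'v set \<Rightarrow> (('v \<Rightarrow> int) \<Rightarrow> int) \<Rightarrow> int" where
  "min_weight V w = (LEAST n. n \<in> w ` lattice V)"

definition lattice_cohomology0 ::
    "'v set \<Rightarrow> (('v \<Rightarrow> int) \<Rightarrow> int) \<Rightarrow> (int \<Rightarrow> ('v \<Rightarrow> real) chain \<Rightarrow> int) monoid" where
  "lattice_cohomology0 V w =
     sum_group {min_weight V w..} (\<lambda>n. cohomology0 (sublevel V w n))"

definition U_action ::
    "'v set \<Rightarrow> (('v \<Rightarrow> int) \<Rightarrow> int) \<Rightarrow> (int \<Rightarrow> ('v \<Rightarrow> real) chain \<Rightarrow> int)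
      \<Rightarrow> (int \<Rightarrow> ('v \<Rightarrow> real) chain \<Rightarrow> int)" where
  "U_action V w x =
     (\<lambda>n\<in>{min_weight V w..}. restrict (x (n + 1)) (singular_chain_set 0 (sublevel V w n)))"

definition homogeneous_part ::
    "'v set \<Rightarrow> (('v \<Rightarrow> int) \<Rightarrow> int) \<Rightarrow> int \<Rightarrow> (int \<Rightarrow> ('v \<Rightarrow> real) chain \<Rightarrow> int) set" where
  "homogeneous_part V w n = {x \<in> carrier (lattice_cohomology0 V w).
     \<forall>m\<in>{min_weight V w..}. m \<noteq> n \<longrightarrow> x m = \<one>\<^bsub>cohomology0 (sublevel V w m)\<^esub>}"

text \<open>
  Isomorphism of graded modules over the polynomial ring in \<open>U\<close> with integer coefficients: an
  additive bijection which commutes with \<open>U\<close> and preserves the grading.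
\<close>

definition lattice_cohomology0_isomorphic ::
    "'u set \<Rightarrow> (('u \<Rightarrow> int) \<Rightarrow> int) \<Rightarrow> 'v set \<Rightarrow> (('v \<Rightarrow> int) \<Rightarrow> int) \<Rightarrow> bool" where
  "lattice_cohomology0_isomorphic V w V' w' \<longleftrightarrow>
     (\<exists>F \<in> iso (lattice_cohomology0 V w) (lattice_cohomology0 V' w').
        (\<forall>x\<in>carrier (lattice_cohomology0 V w). F (U_action V w x) = U_action V' w' (F x)) \<and>
        (\<forall>n. F ` homogeneous_part V w n = homogeneous_part V' w' n))"

definition reduced_lattice_cohomology0 ::
    "'v set \<Rightarrow> (('v \<Rightarrow> int) \<Rightarrow> int) \<Rightarrow> (int \<Rightarrow> (('v \<Rightarrow> real) chain \<Rightarrow> int) set) monoid" where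
  "reduced_lattice_cohomology0 V w =
     sum_group {min_weight V w..} (\<lambda>n. reduced_cohomology0 (sublevel V w n))"

definition eu0 :: "'v set \<Rightarrow> (('v \<Rightarrow> int) \<Rightarrow> int) \<Rightarrow> int" where
  "eu0 V w = - min_weight V w + int (abelian_rank (reduced_lattice_cohomology0 V w))"

definition surgery_verts :: "int \<Rightarrow> series2 list \<Rightarrow> vertex set" where
  "surgery_verts d fs = verts (surgery_graph d fs)"

definition surgery_weight :: "int \<Rightarrow> series2 list \<Rightarrow> int \<Rightarrow> (vertex \<Rightarrow> int) \<Rightarrow> int" where
  "surgery_weight d fs a = spinc_weight (surgery_graph d fs) Plus a"

end

theory Submission
  imports Defs
begin

text \<open>
  The proof computes the weight function in the basis of total transforms.  Let \<open>P\<^sub>k\<close> be the points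
  blown up in the resolutions of all the germs, let \<open>n\<^sub>k\<close> be the multiplicity of the strict transform
  at \<open>P\<^sub>k\<close>, and let \<open>e\<^sub>k\<close> be the total transform of the exceptional curve created at \<open>P\<^sub>k\<close>.  Then
  \<open>E\<^sub>v = e\<^sub>v - \<Sum> e\<^sub>k\<close>, where the sum runs over the points \<open>P\<^sub>k\<close> on the strict transforms of \<open>E\<^sub>v\<close>.  The
  vertex \<open>E\<^sub>+\<close> has the same intersection numbers with the other vertices as the strict transform of the
  germs, so that \<open>E\<^sub>+ = e\<^sub>+ - \<Sum> n\<^sub>k e\<^sub>k\<close> for a vector \<open>e\<^sub>+\<close> orthogonal to all \<open>e\<^sub>k\<close>; moreover
  \<open>e\<^sub>+\<^sup>2 = - d\<close> because the multiplicities \<open>m\<^sub>i\<close> add up to \<open>\<Sum> n\<^sub>k\<^sup>2\<close>.  In this basis the weight of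
  \<open>x e\<^sub>+ + \<Sum> y\<^sub>k e\<^sub>k\<close> is \<open>A(x) + \<Sum> T(y\<^sub>k)\<close> with \<open>T(y) = y (y + 1) / 2\<close>, where \<open>A\<close> depends only on \<open>d\<close>,
  on \<open>a\<close> and on \<open>\<Sum> n\<^sub>k (n\<^sub>k - 1)\<close> (lemma \<open>surgery_weight_eq\<close>).

  Among the steps \<open>\<plusminus>E\<^sub>v\<close> between lattice points, only \<open>\<plusminus>E\<^sub>+\<close> changes \<open>x\<close>.  For fixed \<open>x\<close>, the points of
  weight at most \<open>n\<close> are connected by the other steps (lemma \<open>slice_connected\<close>), for the sole reason
  that the matrix of the \<open>E\<^sub>v\<close> in the basis \<open>e\<^sub>k\<close> is unitriangular with entries \<open>0\<close> and \<open>-1\<close> off the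
  diagonal.  Hence the components of the sublevel set \<open>S\<^sub>n\<close> are those of a graph on the integers
  \<open>x\<close> with \<open>A(x) \<le> n\<close>, in which \<open>x\<close> and \<open>x + 1\<close> are joined if some \<open>y\<close> satisfies both
  \<open>A(x) + \<Sum> T(y\<^sub>k) \<le> n\<close> and \<open>A(x + 1) + \<Sum> T(y\<^sub>k - n\<^sub>k) \<le> n\<close>.  An index with \<open>n\<^sub>k = 1\<close> can be dropped from
  this condition, as \<open>T(0) = T(-1) = 0\<close>.  So the graph depends only on the multiset of all \<open>n\<^sub>k > 1\<close>.
  A cocycle of degree \<open>0\<close> is a function which is constant along paths, so the groups
  \<open>H\<^sup>0(S\<^sub>n)\<close> with their restriction maps, and also the reduced ones, are determined by these graphs (lemma
  \<open>two_line_reductions\<close>), and the minimum of the weight is the minimum of \<open>A\<close>.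

  The change of basis rests on three facts on an irreducible germ.  It has a single tangent
  and its strict transform is irreducible (lemma \<open>blowup_factor\<close>); its multiplicities decrease to \<open>1\<close>
  (lemma \<open>multiplicity_eventually_1\<close>), so that the resolution ends; and \<open>n\<^sub>v\<close> is the sum
  of the \<open>n\<^sub>k\<close> over the points \<open>P\<^sub>k\<close> on \<open>E\<^sub>v\<close>, plus \<open>1\<close> for the last curve (lemma \<open>proximity_end\<close>), because
  this difference is the intersection number of the strict transform with \<open>E\<^sub>v\<close>.  The first two facts
  follow from Weierstrass division for convergent power series.
\<close>

section \<open>Convergent power series in two variables\<close>

text \<open>
  Partial sums suffice in all estimates of Cauchy products: on the left, the summation runs over
  the triangle \<open>k + j < n\<close>, on the right over the whole square.
\<close>

lemma conv_sum_le:
  fixes F :: "nat \<Rightarrow> nat \<Rightarrow> ennreal"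
  shows "(\<Sum>i<n. \<Sum>k\<le>i. F k (i - k)) \<le> (\<Sum>k<n. \<Sum>j<n. F k j)"
proof -
  have "(\<Sum>i<n. \<Sum>k\<le>i. F k (i - k)) = (\<Sum>(i,k)\<in>(SIGMA i:{..<n}. {..i}). F k (i - k))"
    by (simp add: sum.Sigma)
  also have "\<dots> = (\<Sum>(k,j)\<in>(\<lambda>(i,k). (k, i - k)) ` (SIGMA i:{..<n}. {..i}). F k j)"
    by (subst sum.reindex) (auto simp: inj_on_def intro!: sum.cong)
  also have "\<dots> \<le> (\<Sum>(k,j)\<in>{..<n} \<times> {..<n}. F k j)"
    by (rule sum_mono2) auto
  also have "\<dots> = (\<Sum>k<n. \<Sum>j<n. F k j)"
    by (simp add: sum.Sigma)
  finally show ?thesis .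
qed

lemma conv_partial_le:
  fixes a b :: "nat \<Rightarrow> ennreal"
  shows "(\<Sum>i<n. \<Sum>k\<le>i. a k * b (i - k)) \<le> suminf a * (\<Sum>j<n. b j)"
proof -
  have "(\<Sum>i<n. \<Sum>k\<le>i. a k * b (i - k)) \<le> (\<Sum>k<n. \<Sum>j<n. a k * b j)"
    by (rule conv_sum_le)
  also have "\<dots> = (\<Sum>k<n. a k) * (\<Sum>j<n. b j)"
    by (simp add: sum_product)
  also have "\<dots> \<le> suminf a * (\<Sum>j<n. b j)"
    by (intro mult_right_mono sum_le_suminf summableI) auto
  finally show ?thesis .
qed

lemma suminf_conv_le:
  fixes a b :: "nat \<Rightarrow> ennreal"
  shows "suminf (\<lambda>i. \<Sum>k\<le>i. a k * b (i - k)) \<le> suminf a * suminf b"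
proof (rule suminf_le_const[OF summableI])
  fix n
  have "(\<Sum>i<n. \<Sum>k\<le>i. a k * b (i - k)) \<le> suminf a * (\<Sum>j<n. b j)"
    by (rule conv_partial_le)
  also have "\<dots> \<le> suminf a * suminf b"
    by (intro mult_left_mono sum_le_suminf summableI) auto
  finally show "(\<Sum>i<n. \<Sum>k\<le>i. a k * b (i - k)) \<le> suminf a * suminf b" .
qed

text \<open>
  All power series below whose convergence is not obvious are solutions of a linear recursion.
  Write \<open>S\<close> and \<open>H\<close> for the two finite sums and \<open>B n\<close> for the sum of \<open>b i * r ^ i\<close> over \<open>i < n\<close>.
  The recursion gives \<open>B (n + 1) \<le> S + r * H * B n\<close>, so that \<open>B n \<le> 2 * S\<close> is inherited by \<open>n + 1\<close>
  as soon as \<open>r * H \<le> 1 / 2\<close>.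
\<close>

lemma majorant_recursion:
  fixes b s h :: "nat \<Rightarrow> ennreal"
  assumes b0: "b 0 \<le> s 0"
    and rec: "\<And>i. b (Suc i) \<le> s (Suc i) + (\<Sum>k\<le>i. h k * b (i - k))"
    and S: "suminf (\<lambda>i. s i * r0 ^ i) < \<infinity>" and H: "suminf (\<lambda>k. h k * r0 ^ k) < \<infinity>"
    and r0: "0 < r0" "r0 < \<infinity>"
  shows "\<exists>r. 0 < r \<and> r \<le> r0 \<and> suminf (\<lambda>i. b i * r ^ i) < \<infinity>"
proof -
  define S H where "S = suminf (\<lambda>i. s i * r0 ^ i)" and "H = suminf (\<lambda>k. h k * r0 ^ k)"
  obtain C where C: "H = ennreal C" "C \<ge> 0"
    using H unfolding H_def by (cases "suminf (\<lambda>k. h k * r0 ^ k)") auto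
  define r where "r = min r0 (ennreal (1 / (2 * C + 2)))"
  have r: "0 < r" "r \<le> r0" "r < \<infinity>"
    using r0 C by (auto simp: r_def min_less_iff_disj)
  have "r * H \<le> ennreal (1 / (2 * C + 2)) * H"
    by (intro mult_right_mono) (auto simp: r_def)
  also have "\<dots> = ennreal (1 / (2 * C + 2) * C)"
    using C by (subst ennreal_mult) auto
  also have "\<dots> \<le> ennreal (1/2)"
    using C by (intro ennreal_leI) (simp add: field_simps)
  finally have rH: "r * H \<le> ennreal (1/2)" .
  have rr: "r ^ n \<le> r0 ^ n" for n
    using r by (intro power_mono) auto
  have Sr: "(\<Sum>i<n. s i * r ^ i) \<le> S" for n
  proof -
    have "(\<Sum>i<n. s i * r ^ i) \<le> (\<Sum>i<n. s i * r0 ^ i)"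
      by (intro sum_mono mult_left_mono rr) auto
    also have "\<dots> \<le> S"
      unfolding S_def by (intro sum_le_suminf summableI) auto
    finally show ?thesis .
  qed
  have Hr: "suminf (\<lambda>k. h k * r ^ k) \<le> H"
    unfolding H_def by (intro suminf_le summableI mult_left_mono rr) auto
  have bound: "(\<Sum>i<n. b i * r ^ i) \<le> 2 * S" for n
  proof (induction n)
    case 0 then show ?case by simp
  next
    case (Suc n)
    have "(\<Sum>i<Suc n. b i * r ^ i) = b 0 + (\<Sum>i<n. b (Suc i) * r ^ Suc i)"
      by (subst sum.lessThan_Suc_shift) simp
    also have "\<dots> \<le> s 0 + (\<Sum>i<n. (s (Suc i) + (\<Sum>k\<le>i. h k * b (i - k))) * r ^ Suc i)"
      by (intro add_mono sum_mono mult_right_mono b0 rec) auto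
    also have "\<dots> = (s 0 + (\<Sum>i<n. s (Suc i) * r ^ Suc i))
                 + (\<Sum>i<n. (\<Sum>k\<le>i. h k * b (i - k)) * r ^ Suc i)"
      by (simp add: distrib_right sum.distrib add.assoc)
    also have "s 0 + (\<Sum>i<n. s (Suc i) * r ^ Suc i) = (\<Sum>i<Suc n. s i * r ^ i)"
      by (subst sum.lessThan_Suc_shift) simp
    also have "(\<Sum>i<n. (\<Sum>k\<le>i. h k * b (i - k)) * r ^ Suc i)
        = r * (\<Sum>i<n. \<Sum>k\<le>i. (h k * r ^ k) * (b (i - k) * r ^ (i - k)))"
    proof -
      have *: "(h k * b (i - k)) * r ^ Suc i = r * ((h k * r ^ k) * (b (i - k) * r ^ (i - k)))" 
        if "k \<le> i" for i k
      proof -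
        have "r ^ Suc i = r * (r ^ k * r ^ (i - k))"
          using that by (simp flip: power_add)
        then show ?thesis by (simp add: mult_ac)
      qed
      show ?thesis
        by (auto simp only: sum_distrib_left sum_distrib_right * intro!: sum.cong)
    qed
    also have "\<dots> \<le> r * (H * (2 * S))"
    proof -
      have "(\<Sum>i<n. \<Sum>k\<le>i. (h k * r ^ k) * (b (i - k) * r ^ (i - k)))
         \<le> suminf (\<lambda>k. h k * r ^ k) * (\<Sum>j<n. b j * r ^ j)"
        by (rule conv_partial_le)
      also have "\<dots> \<le> H * (2 * S)"
        by (intro mult_mono Hr Suc.IH) auto
      finally show ?thesis by (intro mult_left_mono) auto
    qed
    also have "\<dots> = (r * H) * (2 * S)" by (simp add: mult_ac)
    also have "\<dots> \<le> ennreal (1/2) * (2 * S)" by (intro mult_right_mono rH) auto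
    also have "\<dots> = S"
    proof -
      have "ennreal (1/2) * 2 = ennreal (1/2 * 2)"
        by (subst ennreal_mult) auto
      then show ?thesis by (simp flip: mult.assoc)
    qed
    also have "(\<Sum>i<Suc n. s i * r ^ i) \<le> S" by (rule Sr)
    finally show ?case by (simp add: mult_2 add_mono)
  qed
  have "suminf (\<lambda>i. b i * r ^ i) \<le> 2 * S"
    by (intro suminf_le_const summableI bound)
  also have "\<dots> < \<infinity>" using S by (simp add: S_def ennreal_mult_less_top)
  finally show ?thesis using r by blast
qed

text \<open>
  The weighted sum of the absolute values of the coefficients, that is, a norm on the series which
  converge absolutely at radius \<open>s\<close>.  It takes values in the extended non-negative reals, so that no
  estimate needs a hypothesis of summability.
\<close>

definition fps_norm :: "ennreal \<Rightarrow> complex fps \<Rightarrow> ennreal" where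
  "fps_norm s u = suminf (\<lambda>j. ennreal (norm (u $ j)) * s ^ j)"

lemma fps_norm_mono: "s \<le> t \<Longrightarrow> fps_norm s u \<le> fps_norm t u"
  unfolding fps_norm_def by (intro suminf_le summableI mult_left_mono power_mono) auto

lemma fps_norm_0 [simp]: "fps_norm s 0 = 0"
  by (simp add: fps_norm_def)

lemma fps_norm_add: "fps_norm s (u + v) \<le> fps_norm s u + fps_norm s v"
proof -
  have "fps_norm s (u + v) \<le> suminf (\<lambda>j. ennreal (norm (u $ j)) * s ^ j + ennreal (norm (v $ j)) * s ^ j)"
    unfolding fps_norm_def
    by (intro suminf_le summableI)
       (auto simp flip: distrib_right ennreal_plus intro!: mult_right_mono ennreal_leI norm_triangle_ineq)
  also have "\<dots> = fps_norm s u + fps_norm s v"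
    unfolding fps_norm_def by (rule suminf_add[symmetric]) (auto intro: summableI)
  finally show ?thesis .
qed

lemma fps_norm_uminus [simp]: "fps_norm s (- u) = fps_norm s u"
  by (simp add: fps_norm_def)

lemma fps_norm_diff: "fps_norm s (u - v) \<le> fps_norm s u + fps_norm s v"
  using fps_norm_add[of s u "- v"] by simp

lemma fps_norm_sum: "fps_norm s (\<Sum>i\<in>A. f i) \<le> (\<Sum>i\<in>A. fps_norm s (f i))"
  by (induction A rule: infinite_finite_induct)
     (auto intro: order_trans[OF fps_norm_add] add_left_mono)

lemma fps_norm_mult: "fps_norm s (u * v) \<le> fps_norm s u * fps_norm s v"
proof -
  have "ennreal (norm ((u * v) $ i)) * s ^ i
      \<le> (\<Sum>k\<le>i. (ennreal (norm (u $ k)) * s ^ k) * (ennreal (norm (v $ (i - k))) * s ^ (i - k)))" for i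
  proof -
    have "norm ((u * v) $ i) \<le> (\<Sum>k\<le>i. norm (u $ k) * norm (v $ (i - k)))"
      unfolding fps_mult_nth atLeast0AtMost
      by (rule order_trans[OF norm_sum]) (simp add: norm_mult)
    then have "ennreal (norm ((u * v) $ i)) \<le> ennreal (\<Sum>k\<le>i. norm (u $ k) * norm (v $ (i - k)))"
      by (rule ennreal_leI)
    also have "\<dots> = (\<Sum>k\<le>i. ennreal (norm (u $ k)) * ennreal (norm (v $ (i - k))))"
      by (subst sum_ennreal[symmetric]) (auto simp: ennreal_mult)
    finally have "ennreal (norm ((u * v) $ i)) * s ^ i
        \<le> (\<Sum>k\<le>i. ennreal (norm (u $ k)) * ennreal (norm (v $ (i - k)))) * s ^ i"
      by (rule mult_right_mono) auto
    also have "\<dots> = (\<Sum>k\<le>i. (ennreal (norm (u $ k)) * s ^ k) * (ennreal (norm (v $ (i - k))) * s ^ (i - k)))"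
      unfolding sum_distrib_right
    proof (rule sum.cong, goal_cases)
      case (2 k)
      then have "s ^ i = s ^ k * s ^ (i - k)" by (simp flip: power_add)
      then show ?case by (simp add: mult_ac)
    qed simp
    finally show ?thesis .
  qed
  then have "fps_norm s (u * v) \<le> suminf (\<lambda>i. \<Sum>k\<le>i. (ennreal (norm (u $ k)) * s ^ k) * (ennreal (norm (v $ (i - k))) * s ^ (i - k)))"
    unfolding fps_norm_def by (intro suminf_le summableI) auto
  also have "\<dots> \<le> fps_norm s u * fps_norm s v"
    unfolding fps_norm_def by (rule suminf_conv_le)
  finally show ?thesis .
qed

lemma suminf_shift_le:
  fixes a :: "nat \<Rightarrow> ennreal"
  assumes "0 < s" "s < \<infinity>"
  shows "suminf (\<lambda>j. a (j + q) * s ^ j) \<le> suminf (\<lambda>j. a j * s ^ j) / s ^ q" (is "?A \<le> ?B / _")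
proof -
  have "s ^ q * ?A = suminf (\<lambda>j. a (j + q) * s ^ (j + q))"
    by (simp add: power_add mult_ac flip: ennreal_suminf_cmult)
  also have "\<dots> \<le> ?B"
    by (subst (2) suminf_offset[of _ q]) (auto intro: summableI)
  finally have "?A * s ^ q / s ^ q \<le> ?B / s ^ q"
    by (intro divide_right_mono_ennreal) (simp add: mult.commute)
  moreover have "?A * s ^ q / s ^ q = ?A"
    using assms by (intro ennreal_mult_divide_eq) (auto simp: power_eq_top_ennreal_iff)
  ultimately show ?thesis by simp
qed

lemma fps_norm_shift:
  assumes "0 < s" "s < \<infinity>"
  shows "fps_norm s (fps_shift q u) \<le> fps_norm s u / s ^ q"
  using suminf_shift_le[OF assms, of "\<lambda>j. ennreal (norm (u $ j))" q] by (simp add: fps_norm_def)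

lemma fps_norm_const [simp]: "fps_norm s (fps_const c) = ennreal (norm c)"
proof -
  have "fps_norm s (fps_const c) = (\<Sum>j\<in>{0}. ennreal (norm (fps_const c $ j)) * s ^ j)"
    unfolding fps_norm_def by (rule suminf_finite) auto
  then show ?thesis by simp
qed

lemma fps_norm_1 [simp]: "fps_norm s 1 = 1"
  using fps_norm_const[of s 1] by simp

lemma fps_norm_X [simp]: "fps_norm s fps_X = s"
proof -
  have "fps_norm s fps_X = (\<Sum>j\<in>{1}. ennreal (norm (fps_X $ j :: complex)) * s ^ j)"
    unfolding fps_norm_def by (rule suminf_finite) auto
  then show ?thesis by simp
qed

lemma fps_norm_power: "fps_norm s (u ^ n) \<le> fps_norm s u ^ n"
  proof (induction n)
  case (Suc n)
  have "fps_norm s (u * u ^ n) \<le> fps_norm s u * fps_norm s (u ^ n)" by (rule fps_norm_mult)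
  also have "\<dots> \<le> fps_norm s u * fps_norm s u ^ n" by (intro mult_left_mono Suc.IH) auto
  finally show ?case by simp
qed simp

text \<open>
  Comparing coefficients in \<open>u * inverse u = 1\<close> expresses each coefficient of the inverse through the
  previous ones, by a recursion to which \<open>majorant_recursion\<close> applies.
\<close>

lemma inverse_norm_finite:
  assumes u: "fps_norm s u < \<infinity>" "u $ 0 \<noteq> 0" and s: "0 < s" "s < \<infinity>"
  shows "\<exists>r. 0 < r \<and> r \<le> s \<and> fps_norm r (inverse u) < \<infinity>"
proof -
  define c where "c = ennreal (norm (inverse (u $ 0)))"
  have "\<exists>r. 0 < r \<and> r \<le> s \<and> suminf (\<lambda>i. ennreal (norm (inverse u $ i)) * r ^ i) < \<infinity>"
  proof (rule majorant_recursion[where s = "\<lambda>i. if i = 0 then c else 0" and h = "\<lambda>k. c * ennreal (norm (u $ Suc k))"])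
    show "ennreal (norm (inverse u $ 0)) \<le> (if (0::nat) = 0 then c else 0)"
      by (simp add: c_def)
  next
    fix i
    have "inverse u * u = 1" using u by (simp add: inverse_mult_eq_1)
    then have "0 = (u * inverse u) $ Suc i" by (simp add: mult.commute)
    also have "\<dots> = (\<Sum>k\<le>Suc i. u $ k * inverse u $ (Suc i - k))"
      by (simp add: fps_mult_nth atLeast0AtMost)
    also have "\<dots> = u $ 0 * inverse u $ Suc i + (\<Sum>k\<le>i. u $ Suc k * inverse u $ (i - k))"
      by (subst sum.atMost_Suc_shift) simp
    finally have "inverse u $ Suc i = - inverse (u $ 0) * (\<Sum>k\<le>i. u $ Suc k * inverse u $ (i - k))"
      using u by (simp add: field_simps eq_neg_iff_add_eq_0)
    then have "norm (inverse u $ Suc i) \<le> norm (inverse (u $ 0)) * (\<Sum>k\<le>i. norm (u $ Suc k) * norm (inverse u $ (i - k)))"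
      by (simp add: norm_mult norm_inverse) 
         (intro mult_left_mono order_trans[OF norm_sum], auto simp: norm_mult)
    then have "ennreal (norm (inverse u $ Suc i)) \<le> ennreal (norm (inverse (u $ 0)) * (\<Sum>k\<le>i. norm (u $ Suc k) * norm (inverse u $ (i - k))))"
      by (rule ennreal_leI)
    also have "\<dots> = c * (\<Sum>k\<le>i. ennreal (norm (u $ Suc k)) * ennreal (norm (inverse u $ (i - k))))"
      by (auto simp: c_def ennreal_mult sum_nonneg simp flip: sum_ennreal)
    finally show "ennreal (norm (inverse u $ Suc i)) \<le> (if Suc i = 0 then c else 0) + 
        (\<Sum>k\<le>i. c * ennreal (norm (u $ Suc k)) * ennreal (norm (inverse u $ (i - k))))"
      by (simp add: sum_distrib_left mult_ac)
  next
    have "suminf (\<lambda>i. (if i = 0 then c else 0) * s ^ i) = (\<Sum>i\<in>{0}. (if i = 0 then c else 0) * s ^ i)"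
      by (rule suminf_finite) auto
    then show "suminf (\<lambda>i. (if i = 0 then c else 0) * s ^ i) < \<infinity>" by (simp add: c_def)
    have "suminf (\<lambda>k. c * ennreal (norm (u $ Suc k)) * s ^ k) = c * fps_norm s (fps_shift 1 u)"
      by (simp add: fps_norm_def mult.assoc flip: ennreal_suminf_cmult)
    also have "\<dots> \<le> c * (fps_norm s u / s ^ 1)"
      using s by (intro mult_left_mono fps_norm_shift) auto
    also have "\<dots> < \<infinity>"
    proof -
      have "fps_norm s u / s \<noteq> \<infinity>"
        using u s by (auto simp: ennreal_divide_eq_top_iff)
      then show ?thesis by (simp add: c_def ennreal_mult_less_top less_top)
    qed
    finally show "suminf (\<lambda>k. c * ennreal (norm (u $ Suc k)) * s ^ k) < \<infinity>" .
  qed (use s in auto)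
  then show ?thesis by (simp add: fps_norm_def)
qed

text \<open>
  The radii \<open>r\<close> for \<open>x\<close> and \<open>s\<close> for \<open>y\<close> are independent of each other, because Weierstrass division
  keeps \<open>s\<close> and shrinks \<open>r\<close>.
\<close>

definition germ_norm :: "ennreal \<Rightarrow> ennreal \<Rightarrow> series2 \<Rightarrow> ennreal" where
  "germ_norm r s f = suminf (\<lambda>i. fps_norm s (f $ i) * r ^ i)"

lemma germ_norm_mono: "r \<le> r' \<Longrightarrow> s \<le> s' \<Longrightarrow> germ_norm r s f \<le> germ_norm r' s' f"
  unfolding germ_norm_def by (intro suminf_le summableI mult_mono power_mono fps_norm_mono) auto

lemma convergent_iff:
  "convergent_series f \<longleftrightarrow> (\<exists>r s. 0 < r \<and> 0 < s \<and> r < \<infinity> \<and> s < \<infinity> \<and> germ_norm r s f < \<infinity>)"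
proof
  assume "convergent_series f"
  then obtain r where r: "r > 0" and
    sm: "(\<lambda>(i, j). norm (f $ i $ j) * r ^ (i + j)) summable_on (UNIV :: (nat \<times> nat) set)"
    unfolding convergent_series_def by blast
  let ?g = "\<lambda>(i, j). norm (f $ i $ j) * r ^ (i + j)"
  define B where "B = infsum ?g UNIV"
  have fin: "sum ?g F \<le> B" if "finite F" for F
    unfolding B_def by (rule finite_sum_le_infsum[OF sm that]) (use r in auto)
  have "germ_norm (ennreal r) (ennreal r) f \<le> ennreal B"
    unfolding germ_norm_def
  proof (rule suminf_le_const[OF summableI])
    fix n
    have "(\<Sum>i<n. fps_norm (ennreal r) (f $ i) * ennreal r ^ i)
        = (\<Sum>i<n. suminf (\<lambda>j. ennreal (norm (f $ i $ j) * r ^ (i + j))))"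
      using r by (auto simp: fps_norm_def ennreal_mult power_add ennreal_power mult_ac 
          simp flip: ennreal_suminf_multc intro!: sum.cong suminf_cong)
    also have "\<dots> = suminf (\<lambda>j. \<Sum>i<n. ennreal (norm (f $ i $ j) * r ^ (i + j)))"
      by (rule suminf_sum[symmetric]) (auto intro: summableI)
    also have "\<dots> \<le> ennreal B"
    proof (rule suminf_le_const[OF summableI])
      fix m
      have "(\<Sum>j<m. \<Sum>i<n. ennreal (norm (f $ i $ j) * r ^ (i + j)))
          = ennreal (\<Sum>j<m. \<Sum>i<n. norm (f $ i $ j) * r ^ (i + j))"
        using r by (simp add: sum_nonneg)
      also have "(\<Sum>j<m. \<Sum>i<n. norm (f $ i $ j) * r ^ (i + j)) = sum ?g ({..<n} \<times> {..<m})"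
        by (subst sum.swap) (simp add: sum.cartesian_product)
      also have "ennreal \<dots> \<le> ennreal B" by (intro ennreal_leI fin) auto
      finally show "(\<Sum>j<m. \<Sum>i<n. ennreal (norm (f $ i $ j) * r ^ (i + j))) \<le> ennreal B" .
    qed
    finally show "(\<Sum>i<n. fps_norm (ennreal r) (f $ i) * ennreal r ^ i) \<le> ennreal B" .
  qed
  also have "\<dots> < \<infinity>" by simp
  finally show "\<exists>r s. 0 < r \<and> 0 < s \<and> r < \<infinity> \<and> s < \<infinity> \<and> germ_norm r s f < \<infinity>"
    using r by (intro exI[of _ "ennreal r"]) auto
next
  assume "\<exists>r s. 0 < r \<and> 0 < s \<and> r < \<infinity> \<and> s < \<infinity> \<and> germ_norm r s f < \<infinity>"
  then obtain r' s' where rs: "0 < r'" "0 < s'" "r' < \<infinity>" "s' < \<infinity>" "germ_norm r' s' f < \<infinity>"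
    by blast
  then obtain r where r: "min r' s' = ennreal r" "r > 0"
    by (cases "min r' s'") (auto simp: min_def split: if_splits)
  have fin: "germ_norm (ennreal r) (ennreal r) f < \<infinity>"
    using germ_norm_mono[of "ennreal r" r' "ennreal r" s' f] rs r
    by (metis min.cobounded1 min.cobounded2 order_le_less_trans)
  then obtain B where B: "germ_norm (ennreal r) (ennreal r) f = ennreal B" "B \<ge> 0"
    by (cases "germ_norm (ennreal r) (ennreal r) f") auto
  let ?g = "\<lambda>(i, j). norm (f $ i $ j) * r ^ (i + j)"
  have "sum ?g F \<le> B" if "finite F" for F
  proof -
    obtain n where n: "F \<subseteq> {..<n} \<times> {..<n}"
    proof -
      have "finite (fst ` F \<union> snd ` F)" using \<open>finite F\<close> by simp
      then obtain n where "\<forall>x\<in>fst ` F \<union> snd ` F. x < n"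
        using finite_nat_set_iff_bounded by blast
      then show ?thesis by (intro that[of n]) force
    qed
    have "sum ?g F \<le> sum ?g ({..<n} \<times> {..<n})"
      by (rule sum_mono2[OF _ n]) (use r in auto)
    then have "ennreal (sum ?g F) \<le> ennreal (\<Sum>i<n. \<Sum>j<n. norm (f $ i $ j) * r ^ (i + j))"
      by (simp add: sum.cartesian_product ennreal_leI)
    also have "\<dots> = (\<Sum>i<n. (\<Sum>j<n. ennreal (norm (f $ i $ j)) * ennreal r ^ j) * ennreal r ^ i)"
    proof -
      have "(\<Sum>i<n. (\<Sum>j<n. ennreal (norm (f $ i $ j)) * ennreal r ^ j) * ennreal r ^ i)
         = (\<Sum>i<n. \<Sum>j<n. ennreal (norm (f $ i $ j) * r ^ (i + j)))"
        using r unfolding sum_distrib_right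
        by (intro sum.cong) (auto simp: ennreal_mult power_add ennreal_power mult_ac)
      then show ?thesis using r by (simp add: sum_nonneg)
    qed
    also have "\<dots> \<le> (\<Sum>i<n. fps_norm (ennreal r) (f $ i) * ennreal r ^ i)"
      unfolding fps_norm_def
      by (intro sum_mono mult_right_mono sum_le_suminf summableI) auto
    also have "\<dots> \<le> ennreal B"
      unfolding B(1)[symmetric] germ_norm_def by (intro sum_le_suminf summableI) auto
    finally show ?thesis using B by simp
  qed
  then have "?g summable_on UNIV"
    by (intro nonneg_bdd_above_summable_on bdd_aboveI[of _ B]) (use r in auto)
  then show "convergent_series f"
    unfolding convergent_series_def using r by blast
qed

lemma germ_norm_add: "germ_norm r s (f + g) \<le> germ_norm r s f + germ_norm r s g"
proof -
  have "germ_norm r s (f + g) \<le> suminf (\<lambda>i. fps_norm s (f $ i) * r ^ i + fps_norm s (g $ i) * r ^ i)"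
    unfolding germ_norm_def
    by (intro suminf_le summableI) (auto simp flip: distrib_right intro!: mult_right_mono fps_norm_add)
  also have "\<dots> = germ_norm r s f + germ_norm r s g"
    unfolding germ_norm_def by (rule suminf_add[symmetric]) (auto intro: summableI)
  finally show ?thesis .
qed

lemma germ_norm_uminus: "germ_norm r s (- f) = germ_norm r s f"
  by (simp add: germ_norm_def)

lemma germ_norm_mult: "germ_norm r s (f * g) \<le> germ_norm r s f * germ_norm r s g"
proof -
  have "fps_norm s ((f * g) $ i) * r ^ i
     \<le> (\<Sum>k\<le>i. (fps_norm s (f $ k) * r ^ k) * (fps_norm s (g $ (i - k)) * r ^ (i - k)))" for i
  proof -
    have "fps_norm s ((f * g) $ i) \<le> (\<Sum>k\<le>i. fps_norm s (f $ k) * fps_norm s (g $ (i - k)))"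
      unfolding fps_mult_nth atLeast0AtMost
      by (intro order_trans[OF fps_norm_sum] sum_mono fps_norm_mult)
    then have "fps_norm s ((f * g) $ i) * r ^ i \<le> (\<Sum>k\<le>i. fps_norm s (f $ k) * fps_norm s (g $ (i - k))) * r ^ i"
      by (rule mult_right_mono) auto
    also have "\<dots> = (\<Sum>k\<le>i. (fps_norm s (f $ k) * r ^ k) * (fps_norm s (g $ (i - k)) * r ^ (i - k)))"
      unfolding sum_distrib_right
    proof (rule sum.cong, goal_cases)
      case (2 k)
      then have "r ^ i = r ^ k * r ^ (i - k)" by (simp flip: power_add)
      then show ?case by (simp add: mult_ac)
    qed simp
    finally show ?thesis .
  qed
  then have "germ_norm r s (f * g) \<le> suminf (\<lambda>i. \<Sum>k\<le>i. (fps_norm s (f $ k) * r ^ k) * (fps_norm s (g $ (i - k)) * r ^ (i - k)))"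
    unfolding germ_norm_def by (intro suminf_le summableI) auto
  also have "\<dots> \<le> germ_norm r s f * germ_norm r s g"
    unfolding germ_norm_def by (rule suminf_conv_le)
  finally show ?thesis .
qed

lemma convergent_common:
  assumes "convergent_series f" "convergent_series g"
  obtains r s where "0 < r" "0 < s" "r < \<infinity>" "s < \<infinity>" "germ_norm r s f < \<infinity>" "germ_norm r s g < \<infinity>"
proof -
  obtain r s where 1: "0 < r" "0 < s" "r < \<infinity>" "s < \<infinity>" "germ_norm r s f < \<infinity>"
    using assms(1) convergent_iff by blast
  obtain r' s' where 2: "0 < r'" "0 < s'" "r' < \<infinity>" "s' < \<infinity>" "germ_norm r' s' g < \<infinity>"
    using assms(2) convergent_iff by blast
  have "germ_norm (min r r') (min s s') f \<le> germ_norm r s f" "germ_norm (min r r') (min s s') g \<le> germ_norm r' s' g"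
    by (auto intro!: germ_norm_mono)
  then show ?thesis
    using 1 2 by (intro that[of "min r r'" "min s s'"]) (auto simp: min_less_iff_disj intro: le_less_trans)
qed

lemma convergent_add [intro]: 
  assumes "convergent_series f" "convergent_series g" shows "convergent_series (f + g)"
proof -
  obtain r s where "0 < r" "0 < s" "r < \<infinity>" "s < \<infinity>" "germ_norm r s f < \<infinity>" "germ_norm r s g < \<infinity>"
    using convergent_common[OF assms] by metis
  moreover from this have "germ_norm r s (f + g) < \<infinity>"
    using germ_norm_add[of r s f g] by (simp add: le_less_trans)
  ultimately show ?thesis unfolding convergent_iff by blast
qed

lemma convergent_mult [intro]: 
  assumes "convergent_series f" "convergent_series g" shows "convergent_series (f * g)"
proof -
  obtain r s where "0 < r" "0 < s" "r < \<infinity>" "s < \<infinity>" "germ_norm r s f < \<infinity>" "germ_norm r s g < \<infinity>"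
    using convergent_common[OF assms] by metis
  moreover from this have "germ_norm r s (f * g) < \<infinity>"
    using germ_norm_mult[of r s f g] by (simp add: le_less_trans ennreal_mult_less_top)
  ultimately show ?thesis unfolding convergent_iff by blast
qed

lemma convergent_uminus [intro]: "convergent_series f \<Longrightarrow> convergent_series (- f)"
  by (simp add: convergent_iff germ_norm_uminus)

lemma convergent_diff [intro]: 
  "convergent_series f \<Longrightarrow> convergent_series g \<Longrightarrow> convergent_series (f - g)"
  using convergent_add[of f "- g"] by auto

lemma germ_norm_const: "germ_norm r s (fps_const u) = fps_norm s u"
proof -
  have "germ_norm r s (fps_const u) = (\<Sum>i\<in>{0}. fps_norm s (fps_const u $ i) * r ^ i)"
    unfolding germ_norm_def by (rule suminf_finite) auto
  then show ?thesis by simp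
qed

lemma convergent_const: 
  assumes "fps_norm s u < \<infinity>" "0 < s" "s < \<infinity>" shows "convergent_series (fps_const u)"
  unfolding convergent_iff germ_norm_const using assms zero_less_one ennreal_one_less_top by (metis infinity_ennreal_def)

lemma convergent_scalar [intro, simp]: "convergent_series (fps_const (fps_const c))"
  by (rule convergent_const[of 1]) auto

lemma convergent_0 [intro, simp]: "convergent_series 0"
  using convergent_scalar[of 0] by simp

lemma convergent_1 [intro, simp]: "convergent_series 1"
  using convergent_scalar[of 1] by simp

lemma convergent_y [intro, simp]: "convergent_series (fps_const fps_X)"
  by (rule convergent_const[of 1]) auto

lemma convergent_x [intro, simp]: "convergent_series fps_X"
proof -
  have "germ_norm 1 1 fps_X = (\<Sum>i\<in>{1}. fps_norm 1 (fps_X $ i) * 1 ^ i)"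
    unfolding germ_norm_def by (rule suminf_finite) auto
  then have "germ_norm 1 1 fps_X < \<infinity>" by simp
  then show ?thesis unfolding convergent_iff
    using zero_less_one ennreal_one_less_top by (metis infinity_ennreal_def)
qed

lemma convergent_power [intro]: "convergent_series f \<Longrightarrow> convergent_series (f ^ n)"
  by (induction n) auto

lemma convergent_sum [intro]: 
  "(\<And>i. i \<in> A \<Longrightarrow> convergent_series (f i)) \<Longrightarrow> convergent_series (\<Sum>i\<in>A. f i)"
  by (induction A rule: infinite_finite_induct) auto

section \<open>Weierstrass division\<close>

lemma ennreal_divide_finite: "a < \<infinity> \<Longrightarrow> 0 < s \<Longrightarrow> s < \<infinity> \<Longrightarrow> a / s ^ q < (\<infinity>::ennreal)"
  by (metis ennreal_divide_eq_top_iff infinity_ennreal_def less_top not_gr_zero power_eq_0_iff)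

lemma germ_norm_shift:
  assumes "0 < r" "r < \<infinity>"
  shows "germ_norm r s (fps_shift q f) \<le> germ_norm r s f / r ^ q"
  using suminf_shift_le[OF assms, of "\<lambda>j. fps_norm s (f $ j)" q] by (simp add: germ_norm_def)

lemma convergent_shift [intro]:
  assumes "convergent_series f" shows "convergent_series (fps_shift q f)"
proof -
  obtain r s where 1: "0 < r" "0 < s" "r < \<infinity>" "s < \<infinity>" "germ_norm r s f < \<infinity>"
    using assms convergent_iff by blast
  have "germ_norm r s (fps_shift q f) < \<infinity>"
    using germ_norm_shift[of r s q f] ennreal_divide_finite[of "germ_norm r s f" r q] 1 
    by (simp add: order_le_less_trans)
  then show ?thesis using 1 convergent_iff by blast
qed

lemma fps_norm_nth_finite:
  assumes "germ_norm r s f < \<infinity>" "0 < r" shows "fps_norm s (f $ i) < \<infinity>"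
proof (rule ccontr)
  assume "\<not> ?thesis"
  then have "fps_norm s (f $ i) * r ^ i = \<infinity>"
    using assms(2) by (simp add: less_top[symmetric] ennreal_mult_eq_top_iff)
  moreover have "fps_norm s (f $ i) * r ^ i \<le> germ_norm r s f"
    unfolding germ_norm_def using sum_le_suminf[OF summableI, of "{i}" "\<lambda>i. fps_norm s (f $ i) * r ^ i"] by simp
  ultimately show False using assms by simp
qed

text \<open>
  The coefficient of \<open>x\<^sup>i\<close> in the quotient by \<open>g\<close>: if \<open>q\<close> is the order of \<open>g(0, y) = y\<^sup>q u(y)\<close>, then it
  is the quotient, in one variable, of what is left in degree \<open>i\<close> by \<open>y\<^sup>q u\<close>.
\<close>

fun weierstrass_quotient :: "series2 \<Rightarrow> series2 \<Rightarrow> nat \<Rightarrow> complex fps" where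
  "weierstrass_quotient f g 0 =
     inverse (fps_shift (subdegree (g $ 0)) (g $ 0)) * fps_shift (subdegree (g $ 0)) (f $ 0)"
| "weierstrass_quotient f g (Suc i) =
     inverse (fps_shift (subdegree (g $ 0)) (g $ 0)) *
       fps_shift (subdegree (g $ 0)) (f $ Suc i - (\<Sum>k\<le>i. g $ Suc k * weierstrass_quotient f g (i - k)))"

text \<open>
  The remainder is a polynomial in \<open>y\<close> of degree less than the order of \<open>g(0, y)\<close>.  As formal series,
  quotient and remainder are found degree by degree in \<open>x\<close>.  The recursion for the norms of the
  coefficients of the quotient has the form of \<open>majorant_recursion\<close>, with a factor \<open>K\<close> which
  depends only on the radius in \<open>y\<close>; hence the quotient converges for a small radius in \<open>x\<close>.
\<close>

lemma weierstrass_division: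
  assumes f: "convergent_series f" and g: "convergent_series g" and g0: "g $ 0 \<noteq> 0"
  obtains Q where "convergent_series Q" "\<And>i j. subdegree (g $ 0) \<le> j \<Longrightarrow> (f - Q * g) $ i $ j = 0"
proof -
  define q where "q = subdegree (g $ 0)"
  define u where "u = fps_shift q (g $ 0)"
  define Q where "Q = Abs_fps (weierstrass_quotient f g)"
  have u0: "u $ 0 \<noteq> 0" using g0 by (simp add: u_def q_def)
  have gu: "g $ 0 = fps_X ^ q * u"
    unfolding u_def q_def by (rule fps_conv_fps_X_power_mult_fps_shift) simp
  have rem: "D - g $ 0 * (inverse u * fps_shift q D) = fps_cutoff q D" for D
  proof -
    have "g $ 0 * (inverse u * fps_shift q D) = (u * inverse u) * (fps_X ^ q * fps_shift q D)"
      by (simp add: gu mult_ac)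
    also have "u * inverse u = 1" using u0 by (simp add: inverse_mult_eq_1')
    also have "1 * (fps_X ^ q * fps_shift q D) = D - fps_cutoff q D"
      by (subst fps_shift_cutoff'[of q D, symmetric]) simp
    finally show ?thesis by simp
  qed
  have "(f - Q * g) $ i = fps_cutoff q (case i of 0 \<Rightarrow> f $ 0 | Suc i' \<Rightarrow> 
      f $ Suc i' - (\<Sum>k\<le>i'. g $ Suc k * Q $ (i' - k)))" for i
  proof (cases i)
    case 0
    then show ?thesis using rem[of "f $ 0"] by (simp add: Q_def u_def q_def mult.commute)
  next
    case (Suc i')
    have "(Q * g) $ Suc i' = (g * Q) $ Suc i'" by (simp add: mult.commute)
    also have "\<dots> = (\<Sum>k\<le>Suc i'. g $ k * Q $ (Suc i' - k))"
      by (simp add: fps_mult_nth atLeast0AtMost)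
    also have "\<dots> = g $ 0 * Q $ Suc i' + (\<Sum>k\<le>i'. g $ Suc k * Q $ (i' - k))"
      by (subst sum.atMost_Suc_shift) simp
    also have "Q $ Suc i' = inverse u * fps_shift q (f $ Suc i' - (\<Sum>k\<le>i'. g $ Suc k * Q $ (i' - k)))"
      by (simp add: Q_def u_def q_def)
    finally show ?thesis using rem[of "f $ Suc i' - (\<Sum>k\<le>i'. g $ Suc k * Q $ (i' - k))"] Suc
      by (simp add: algebra_simps)
  qed
  then have "(f - Q * g) $ i $ j = 0" if "q \<le> j" for i j
    using that by (simp add: fps_cutoff_nth)
  moreover have "convergent_series Q"
  proof -
    obtain r s0 where 1: "0 < r" "0 < s0" "r < \<infinity>" "s0 < \<infinity>" "germ_norm r s0 f < \<infinity>" "germ_norm r s0 g < \<infinity>"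
      using convergent_common[OF f g] by metis
    have "fps_norm s0 u \<le> fps_norm s0 (g $ 0) / s0 ^ q"
      unfolding u_def using 1 by (intro fps_norm_shift)
    also have "\<dots> < \<infinity>" using 1 by (intro ennreal_divide_finite fps_norm_nth_finite)
    finally obtain s where s: "0 < s" "s \<le> s0" "fps_norm s (inverse u) < \<infinity>"
      using inverse_norm_finite[of s0 u] u0 1 by blast
    have sfin: "s < \<infinity>" using s 1 by (simp add: order_le_less_trans)
    have gf: "germ_norm r s f < \<infinity>" "germ_norm r s g < \<infinity>"
      using germ_norm_mono[of r r s s0] s 1 by (meson order.refl order_le_less_trans)+
    define K where "K = fps_norm s (inverse u) / s ^ q"
    have Kfin: "K < \<infinity>" unfolding K_def using s sfin by (intro ennreal_divide_finite)
    have K: "fps_norm s (inverse u * fps_shift q D) \<le> K * fps_norm s D" for D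
    proof -
      have "fps_norm s (inverse u * fps_shift q D) \<le> fps_norm s (inverse u) * fps_norm s (fps_shift q D)"
        by (rule fps_norm_mult)
      also have "\<dots> \<le> fps_norm s (inverse u) * (fps_norm s D / s ^ q)"
        using s sfin by (intro mult_left_mono fps_norm_shift) auto
      also have "\<dots> = K * fps_norm s D"
        by (simp add: K_def ennreal_times_divide ennreal_divide_times mult_ac)
      finally show ?thesis .
    qed
    have "\<exists>r'. 0 < r' \<and> r' \<le> r \<and> suminf (\<lambda>i. fps_norm s (Q $ i) * r' ^ i) < \<infinity>"
    proof (rule majorant_recursion[where s = "\<lambda>i. K * fps_norm s (f $ i)" and h = "\<lambda>k. K * fps_norm s (g $ Suc k)"])
      show "fps_norm s (Q $ 0) \<le> K * fps_norm s (f $ 0)"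
        using K[of "f $ 0"] by (simp add: Q_def u_def q_def)
    next
      fix i
      let ?D = "f $ Suc i - (\<Sum>k\<le>i. g $ Suc k * Q $ (i - k))"
      have "fps_norm s (Q $ Suc i) \<le> K * fps_norm s ?D"
        using K[of ?D] by (simp add: Q_def u_def q_def)
      also have "\<dots> \<le> K * (fps_norm s (f $ Suc i) + (\<Sum>k\<le>i. fps_norm s (g $ Suc k) * fps_norm s (Q $ (i - k))))"
        by (intro mult_left_mono order_trans[OF fps_norm_diff] add_left_mono order_trans[OF fps_norm_sum] 
              sum_mono fps_norm_mult) auto
      finally show "fps_norm s (Q $ Suc i) \<le> K * fps_norm s (f $ Suc i)
            + (\<Sum>k\<le>i. K * fps_norm s (g $ Suc k) * fps_norm s (Q $ (i - k)))"
        by (simp add: distrib_left sum_distrib_left mult_ac)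
    next
      have "suminf (\<lambda>i. K * fps_norm s (f $ i) * r ^ i) = K * germ_norm r s f"
        unfolding germ_norm_def by (simp add: mult.assoc)
      then show "suminf (\<lambda>i. K * fps_norm s (f $ i) * r ^ i) < \<infinity>"
        using gf Kfin by (simp add: ennreal_mult_less_top)
      have "suminf (\<lambda>k. K * fps_norm s (g $ Suc k) * r ^ k) = K * germ_norm r s (fps_shift 1 g)"
        unfolding germ_norm_def by (simp add: mult.assoc)
      moreover have "germ_norm r s (fps_shift 1 g) < \<infinity>"
        using germ_norm_shift[of r s 1 g] ennreal_divide_finite[of "germ_norm r s g" r 1] gf 1 
        by (simp add: order_le_less_trans)
      ultimately show "suminf (\<lambda>k. K * fps_norm s (g $ Suc k) * r ^ k) < \<infinity>"
        using Kfin by (simp add: ennreal_mult_less_top)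
    qed (use 1 in auto)
    then obtain r' where "0 < r'" "r' \<le> r" "germ_norm r' s Q < \<infinity>"
      unfolding germ_norm_def by blast
    moreover from this 1 have "r' < \<infinity>" by (simp add: order_le_less_trans)
    ultimately show ?thesis unfolding convergent_iff using s sfin by blast
  qed
  ultimately show ?thesis using that unfolding q_def by blast
qed

text \<open>
  Weierstrass division of \<open>1\<close> by a series which is regular of order \<open>0\<close> has remainder zero.
\<close>

lemma convergent_unit_iff: "convergent_unit f \<longleftrightarrow> convergent_series f \<and> f $ 0 $ 0 \<noteq> 0"
proof
  assume "convergent_unit f"
  then obtain g where "convergent_series f" "f * g = 1" unfolding convergent_unit_def by blast
  then have "(f * g) $ 0 $ 0 = 1" by simp
  then have "f $ 0 $ 0 * g $ 0 $ 0 = 1" by simp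
  then show "convergent_series f \<and> f $ 0 $ 0 \<noteq> 0" using \<open>convergent_series f\<close> by auto
next
  assume f: "convergent_series f \<and> f $ 0 $ 0 \<noteq> 0"
  then have f0: "f $ 0 \<noteq> 0" by auto
  have sd: "subdegree (f $ 0) = 0" using f by (simp add: subdegree_eq_0_iff)
  obtain Q where Q: "convergent_series Q" "\<And>i j. (1 - Q * f) $ i $ j = 0"
    using weierstrass_division[of 1 f] f f0 sd by (metis convergent_1 le0)
  then have "1 - Q * f = 0" by (intro fps_ext) (metis fps_zero_nth)
  then have "f * Q = 1" by (simp add: mult.commute)
  then show "convergent_unit f" using f Q unfolding convergent_unit_def by blast
qed

definition ydiff :: "series2 \<Rightarrow> series2" where
  "ydiff f = Abs_fps (\<lambda>i. fps_deriv (f $ i))"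

lemma ydiff_nth [simp]: "ydiff f $ i = fps_deriv (f $ i)"
  by (simp add: ydiff_def)

text \<open>
  The factor \<open>j\<close> produced by differentiating \<open>y\<^sup>j\<close> is at most \<open>2\<^sup>j\<close> and is absorbed by halving the
  radius.
\<close>

lemma fps_norm_deriv:
  assumes "0 < s" "s < \<infinity>" shows "fps_norm (s / 2) (fps_deriv u) \<le> fps_norm s u / s * 2"
proof -
  have "fps_norm (s / 2) (fps_deriv u) \<le> fps_norm s (fps_shift 1 u) * 2"
  proof -
    have "ennreal (norm (fps_deriv u $ j)) * (s / 2) ^ j \<le> ennreal (norm (u $ Suc j)) * s ^ j * 2" for j
    proof -
      obtain t where t: "s = ennreal t" "t > 0" using assms by (cases s) auto
      have s2: "s / 2 = ennreal (t / 2)" using t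
        by (metis divide_ennreal ennreal_numeral less_imp_le zero_less_numeral)
      have "real (Suc j) \<le> 2 * 2 ^ j" 
        by (induction j) auto
      then have "norm (fps_deriv u $ j) * (t / 2) ^ j \<le> 2 * 2 ^ j * norm (u $ Suc j) * (t / 2) ^ j"
        using t by (intro mult_right_mono) (auto simp: norm_mult simp flip: of_nat_Suc intro!: mult_right_mono)
      also have "\<dots> = norm (u $ Suc j) * t ^ j * 2" by (simp add: power_divide)
      finally have "ennreal (norm (fps_deriv u $ j) * (t / 2) ^ j) \<le> ennreal (norm (u $ Suc j) * t ^ j * 2)"
        by (rule ennreal_leI)
      then show ?thesis unfolding s2 using t
        by (simp add: ennreal_power ennreal_mult)
    qed
    then have "fps_norm (s / 2) (fps_deriv u) \<le> suminf (\<lambda>j. ennreal (norm (u $ Suc j)) * s ^ j * 2)"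
      unfolding fps_norm_def by (intro suminf_le summableI) auto
    then show ?thesis by (simp add: fps_norm_def)
  qed
  also have "\<dots> \<le> fps_norm s u / s ^ 1 * 2"
    using assms by (intro mult_right_mono fps_norm_shift) auto
  finally show ?thesis by simp
qed

lemma convergent_ydiff [intro]:
  assumes "convergent_series f" shows "convergent_series (ydiff f)"
proof -
  obtain r s where 1: "0 < r" "0 < s" "r < \<infinity>" "s < \<infinity>" "germ_norm r s f < \<infinity>"
    using assms convergent_iff by blast
  have "germ_norm r (s / 2) (ydiff f) \<le> suminf (\<lambda>i. fps_norm s (f $ i) * r ^ i * (2 / s))"
    unfolding germ_norm_def
  proof (intro suminf_le summableI)
    fix i
    have "fps_norm (s / 2) (ydiff f $ i) * r ^ i \<le> (fps_norm s (f $ i) / s * 2) * r ^ i"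
      using 1 by (intro mult_right_mono) (auto intro: fps_norm_deriv)
    also have "\<dots> = fps_norm s (f $ i) * r ^ i * (2 / s)"
      by (simp add: ennreal_times_divide ennreal_divide_times mult_ac)
    finally show "fps_norm (s / 2) (ydiff f $ i) * r ^ i \<le> fps_norm s (f $ i) * r ^ i * (2 / s)" .
  qed
  also have "\<dots> = germ_norm r s f * (2 / s)"
    by (simp add: germ_norm_def)
  also have "\<dots> < \<infinity>"
  proof -
    have "2 / s < \<infinity>" using ennreal_divide_finite[of 2 s 1] 1 by simp
    then show ?thesis using 1 by (simp add: ennreal_mult_less_top)
  qed
  finally have "germ_norm r (s / 2) (ydiff f) < \<infinity>" .
  moreover have "0 < s / 2" "s / 2 < \<infinity>"
    using 1 ennreal_divide_finite[of s 2 1] by (auto simp: ennreal_zero_less_divide)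
  ultimately show ?thesis using 1 convergent_iff by blast
qed

text \<open>
  Exchanging the two variables turns the chart \<open>Vertical\<close> into \<open>Finite_slope 0\<close>.  All statements
  about a blow-up are therefore proved for the charts \<open>Finite_slope c\<close> first.
\<close>

definition swap :: "series2 \<Rightarrow> series2" where
  "swap f = Abs_fps (\<lambda>i. Abs_fps (\<lambda>j. f $ j $ i))"

lemma swap_nth [simp]: "swap f $ i $ j = f $ j $ i"
  by (simp add: swap_def)

lemma swap_swap [simp]: "swap (swap f) = f"
  by (intro fps_ext) simp

lemma swap_mult: "swap (f * g) = swap f * swap g"
proof (intro fps_ext)
  fix i j
  have "swap (f * g) $ i $ j = (\<Sum>k=0..j. \<Sum>l=0..i. f $ k $ l * g $ (j - k) $ (i - l))"
    by (simp add: fps_mult_nth fps_sum_nth)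
  also have "\<dots> = (swap f * swap g) $ i $ j"
    by (subst sum.swap) (simp add: fps_mult_nth fps_sum_nth)
  finally show "swap (f * g) $ i $ j = (swap f * swap g) $ i $ j" .
qed

lemma swap_eq_iff [simp]: "swap f = swap g \<longleftrightarrow> f = g"
  by (metis swap_swap)

lemma convergent_swap [intro]:
  assumes "convergent_series f" shows "convergent_series (swap f)"
proof -
  obtain r where r: "r > 0" "(\<lambda>(i, j). norm (f $ i $ j) * r ^ (i + j)) summable_on (UNIV :: (nat \<times> nat) set)"
    using assms unfolding convergent_series_def by blast
  have "(\<lambda>(i, j). norm (f $ i $ j) * r ^ (i + j)) summable_on range prod.swap"
    using r by (simp add: surj_swap)
  then have "((\<lambda>(i, j). norm (f $ i $ j) * r ^ (i + j)) \<circ> prod.swap) summable_on UNIV"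
    by (subst (asm) summable_on_reindex) (auto simp: inj_on_def)
  then have "(\<lambda>(i, j). norm (swap f $ i $ j) * r ^ (i + j)) summable_on UNIV"
    by (simp add: o_def case_prod_unfold add.commute)
  then show ?thesis unfolding convergent_series_def using r by blast
qed

section \<open>Blowing up a germ\<close>

declare pullback.simps [simp del]

lemma mult0_nz: "f \<noteq> 0 \<Longrightarrow> \<exists>i j. i + j = mult0 f \<and> f $ i $ j \<noteq> 0"
proof -
  assume "f \<noteq> 0"
  then obtain i j where "f $ i $ j \<noteq> 0" by (auto simp: fps_eq_iff)
  then have "\<exists>n. \<exists>i j. i + j = n \<and> f $ i $ j \<noteq> 0" by blast
  then show ?thesis unfolding mult0_def by (rule LeastI_ex)
qed

lemma mult0_le: "f $ i $ j \<noteq> 0 \<Longrightarrow> mult0 f \<le> i + j"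
  unfolding mult0_def by (rule Least_le) blast

lemma below_mult0: "i + j < mult0 f \<Longrightarrow> f $ i $ j = 0"
  using mult0_le leD by blast

lemma mult0_swap [simp]: "mult0 (swap f) = mult0 f"
  unfolding mult0_def swap_nth by (intro arg_cong[where f = Least] ext) (metis add.commute)

text \<open>
  The homogeneous part of degree \<open>n\<close>, made inhomogeneous by \<open>x = 1\<close>.  The blow-down map multiplies
  it by \<open>x\<^sup>n\<close> and translates the variable by \<open>c\<close>; in this form it is visible that the pull-back is an
  injective ring homomorphism.
\<close>

definition form_poly :: "series2 \<Rightarrow> nat \<Rightarrow> complex poly" where
  "form_poly f n = (\<Sum>j\<le>n. Polynomial.monom (f $ (n - j) $ j) j)"

lemma coeff_form_poly: "poly.coeff (form_poly f n) j = (if j \<le> n then f $ (n - j) $ j else 0)"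
  by (simp add: form_poly_def coeff_sum coeff_monom)

lemma poly_form_poly: "poly (form_poly f n) c = (\<Sum>j\<le>n. f $ (n - j) $ j * c ^ j)"
  by (simp add: form_poly_def poly_sum poly_monom)

lemma pullback_nth: "pullback (Finite_slope c) f $ n = fps_of_poly (form_poly f n \<circ>\<^sub>p [:c, 1:])"
proof -
  have *: "fps_of_poly (Polynomial.monom a j \<circ>\<^sub>p [:c, 1:]) = fps_const a * (fps_X + fps_const c) ^ j" for a :: complex and j
  proof -
    have "Polynomial.monom a j \<circ>\<^sub>p [:c, 1:] = Polynomial.smult a ([:c, 1:] ^ j)"
      by (induction j) (simp_all add: monom_Suc pcompose_pCons monom_0)
    moreover have "fps_of_poly [:c, 1:] = fps_X + fps_const c"
      by (simp add: fps_of_poly_pCons)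
    ultimately show ?thesis by (simp add: fps_of_poly_smult fps_of_poly_power)
  qed
  show ?thesis
    by (simp add: form_poly_def pcompose_sum fps_of_poly_sum * pullback.simps(1))
qed

text \<open>
  Homogeneous parts multiply like the coefficients of a power series, since a monomial of degree \<open>n\<close>
  in the product comes from monomials of degrees \<open>i\<close> and \<open>n - i\<close>.
\<close>

lemma form_poly_mult: "form_poly (f * g) n = (\<Sum>i\<le>n. form_poly f i * form_poly g (n - i))"
proof (rule poly_eqI)
  fix j
  let ?F = "\<lambda>i b. (if b \<le> i then f $ (i - b) $ b else 0) * (if j - b \<le> n - i then g $ (n - i - (j - b)) $ (j - b) else 0)"
  have R: "poly.coeff (\<Sum>i\<le>n. form_poly f i * form_poly g (n - i)) j = (\<Sum>b\<le>j. \<Sum>i\<le>n. ?F i b)"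
    by (subst sum.swap) (simp add: coeff_sum coeff_mult coeff_form_poly)
  show "poly.coeff (form_poly (f * g) n) j = poly.coeff (\<Sum>i\<le>n. form_poly f i * form_poly g (n - i)) j"
  proof (cases "j \<le> n")
    case False
    then have "?F i b = 0" if "b \<le> j" "i \<le> n" for i b using that by auto
    then have "(\<Sum>b\<le>j. \<Sum>i\<le>n. ?F i b) = 0" by (intro sum.neutral ballI) auto
    then show ?thesis unfolding R using False by (simp add: coeff_form_poly)
  next
    case True
    have "poly.coeff (form_poly (f * g) n) j = (\<Sum>a\<le>n - j. \<Sum>b\<le>j. f $ a $ b * g $ (n - j - a) $ (j - b))"
      using True by (simp add: coeff_form_poly fps_mult_nth fps_sum_nth atLeast0AtMost)
    also have "\<dots> = (\<Sum>b\<le>j. \<Sum>a\<le>n - j. f $ a $ b * g $ (n - j - a) $ (j - b))"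
      by (rule sum.swap)
    also have "\<dots> = (\<Sum>b\<le>j. \<Sum>i\<le>n. ?F i b)"
    proof (rule sum.cong[OF refl])
      fix b assume b: "b \<in> {..j}"
      have "(\<Sum>i\<le>n. ?F i b) = (\<Sum>i\<in>(\<lambda>a. a + b) ` {..n - j}. ?F i b)"
      proof (rule sum.mono_neutral_right)
        show "\<forall>i\<in>{..n} - (\<lambda>a. a + b) ` {..n - j}. ?F i b = 0"
        proof
          fix i assume i: "i \<in> {..n} - (\<lambda>a. a + b) ` {..n - j}"
          show "?F i b = 0"
          proof (rule ccontr)
            assume "?F i b \<noteq> 0"
            then have "b \<le> i" "j - b \<le> n - i" by (auto split: if_splits)
            then have "i = (i - b) + b" "i - b \<le> n - j" using i b by auto
            then show False using i by blast
          qed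
        qed
      qed (use b True in auto)
      also have "\<dots> = (\<Sum>a\<le>n - j. ?F (a + b) b)"
        by (subst sum.reindex) (auto simp: inj_on_def)
      also have "\<dots> = (\<Sum>a\<le>n - j. f $ a $ b * g $ (n - j - a) $ (j - b))"
      proof (rule sum.cong[OF refl])
        fix a assume a: "a \<in> {..n - j}"
        have "j - b \<le> n - (a + b)" "n - (a + b) - (j - b) = n - j - a" using a b True by auto
        then show "?F (a + b) b = f $ a $ b * g $ (n - j - a) $ (j - b)" by simp
      qed
      finally show "(\<Sum>a\<le>n - j. f $ a $ b * g $ (n - j - a) $ (j - b)) = (\<Sum>i\<le>n. ?F i b)" by simp
    qed
    finally show ?thesis unfolding R .
  qed
qed

lemma pullback_slope_mult: "pullback (Finite_slope c) (f * g) = pullback (Finite_slope c) f * pullback (Finite_slope c) g"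
  by (rule fps_ext)
     (simp add: pullback_nth form_poly_mult fps_mult_nth pcompose_sum pcompose_mult fps_of_poly_sum fps_of_poly_mult atLeast0AtMost)

lemma pullback_add: "pullback (Finite_slope c) (f + g) = pullback (Finite_slope c) f + pullback (Finite_slope c) g"
proof (rule fps_ext)
  fix n
  have "form_poly (f + g) n = form_poly f n + form_poly g n"
    by (rule poly_eqI) (simp add: coeff_form_poly)
  then show "pullback (Finite_slope c) (f + g) $ n = (pullback (Finite_slope c) f + pullback (Finite_slope c) g) $ n"
    by (simp add: pullback_nth pcompose_add fps_of_poly_add)
qed

lemma pullback_series_x:
  assumes "\<And>i. f $ i = fps_const (a i)"
  shows "pullback (Finite_slope c) f = f"
proof (rule fps_ext)
  fix n
  have "form_poly f n = [:a n:]"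
    by (rule poly_eqI) (auto simp: coeff_form_poly assms coeff_pCons split: nat.split)
  then show "pullback (Finite_slope c) f $ n = f $ n"
    by (simp add: pullback_nth assms fps_of_poly_const)
qed

lemma pullback_const [simp]: "pullback (Finite_slope c) (fps_const (fps_const a)) = fps_const (fps_const a)"
  by (rule pullback_series_x[of _ "\<lambda>i. if i = 0 then a else 0"]) auto

lemma pullback_0 [simp]: "pullback (Finite_slope c) 0 = 0"
  using pullback_const[of c 0] by (simp del: pullback_const)

lemma pullback_1 [simp]: "pullback (Finite_slope c) 1 = 1"
  using pullback_const[of c 1] by (simp del: pullback_const)

lemma pullback_x [simp]: "pullback (Finite_slope c) fps_X = fps_X"
  by (rule pullback_series_x[of _ "\<lambda>i. if i = 1 then 1 else 0"]) auto

lemma pullback_y: "pullback (Finite_slope c) (fps_const fps_X) = fps_X * fps_const (fps_X + fps_const c)"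
proof (rule fps_ext)
  fix n
  have "form_poly (fps_const fps_X) n = (if n = 1 then [:0, 1:] else 0)"
    by (rule poly_eqI) (auto simp: coeff_form_poly coeff_pCons split: nat.split)
  then show "pullback (Finite_slope c) (fps_const fps_X) $ n = (fps_X * fps_const (fps_X + fps_const c)) $ n"
    by (auto simp add: pullback_nth fps_of_poly_pCons pcompose_pCons)
qed

lemma pullback_power: "pullback (Finite_slope c) (f ^ n) = pullback (Finite_slope c) f ^ n"
  by (induction n) (simp_all add: pullback_slope_mult)

lemma pullback_sum: "pullback (Finite_slope c) (\<Sum>i\<in>A. f i) = (\<Sum>i\<in>A. pullback (Finite_slope c) (f i))"
  by (induction A rule: infinite_finite_induct) (simp_all add: pullback_add)

lemma pullback_uminus: "pullback (Finite_slope c) (- f) = - pullback (Finite_slope c) f"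
proof -
  have "pullback (Finite_slope c) (- f) + pullback (Finite_slope c) f = 0"
    by (simp flip: pullback_add)
  then show ?thesis by (simp add: eq_neg_iff_add_eq_0)
qed

lemma pullback_diff: "pullback (Finite_slope c) (f - g) = pullback (Finite_slope c) f - pullback (Finite_slope c) g"
  using pullback_add[of c f "- g"] by (simp add: pullback_uminus)

lemma pullback_nth_eq_0_iff: "pullback (Finite_slope c) f $ n = 0 \<longleftrightarrow> form_poly f n = 0"
  unfolding pullback_nth by (simp add: pcompose_eq_0_iff)

lemma pullback_eq_0_iff: "pullback (Finite_slope c) f = 0 \<longleftrightarrow> f = 0"
proof
  assume "pullback (Finite_slope c) f = 0"
  then have *: "form_poly f n = 0" for n by (simp flip: pullback_nth_eq_0_iff[of c])
  have "f $ i $ j = 0" for i j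
    using arg_cong[OF *[of "i + j"], of "\<lambda>p. poly.coeff p j"] by (simp add: coeff_form_poly)
  then show "f = 0" by (intro fps_ext) simp
qed simp

lemma form_poly_below: "n < mult0 f \<Longrightarrow> form_poly f n = 0"
  by (rule poly_eqI) (simp add: coeff_form_poly below_mult0)

lemma form_poly_mult0: "f \<noteq> 0 \<Longrightarrow> form_poly f (mult0 f) \<noteq> 0"
proof
  assume "f \<noteq> 0" "form_poly f (mult0 f) = 0"
  obtain i j where ij: "i + j = mult0 f" "f $ i $ j \<noteq> 0" using mult0_nz[OF \<open>f \<noteq> 0\<close>] by blast
  have "poly.coeff (form_poly f (mult0 f)) j = f $ i $ j" by (simp add: coeff_form_poly flip: ij(1))
  then show False using ij \<open>form_poly f (mult0 f) = 0\<close> by simp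
qed

lemma pullback_nth_0: "pullback (Finite_slope c) f $ 0 = fps_const (f $ 0 $ 0)"
proof -
  have "form_poly f 0 = [:f $ 0 $ 0:]"
    by (rule poly_eqI) (auto simp: coeff_form_poly coeff_pCons split: nat.split)
  then show ?thesis unfolding pullback_nth by (simp add: fps_of_poly_const)
qed

lemma strict_transform_FS: 
  assumes "f \<noteq> 0"
  shows "strict_transform (Finite_slope c) f = fps_shift (mult0 f) (pullback (Finite_slope c) f)"
    and "pullback (Finite_slope c) f = fps_X ^ mult0 f * strict_transform (Finite_slope c) f"
    and "strict_transform (Finite_slope c) f $ 0 \<noteq> 0"
proof -
  let ?p = "pullback (Finite_slope c) f" and ?m = "mult0 f"
  have nz: "?p $ ?m \<noteq> 0" unfolding pullback_nth_eq_0_iff using assms by (rule form_poly_mult0)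
  have sd: "subdegree ?p = ?m"
  proof (rule subdegreeI)
    show "?p $ i = 0" if "i < ?m" for i
      unfolding pullback_nth_eq_0_iff using that by (rule form_poly_below)
  qed (rule nz)
  have eq: "?p = fps_X ^ ?m * fps_shift ?m ?p"
    by (rule fps_conv_fps_X_power_mult_fps_shift) (simp add: sd)
  show 1: "strict_transform (Finite_slope c) f = fps_shift ?m ?p"
    unfolding strict_transform_def
  proof (rule the_equality)
    show "?p = exceptional (Finite_slope c) ^ ?m * fps_shift ?m ?p" using eq by simp
    fix h assume "?p = exceptional (Finite_slope c) ^ ?m * h"
    then show "h = fps_shift ?m ?p" using eq by simp
  qed
  show "?p = fps_X ^ ?m * strict_transform (Finite_slope c) f" unfolding 1 by (rule eq)
  show "strict_transform (Finite_slope c) f $ 0 \<noteq> 0" unfolding 1 using nz by simp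
qed

lemma pullback_Vertical: "pullback Vertical f = swap (pullback (Finite_slope 0) (swap f))"
proof (intro fps_ext)
  fix i j
  have "pullback (Finite_slope 0) (swap f) $ j $ i = poly.coeff (form_poly (swap f) j) i"
    unfolding pullback_nth by simp
  then show "pullback Vertical f $ i $ j = swap (pullback (Finite_slope 0) (swap f)) $ i $ j"
    by (simp add: coeff_form_poly fps_X_power_mult_nth pullback.simps(2))
qed

lemma swap_0 [simp]: "swap 0 = 0" by (intro fps_ext) simp
lemma swap_eq_0_iff [simp]: "swap f = 0 \<longleftrightarrow> f = 0" using swap_eq_iff[of f 0] by simp
lemma swap_x: "swap fps_X = fps_const fps_X" by (intro fps_ext) simp
lemma swap_y: "swap (fps_const fps_X) = fps_X" by (intro fps_ext) simp
lemma swap_1 [simp]: "swap 1 = 1" by (intro fps_ext) (simp add: fps_one_nth)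
lemma swap_power: "swap (f ^ n) = swap f ^ n" by (induction n) (simp_all add: swap_mult)

lemma strict_transform_Vertical: 
  assumes "f \<noteq> 0"
  shows "strict_transform Vertical f = swap (strict_transform (Finite_slope 0) (swap f))"
    and "pullback Vertical f = fps_const fps_X ^ mult0 f * strict_transform Vertical f"
proof -
  define s where "s = swap (strict_transform (Finite_slope 0) (swap f))"
  have eq: "pullback Vertical f = fps_const fps_X ^ mult0 f * s"
    unfolding pullback_Vertical s_def
    by (subst strict_transform_FS(2)) (use assms in \<open>auto simp: swap_mult swap_power swap_x\<close>)
  have 1: "strict_transform Vertical f = s"
    unfolding strict_transform_def
  proof (rule the_equality)
    show "pullback Vertical f = exceptional Vertical ^ mult0 f * s" using eq by simp
    fix h assume "pullback Vertical f = exceptional Vertical ^ mult0 f * h"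
    then show "h = s" using eq by simp
  qed
  then show "strict_transform Vertical f = swap (strict_transform (Finite_slope 0) (swap f))"
    by (simp add: s_def)
  show "pullback Vertical f = fps_const fps_X ^ mult0 f * strict_transform Vertical f"
    unfolding 1 by (rule eq)
qed

text \<open>
  The monomial \<open>x\<^sup>i y\<^sup>j\<close> becomes \<open>x\<^sup>i\<^sup>+\<^sup>j (y + c)\<^sup>j\<close>, and \<open>y + c\<close> has norm at most \<open>K = 1 + |c|\<close> at
  radius \<open>1\<close>.  So it suffices to choose a radius \<open>r'\<close> for \<open>x\<close> which is small enough that \<open>r' * K\<close> does
  not exceed the radius \<open>t\<close> in \<open>y\<close> at which the given series converges.
\<close>

lemma convergent_pullback: 
  assumes "convergent_series f" shows "convergent_series (pullback (Finite_slope c) f)"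
proof -
  obtain r t where 1: "0 < r" "0 < t" "r < \<infinity>" "t < \<infinity>" "germ_norm r t f < \<infinity>"
    using assms convergent_iff by blast
  define K where "K = 1 + ennreal (norm c)"
  have K: "1 \<le> K" "K < \<infinity>" by (auto simp: K_def)
  define r' where "r' = min r (t / K)"
  have "K \<noteq> 0" using K by auto
  have tK: "0 < t / K" using 1 K by (auto simp: ennreal_zero_less_divide)
  have r': "0 < r'" "r' \<le> r" "r' < \<infinity>" using 1 tK by (auto simp: r'_def min_less_iff_disj)
  have "r' * K \<le> t / K * K" unfolding r'_def by (intro mult_right_mono) auto
  also have "\<dots> = t" using K \<open>K \<noteq> 0\<close> by (simp add: ennreal_divide_times ennreal_mult_divide_eq)
  finally have r'K: "r' * K \<le> t" .
  let ?F = "\<lambda>j i. ennreal (norm (f $ i $ j)) * K ^ j * r' ^ (i + j)"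
  have bound: "fps_norm 1 (pullback (Finite_slope c) f $ n) * r' ^ n \<le> (\<Sum>j\<le>n. ?F j (n - j))" for n
  proof -
    have "fps_norm 1 (pullback (Finite_slope c) f $ n)
        \<le> (\<Sum>j\<le>n. fps_norm 1 (fps_const (f $ (n - j) $ j)) * fps_norm 1 (fps_X + fps_const c) ^ j)"
      by (simp add: pullback.simps(1)) (intro order_trans[OF fps_norm_sum] sum_mono order_trans[OF fps_norm_mult] mult_mono fps_norm_power, auto)
    also have "\<dots> \<le> (\<Sum>j\<le>n. ennreal (norm (f $ (n - j) $ j)) * K ^ j)"
      using fps_norm_add[of 1 fps_X "fps_const c"]
      by (intro sum_mono mult_mono power_mono) (auto simp: K_def)
    finally have "fps_norm 1 (pullback (Finite_slope c) f $ n) * r' ^ n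
        \<le> (\<Sum>j\<le>n. ennreal (norm (f $ (n - j) $ j)) * K ^ j) * r' ^ n"
      by (rule mult_right_mono) auto
    then show ?thesis by (simp add: sum_distrib_right)
  qed
  have "germ_norm r' 1 (pullback (Finite_slope c) f) \<le> germ_norm r t f"
    unfolding germ_norm_def[of r' 1]
  proof (rule suminf_le_const[OF summableI])
    fix N
    have "(\<Sum>n<N. fps_norm 1 (pullback (Finite_slope c) f $ n) * r' ^ n) \<le> (\<Sum>n<N. \<Sum>j\<le>n. ?F j (n - j))"
      by (intro sum_mono bound)
    also have "\<dots> \<le> (\<Sum>j<N. \<Sum>i<N. ?F j i)" by (rule conv_sum_le)
    also have "\<dots> = (\<Sum>i<N. (\<Sum>j<N. ennreal (norm (f $ i $ j)) * (r' * K) ^ j) * r' ^ i)"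
      by (subst sum.swap) (simp add: sum_distrib_left power_add power_mult_distrib mult_ac)
    also have "\<dots> \<le> (\<Sum>i<N. fps_norm t (f $ i) * r ^ i)"
    proof (intro sum_mono mult_mono power_mono)
      fix i
      have "(\<Sum>j<N. ennreal (norm (f $ i $ j)) * (r' * K) ^ j) \<le> (\<Sum>j<N. ennreal (norm (f $ i $ j)) * t ^ j)"
        using r'K by (intro sum_mono mult_left_mono power_mono) auto
      also have "\<dots> \<le> fps_norm t (f $ i)" unfolding fps_norm_def by (intro sum_le_suminf summableI) auto
      finally show "(\<Sum>j<N. ennreal (norm (f $ i $ j)) * (r' * K) ^ j) \<le> fps_norm t (f $ i)" .
    qed (use r' in auto)
    also have "\<dots> \<le> germ_norm r t f" unfolding germ_norm_def by (intro sum_le_suminf summableI) auto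
    finally show "(\<Sum>n<N. fps_norm 1 (pullback (Finite_slope c) f $ n) * r' ^ n) \<le> germ_norm r t f" .
  qed
  then have "germ_norm r' 1 (pullback (Finite_slope c) f) < \<infinity>" using 1 by (simp add: order_le_less_trans)
  then show ?thesis unfolding convergent_iff using r' by (intro exI[of _ r'] exI[of _ 1]) auto
qed

lemma convergent_strict_FS:
  assumes "convergent_series f" "f \<noteq> 0" shows "convergent_series (strict_transform (Finite_slope c) f)"
  unfolding strict_transform_FS(1)[OF assms(2)] by (intro convergent_shift convergent_pullback assms)

lemma convergent_swap_iff [simp]: "convergent_series (swap f) \<longleftrightarrow> convergent_series f"
  by (metis convergent_swap swap_swap)

lemma convergent_unit_swap [simp]: "convergent_unit (swap f) \<longleftrightarrow> convergent_unit f"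
  by (simp add: convergent_unit_iff)

lemma irreducible_germ_swap [simp]: "irreducible_germ (swap f) \<longleftrightarrow> irreducible_germ f"
proof -
  have "irreducible_germ (swap f)" if "irreducible_germ f" for f
    unfolding irreducible_germ_def
  proof (intro conjI allI impI)
    show "convergent_series (swap f)" "swap f \<noteq> 0" "\<not> convergent_unit (swap f)"
      using that by (auto simp: irreducible_germ_def)
    fix g h assume "convergent_series g" "convergent_series h" "swap f = g * h"
    then have "f = swap g * swap h" by (metis swap_mult swap_swap)
    then have "convergent_unit (swap g) \<or> convergent_unit (swap h)"
      using that convergent_swap[OF \<open>convergent_series g\<close>] convergent_swap[OF \<open>convergent_series h\<close>]
      unfolding irreducible_germ_def by blast
    then show "convergent_unit g \<or> convergent_unit h" by simp
  qed
  from this[of f] this[of "swap f"] show ?thesis unfolding swap_swap by blast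
qed

lemma irreducible_germD:
  assumes "irreducible_germ f"
  shows "convergent_series f" "f \<noteq> 0" "f $ 0 $ 0 = 0" "1 \<le> mult0 f"
proof -
  show 1: "convergent_series f" "f \<noteq> 0" "f $ 0 $ 0 = 0" using assms by (auto simp: irreducible_germ_def convergent_unit_iff)
  obtain i j where "i + j = mult0 f" "f $ i $ j \<noteq> 0" using mult0_nz[OF 1(2)] by blast
  then show "1 \<le> mult0 f" using 1(3) by (cases "mult0 f") auto
qed

section \<open>The tangent of an irreducible germ\<close>

lemma convergent_coeff_series:
  assumes "convergent_series f" shows "convergent_series (Abs_fps (\<lambda>i. fps_const (f $ i $ j)))"
proof -
  obtain r s where 1: "0 < r" "0 < s" "r < \<infinity>" "s < \<infinity>" "germ_norm r s f < \<infinity>"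
    using assms convergent_iff by blast
  have c: "ennreal (norm (u $ j)) \<le> fps_norm s u / s ^ j" for u
  proof -
    have "ennreal (norm (u $ j)) * s ^ j \<le> fps_norm s u"
      unfolding fps_norm_def
      using sum_le_suminf[OF summableI, of "{j}" "\<lambda>j. ennreal (norm (u $ j)) * s ^ j"] by simp
    then have "ennreal (norm (u $ j)) * s ^ j / s ^ j \<le> fps_norm s u / s ^ j"
      by (rule divide_right_mono_ennreal)
    moreover have "ennreal (norm (u $ j)) * s ^ j / s ^ j = ennreal (norm (u $ j))"
      using 1 by (intro ennreal_mult_divide_eq) (auto simp: power_eq_top_ennreal_iff)
    ultimately show ?thesis by simp
  qed
  have "germ_norm r s (Abs_fps (\<lambda>i. fps_const (f $ i $ j))) \<le> suminf (\<lambda>i. fps_norm s (f $ i) * r ^ i * (1 / s ^ j))"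
    unfolding germ_norm_def
  proof (intro suminf_le summableI)
    fix i
    have "ennreal (norm (f $ i $ j)) * r ^ i \<le> (fps_norm s (f $ i) / s ^ j) * r ^ i"
      by (intro mult_right_mono c) auto
    also have "\<dots> = fps_norm s (f $ i) * r ^ i * (1 / s ^ j)"
      by (simp add: ennreal_times_divide ennreal_divide_times mult_ac)
    finally show "fps_norm s (Abs_fps (\<lambda>i. fps_const (f $ i $ j)) $ i) * r ^ i \<le> fps_norm s (f $ i) * r ^ i * (1 / s ^ j)"
      by simp
  qed
  also have "\<dots> = germ_norm r s f * (1 / s ^ j)" unfolding germ_norm_def by simp
  also have "\<dots> < \<infinity>"
    using 1 ennreal_divide_finite[of 1 s j] by (simp add: ennreal_mult_less_top)
  finally show ?thesis unfolding convergent_iff using 1 by blast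
qed

text \<open>
  The uniqueness half of Weierstrass division: the lowest coefficient of \<open>s\<close> would produce a term
  \<open>y\<^sup>q * s\<close> of degree at least \<open>q\<close>.
\<close>

lemma monic_division_unique:
  fixes W s :: series2
  assumes W: "W $ 0 = fps_X ^ q" and deg: "\<And>n k. q \<le> k \<Longrightarrow> (W * s) $ n $ k = 0"
  shows "s = 0"
proof (rule fps_ext)
  fix n show "s $ n = 0 $ n"
  proof (induction n rule: less_induct)
    case (less n)
    have "(W * s) $ n = (\<Sum>i\<le>n. W $ i * s $ (n - i))"
      by (simp add: fps_mult_nth atLeast0AtMost)
    also have "\<dots> = (\<Sum>i\<in>{0}. W $ i * s $ (n - i))"
      by (rule sum.mono_neutral_right) (use less.IH in auto)
    finally have "(W * s) $ n = fps_X ^ q * s $ n" using W by simp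
    then have "s $ n $ k = 0" for k
      using deg[of "k + q" n] by (simp add: fps_X_power_mult_nth)
    then show ?case by (simp add: fps_ext)
  qed
qed

lemma pullback_degree:
  assumes "\<And>i j. q \<le> j \<Longrightarrow> r $ i $ j = 0" "1 \<le> q" "q \<le> k"
  shows "pullback (Finite_slope c) r $ n $ k = 0"
proof -
  have "poly.coeff (form_poly r n) j = 0" if "j > q - 1" for j
    using that assms by (auto simp: coeff_form_poly)
  then have "degree (form_poly r n) \<le> q - 1" by (intro degree_le) auto
  then have "degree (form_poly r n \<circ>\<^sub>p [:c, 1:]) < k" using assms by (simp add: degree_pcompose)
  then show ?thesis unfolding pullback_nth by (simp add: coeff_eq_0)
qed

text \<open>
  This is the reason why an irreducible germ has only one tangent, and why its strict transform is
  again irreducible.  Let \<open>g\<close> be a factor of the strict transform which vanishes at the chosen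
  point.  Up to a unit \<open>g\<close> is a Weierstrass polynomial \<open>W\<close> of degree \<open>q\<close>.  Blowing it down, that is,
  forming \<open>G(x, y) = x\<^sup>q W(x, y/x - c)\<close>, gives a convergent series which is monic of degree \<open>q\<close> in
  \<open>y\<close>.  Let \<open>r\<close> be the remainder of \<open>f\<close> modulo \<open>G\<close>.  Its pull-back is a multiple of \<open>W\<close> and has degree less
  than \<open>q\<close> in \<open>y\<close>, so it vanishes, and \<open>G\<close> divides \<open>f\<close>.  Since \<open>f\<close> is irreducible, it is \<open>G\<close> up to a
  unit; then \<open>W\<close> is the strict transform up to a unit, and \<open>q\<close> is the multiplicity of \<open>f\<close>.
\<close>

lemma blowup_factor:
  assumes irr: "irreducible_germ f"
    and f': "strict_transform (Finite_slope c) f = g * h"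
    and g: "convergent_series g" and h: "convergent_series h" and g00: "g $ 0 $ 0 = 0"
  shows "h $ 0 $ 0 \<noteq> 0 \<and> (\<exists>\<kappa>. \<kappa> \<noteq> 0 \<and> strict_transform (Finite_slope c) f $ 0 = fps_const \<kappa> * fps_X ^ mult0 f)"
proof -
  define m where "m = mult0 f"
  define y :: series2 where "y = fps_const fps_X"
  define x :: series2 where "x = fps_X"
  let ?pb = "pullback (Finite_slope c)" and ?f' = "strict_transform (Finite_slope c) f"
  note irreducible_germD[OF irr]
  have pf: "?pb f = x ^ m * ?f'" and f'0: "?f' $ 0 \<noteq> 0"
    using strict_transform_FS[OF \<open>f \<noteq> 0\<close>] by (auto simp: m_def x_def)
  have g0: "g $ 0 \<noteq> 0" using f'0 unfolding f' by auto
  define q where "q = subdegree (g $ 0)"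
  have q1: "1 \<le> q" using g00 g0 by (simp add: q_def Suc_le_eq subdegree_eq_0_iff flip: neq0_conv)
  obtain A where A: "convergent_series A" "\<And>i j. q \<le> j \<Longrightarrow> (y ^ q - A * g) $ i $ j = 0"
    using weierstrass_division[of "y ^ q" g] g g0 unfolding q_def y_def by blast
  define R where "R = y ^ q - A * g"
  define W where "W = A * g"
  have R: "R $ i $ j = 0" if "q \<le> j" for i j using A(2) that by (simp add: R_def)
  have WR: "W = y ^ q - R" by (simp add: R_def W_def)
  have Rconv: "convergent_series R" unfolding R_def y_def by (intro convergent_diff convergent_power convergent_mult A g) auto
  have yq: "y ^ q = fps_const (fps_X ^ q)" by (simp add: y_def)
  have R0: "R $ 0 = 0"
  proof (rule fps_ext)
    fix j show "R $ 0 $ j = 0 $ j"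
    proof (cases "q \<le> j")
      case False
      then have "j < subdegree (g $ 0)" by (simp add: q_def)
      then have "j < subdegree (A $ 0 * g $ 0) \<or> A $ 0 * g $ 0 = 0"
        by (metis fps_mult_subdegree_ge le_add2 mult_zero_left order_less_le_trans trans_less_add2 subdegree_mult)
      then have "(A $ 0 * g $ 0) $ j = 0" by auto
      then show ?thesis using False by (simp add: R_def yq)
    qed (simp add: R)
  qed
  then have W0: "W $ 0 = fps_X ^ q" by (simp add: WR yq)
  have A00: "A $ 0 $ 0 \<noteq> 0"
  proof -
    have eq: "A $ 0 * g $ 0 = fps_X ^ q" using W0 by (simp add: W_def)
    then have "A $ 0 \<noteq> 0" by auto
    then have "subdegree (A $ 0 * g $ 0) = subdegree (A $ 0) + q"
      using g0 by (simp add: q_def)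
    then have "subdegree (A $ 0) = 0" unfolding eq by simp
    then show ?thesis using \<open>A $ 0 \<noteq> 0\<close> subdegree_eq_0_iff by blast
  qed
  define a where "a j = Abs_fps (\<lambda>i. fps_const (R $ i $ j))" for j
  have Ra: "R = (\<Sum>j<q. a j * y ^ j)"
  proof (intro fps_ext)
    fix i l
    have "(\<Sum>j<q. a j * y ^ j) $ i $ l = (\<Sum>j<q. if l = j then R $ i $ j else 0)"
      unfolding fps_sum_nth by (intro sum.cong) (auto simp: a_def y_def)
    also have "\<dots> = R $ i $ l" using R[of l i] by (simp add: sum.delta')
    finally show "R $ i $ l = (\<Sum>j<q. a j * y ^ j) $ i $ l" by simp
  qed
  \<comment> \<open>The equation \<open>y - c x\<close> of the tangent pulls back to \<open>x y\<close>.\<close>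
  define \<eta> where "\<eta> = y - fps_const (fps_const c) * x"
  have pb\<eta>: "?pb \<eta> = x * y"
    unfolding \<eta>_def y_def x_def pullback_diff pullback_slope_mult pullback_y pullback_x pullback_const
    by (simp add: algebra_simps flip: fps_const_add)
  have pba: "?pb (a j) = a j" for j
    by (rule pullback_series_x[of _ "\<lambda>i. R $ i $ j"]) (simp add: a_def)
  define G where "G = \<eta> ^ q - (\<Sum>j<q. a j * x ^ (q - j) * \<eta> ^ j)"
  have pbG: "?pb G = x ^ q * W"
  proof -
    have "?pb G = (x * y) ^ q - (\<Sum>j<q. a j * x ^ (q - j) * (x * y) ^ j)"
      unfolding G_def pullback_diff pullback_sum pullback_slope_mult pullback_power pb\<eta> pba
      by (simp add: x_def)
    also have "(\<Sum>j<q. a j * x ^ (q - j) * (x * y) ^ j) = (\<Sum>j<q. x ^ q * (a j * y ^ j))"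
    proof (rule sum.cong[OF refl])
      fix j assume "j \<in> {..<q}"
      then have "x ^ q = x ^ (q - j) * x ^ j" by (simp flip: power_add)
      then show "a j * x ^ (q - j) * (x * y) ^ j = x ^ q * (a j * y ^ j)"
        by (simp add: power_mult_distrib mult_ac)
    qed
    finally show ?thesis by (simp add: WR Ra power_mult_distrib right_diff_distrib sum_distrib_left)
  qed
  have Gconv: "convergent_series G"
    unfolding G_def \<eta>_def a_def x_def y_def
    by (intro convergent_diff convergent_power convergent_sum convergent_mult convergent_coeff_series Rconv) auto
  have G0: "G $ 0 = fps_X ^ q"
  proof -
    have "(\<Sum>j<q. a j * x ^ (q - j) * \<eta> ^ j) $ 0 = 0"
      unfolding fps_sum_nth by (rule sum.neutral) (simp add: x_def)
    moreover have "\<eta> $ 0 = fps_X" by (simp add: \<eta>_def y_def x_def)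
    ultimately show ?thesis by (simp add: G_def fps_power_zeroth)
  qed
  obtain Q where Q: "convergent_series Q" "\<And>i j. q \<le> j \<Longrightarrow> (f - Q * G) $ i $ j = 0"
    using weierstrass_division[of f G] \<open>convergent_series f\<close> Gconv G0 by auto
  obtain B where B: "A * B = 1" using A00 A(1) convergent_unit_iff[of A] unfolding convergent_unit_def by blast
  have "?pb (f - Q * G) = ?pb f - ?pb Q * (x ^ q * W)"
    unfolding pullback_diff pullback_slope_mult pbG ..
  also have "\<dots> = (A * B) * (x ^ m * (g * h)) - (A * B) * (?pb Q * (x ^ q * W))"
    unfolding B pf f' by simp
  also have "\<dots> = W * (B * x ^ m * h - A * B * ?pb Q * x ^ q)"
    unfolding W_def by (simp add: algebra_simps)
  finally have pbr: "?pb (f - Q * G) = W * (B * x ^ m * h - A * B * ?pb Q * x ^ q)" .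
  have "B * x ^ m * h - A * B * ?pb Q * x ^ q = 0"
    by (rule monic_division_unique[OF W0], unfold pbr[symmetric], rule pullback_degree[OF Q(2)]) (use q1 in auto)
  then have "?pb (f - Q * G) = 0" unfolding pbr by simp
  then have fQG: "f = Q * G" unfolding pullback_eq_0_iff by simp
  have "\<not> convergent_unit G" using q1 by (simp add: convergent_unit_iff G0)
  then have "convergent_unit Q" using irr fQG Q(1) Gconv unfolding irreducible_germ_def by blast
  then have Q00: "Q $ 0 $ 0 \<noteq> 0" by (simp add: convergent_unit_iff)
  have pQ0: "?pb Q $ 0 = fps_const (Q $ 0 $ 0)" by (rule pullback_nth_0)
  have eq: "x ^ m * ?f' = x ^ q * (?pb Q * W)"
    using arg_cong[OF fQG, of ?pb] unfolding pf pullback_slope_mult pbG by (simp add: mult_ac)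
  have sd0: "subdegree ?f' = 0" "subdegree (?pb Q) = 0" "subdegree W = 0"
    using f'0 pQ0 Q00 W0 by (auto simp: subdegree_eq_0_iff)
  have nz: "?f' \<noteq> 0" "?pb Q \<noteq> 0" "W \<noteq> 0"
    using f'0 pQ0 Q00 W0 by auto
  have "m = q"
  proof -
    have "subdegree (x ^ m * ?f') = subdegree (x ^ q * (?pb Q * W))" unfolding eq ..
    then show ?thesis using nz sd0 by (simp add: x_def)
  qed
  then have f'W: "?f' = ?pb Q * W" using eq by (simp add: x_def)
  have "?f' $ 0 = fps_const (Q $ 0 $ 0) * fps_X ^ m"
    unfolding f'W using W0 pQ0 \<open>m = q\<close> by simp
  moreover have "h = A * ?pb Q"
  proof -
    have "W * h = W * (A * ?pb Q)"
      using f'W f' by (simp add: W_def mult_ac)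
    then show ?thesis using nz by simp
  qed
  then have "h $ 0 $ 0 \<noteq> 0" using A00 pQ0 Q00 by simp
  ultimately show ?thesis using Q00 unfolding m_def by blast
qed

text \<open>
  The statement on the restriction to the exceptional curve says that the root \<open>c\<close> of the initial
  form has full multiplicity; it results from the trivial factorisation.
\<close>

lemma strict_transform_irreducible:
  assumes irr: "irreducible_germ f" and root: "poly (form_poly f (mult0 f)) c = 0"
  shows "irreducible_germ (strict_transform (Finite_slope c) f)"
    and "\<exists>\<kappa>. \<kappa> \<noteq> 0 \<and> strict_transform (Finite_slope c) f $ 0 = fps_const \<kappa> * fps_X ^ mult0 f"
proof -
  let ?f' = "strict_transform (Finite_slope c) f"
  note f = irreducible_germD[OF irr]
  have conv: "convergent_series ?f'" using f by (intro convergent_strict_FS)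
  have "?f' $ 0 = pullback (Finite_slope c) f $ mult0 f"
    unfolding strict_transform_FS(1)[OF f(2)] by simp
  then have z: "?f' $ 0 $ 0 = 0" using root unfolding pullback_nth by (simp add: poly_pcompose flip: poly_0_coeff_0)
  show "\<exists>\<kappa>. \<kappa> \<noteq> 0 \<and> ?f' $ 0 = fps_const \<kappa> * fps_X ^ mult0 f"
    using blowup_factor[OF irr, of c ?f' 1] conv z by simp
  show "irreducible_germ ?f'"
    unfolding irreducible_germ_def
  proof (intro conjI allI impI)
    show "?f' \<noteq> 0" using strict_transform_FS(3)[OF f(2), of c] by auto
    show "\<not> convergent_unit ?f'" using z by (simp add: convergent_unit_iff)
    fix g h assume gh: "convergent_series g" "convergent_series h" "?f' = g * h"
    show "convergent_unit g \<or> convergent_unit h"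
      using blowup_factor[OF irr gh(3) gh(1,2)] gh by (auto simp: convergent_unit_iff)
  qed (rule conv)
qed

section \<open>Decrease of multiplicities\<close>

lemma ydiff_x_power_mult: "ydiff (fps_X ^ m * g) = fps_X ^ m * ydiff g"
  by (intro fps_ext) (simp add: fps_X_power_mult_nth)

text \<open>
  The chain rule for the map \<open>(x, y) \<mapsto> (x, x (y + c))\<close>.
\<close>

lemma ydiff_pullback: "fps_X * pullback (Finite_slope c) (ydiff f) = ydiff (pullback (Finite_slope c) f)"
proof (rule fps_ext)
  fix n
  show "(fps_X * pullback (Finite_slope c) (ydiff f)) $ n = ydiff (pullback (Finite_slope c) f) $ n"
  proof (cases n)
    case 0
    then show ?thesis by (simp add: pullback_nth_0)
  next
    case (Suc n')
    have "form_poly (ydiff f) n' = pderiv (form_poly f (Suc n'))"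
      by (rule poly_eqI) (simp add: coeff_form_poly coeff_pderiv)
    then show ?thesis unfolding Suc
      by (simp add: pullback_nth pderiv_pcompose fps_of_poly_pderiv[symmetric] pderiv_pCons)
  qed
qed

text \<open>
  Some power of \<open>x\<close> lies in the ideal \<open>J\<close> generated by \<open>f\<close> and its derivative: the two have no common
  factor.  Among all elements \<open>x\<^sup>s G\<close> of \<open>J\<close> with \<open>G(0, y) \<noteq> 0\<close> choose one such that the order \<open>q\<close> of \<open>G(0, y)\<close>
  is minimal.  The remainder of \<open>f\<close> modulo \<open>G\<close>, multiplied by \<open>x\<^sup>s\<close>, lies in \<open>J\<close> and has smaller order, so
  it is zero, and \<open>G\<close> divides \<open>f\<close>.  If \<open>q > 0\<close> then \<open>G\<close> is \<open>f\<close> up to a unit, and the derivative of \<open>f\<close>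
  contradicts minimality.  Hence \<open>q = 0\<close> and \<open>G\<close> is a unit.
\<close>

lemma bezout_ydiff:
  assumes irr: "irreducible_germ f" and f0: "f $ 0 \<noteq> 0" and m: "2 \<le> subdegree (f $ 0)"
  shows "\<exists>A B M. A * f + B * ydiff f = fps_X ^ M"
proof -
  define J where "J = {A * f + B * ydiff f |A B. convergent_series A \<and> convergent_series B}"
  have J_mult: "c * g \<in> J" if "g \<in> J" "convergent_series c" for c g
  proof -
    obtain A B where "g = A * f + B * ydiff f" "convergent_series A" "convergent_series B"
      using \<open>g \<in> J\<close> unfolding J_def by blast
    then have "c * g = (c * A) * f + (c * B) * ydiff f" "convergent_series (c * A)" "convergent_series (c * B)"
      using that by (auto simp: algebra_simps)
    then show ?thesis unfolding J_def by blast
  qed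
  have J_diff: "g - h \<in> J" if gh: "g \<in> J" "h \<in> J" for g h
  proof -
    obtain A B where 1: "g = A * f + B * ydiff f" "convergent_series A" "convergent_series B"
      using gh unfolding J_def by blast
    obtain A' B' where 2: "h = A' * f + B' * ydiff f" "convergent_series A'" "convergent_series B'"
      using gh unfolding J_def by blast
    have "g - h = (A - A') * f + (B - B') * ydiff f" by (simp add: 1 2 algebra_simps)
    then show ?thesis unfolding J_def using 1 2 by blast
  qed
  have fc: "convergent_series f" using irreducible_germD[OF irr] by blast
  have fJ: "f \<in> J"
  proof -
    have "f = 1 * f + 0 * ydiff f" by simp
    then show ?thesis unfolding J_def using convergent_0 convergent_1 by blast
  qed
  have dJ: "ydiff f \<in> J"
  proof -
    have "ydiff f = 0 * f + 1 * ydiff f" by simp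
    then show ?thesis unfolding J_def using convergent_0 convergent_1 by blast
  qed
  define P where "P q \<longleftrightarrow> (\<exists>s G. fps_X ^ s * G \<in> J \<and> convergent_series G \<and> G $ 0 \<noteq> 0 \<and> subdegree (G $ 0) = q)" for q
  have "P (subdegree (f $ 0))"
    unfolding P_def using fJ fc f0 by (intro exI[of _ 0] exI[of _ f]) auto
  define q where "q = (LEAST q. P q)"
  have "P q" unfolding q_def by (rule LeastI) fact
  have least: "q \<le> q'" if "P q'" for q' unfolding q_def using that by (rule Least_le)
  obtain s G where G: "fps_X ^ s * G \<in> J" "convergent_series G" "G $ 0 \<noteq> 0" "subdegree (G $ 0) = q"
    using \<open>P q\<close> unfolding P_def by blast
  have "q = 0"
  proof (rule ccontr)
    assume "q \<noteq> 0"
    obtain Q where Q: "convergent_series Q" "\<And>i j. q \<le> j \<Longrightarrow> (f - Q * G) $ i $ j = 0"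
      using weierstrass_division[of f G] fc G by metis
    define r where "r = f - Q * G"
    have rc: "convergent_series r" unfolding r_def using fc Q G by blast
    have "r = 0"
    proof (rule ccontr)
      assume "r \<noteq> 0"
      define s' where "s' = subdegree r"
      define r' where "r' = fps_shift s' r"
      have r': "r = fps_X ^ s' * r'"
        unfolding r'_def s'_def by (rule fps_conv_fps_X_power_mult_fps_shift) simp
      have "r' $ 0 \<noteq> 0" unfolding r'_def s'_def using \<open>r \<noteq> 0\<close> by simp
      moreover have "r' $ 0 $ j = 0" if "q \<le> j" for j
        unfolding r'_def using Q(2)[OF that] by (simp add: r_def)
      ultimately have "subdegree (r' $ 0) < q"
        by (meson linorder_not_le nth_subdegree_nonzero)
      moreover have "P (subdegree (r' $ 0))"
      proof -
        have "fps_X ^ s * r = fps_X ^ s * f - Q * (fps_X ^ s * G)" by (simp add: r_def algebra_simps)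
        moreover have "fps_X ^ s * f - Q * (fps_X ^ s * G) \<in> J"
          using J_diff[OF J_mult[OF fJ, of "fps_X ^ s"] J_mult[OF G(1) Q(1)]] by blast
        ultimately have "fps_X ^ (s + s') * r' \<in> J" by (simp add: r' power_add mult_ac)
        moreover have "convergent_series r'" unfolding r'_def using rc by blast
        ultimately show ?thesis unfolding P_def using \<open>r' $ 0 \<noteq> 0\<close> by blast
      qed
      ultimately show False using least by fastforce
    qed
    then have fQG: "f = Q * G" by (simp add: r_def)
    have "\<not> convergent_unit G"
      using \<open>q \<noteq> 0\<close> G by (auto simp: convergent_unit_iff subdegree_eq_0_iff)
    then have "convergent_unit Q" using irr fQG Q(1) G(2) unfolding irreducible_germ_def by blast
    then have "Q $ 0 $ 0 \<noteq> 0" by (simp add: convergent_unit_iff)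
    then have "subdegree (Q $ 0) = 0" "Q $ 0 \<noteq> 0" by (auto simp: subdegree_eq_0_iff)
    then have "subdegree (f $ 0) = q" using G by (simp add: fQG)
    define m where "m = subdegree (f $ 0)"
    have "ydiff f $ 0 $ (m - 1) \<noteq> 0"
      using f0 m by (simp add: m_def)
    moreover from this have "ydiff f $ 0 \<noteq> 0" by (metis fps_zero_nth)
    ultimately have "subdegree (ydiff f $ 0) \<le> m - 1" by (meson subdegree_leI)
    moreover have "P (subdegree (ydiff f $ 0))"
      unfolding P_def using dJ fc \<open>ydiff f $ 0 \<noteq> 0\<close> by (intro exI[of _ 0] exI[of _ "ydiff f"]) auto
    ultimately show False using least \<open>subdegree (f $ 0) = q\<close> m unfolding m_def by fastforce
  qed
  then have "convergent_unit G" using G by (simp add: convergent_unit_iff subdegree_eq_0_iff)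
  then obtain H where H: "convergent_series H" "G * H = 1" unfolding convergent_unit_def by blast
  have "H * (fps_X ^ s * G) \<in> J" by (rule J_mult[OF G(1) H(1)])
  then have "fps_X ^ s * (G * H) \<in> J" by (simp add: mult_ac)
  then have "fps_X ^ s \<in> J" using H by simp
  then obtain A B where "fps_X ^ s = A * f + B * ydiff f" unfolding J_def by blast
  then show ?thesis by metis
qed

text \<open>
  Pulling back a relation \<open>A f + B f\<^sub>y = x\<^sup>M\<close> and dividing by \<open>x\<^sup>m\<^sup>-\<^sup>1\<close> gives a relation of the same form
  for the strict transform, with \<open>M\<close> replaced by \<open>M + 1 - m\<close>.  If the multiplicity \<open>m \<ge> 2\<close> persisted
  for ever, then \<open>M\<close> would decrease for ever.
\<close>

lemma multiplicity_drops_finite_slope: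
  fixes h :: "nat \<Rightarrow> series2"
  assumes irr: "\<And>k. irreducible_germ (h k)" and m: "\<And>k. mult0 (h k) = m" "2 \<le> m"
    and step: "\<And>k. h (Suc k) = strict_transform (Finite_slope (c k)) (h k)"
    and root: "\<And>k. poly (form_poly (h k) m) (c k) = 0"
  shows False
proof -
  have z: "h k $ 0 $ 0 = 0" for k using irreducible_germD[OF irr] by blast
  have "\<exists>\<kappa>. \<kappa> \<noteq> 0 \<and> h (Suc k) $ 0 = fps_const \<kappa> * fps_X ^ m" for k
    using strict_transform_irreducible(2)[OF irr[of k], of "c k"] root[of k] by (simp add: m step)
  then obtain \<kappa> where \<kappa>: "\<And>k. \<kappa> k \<noteq> 0" "\<And>k. h (Suc k) $ 0 = fps_const (\<kappa> k) * fps_X ^ m" by metis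
  have sd: "subdegree (h (Suc k) $ 0) = m" "h (Suc k) $ 0 \<noteq> 0" for k
    using \<kappa>[of k] by auto
  have dz: "ydiff (h (Suc k)) $ 0 $ 0 = 0" for k
    using \<kappa>(2)[of k] m(2) by simp
  have no: "A * h (Suc k) + B * ydiff (h (Suc k)) \<noteq> fps_X ^ M" for A B k M
  proof (induction M arbitrary: A B k rule: less_induct)
    case (less M)
    show ?case
    proof
      assume eq: "A * h (Suc k) + B * ydiff (h (Suc k)) = fps_X ^ M"
      let ?c = "c (Suc k)" and ?f = "h (Suc k)" and ?f' = "h (Suc (Suc k))"
      let ?pb = "pullback (Finite_slope ?c)"
      have pf: "?pb ?f = fps_X ^ m * ?f'"
        using strict_transform_FS(2)[OF irreducible_germD(2)[OF irr], of ?c "Suc k"] by (simp add: m flip: step)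
      have "fps_X * fps_X ^ M = fps_X * ?pb (A * ?f + B * ydiff ?f)"
        unfolding eq pullback_power by simp
      also have "\<dots> = fps_X * ?pb A * ?pb ?f + ?pb B * (fps_X * ?pb (ydiff ?f))"
        by (simp add: pullback_add pullback_slope_mult algebra_simps)
      also have "\<dots> = fps_X ^ m * (fps_X * ?pb A * ?f' + ?pb B * ydiff ?f')"
        unfolding ydiff_pullback pf ydiff_x_power_mult by (simp add: algebra_simps)
      finally have e: "fps_X ^ Suc M = fps_X ^ m * (fps_X * ?pb A * ?f' + ?pb B * ydiff ?f')" by simp
      show False
      proof (cases "Suc M < m")
        case True
        then have "(fps_X ^ Suc M :: series2) $ Suc M = 0" unfolding e by (simp add: fps_X_power_mult_nth)
        then show False by simp
      next
        case False
        then have "fps_X ^ Suc M = fps_X ^ m * (fps_X ^ (Suc M - m) :: series2)" by (simp flip: power_add)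
        then have e2: "(fps_X * ?pb A) * ?f' + ?pb B * ydiff ?f' = fps_X ^ (Suc M - m)"
          using e by (simp del: power_Suc)
        show False
        proof (cases "Suc M - m < M")
          case True
          then show False using less.IH e2 by blast
        next
          case False
          then have "M = 0" using m by linarith
          then have "(A * ?f + B * ydiff ?f) $ 0 $ 0 = 1" using eq by simp
          then show False using z dz by simp
        qed
      qed
    qed
  qed
  moreover have "\<exists>A B M. A * h (Suc 0) + B * ydiff (h (Suc 0)) = fps_X ^ M"
    by (rule bezout_ydiff) (use irr sd m in auto)
  ultimately show False by blast
qed

lemma tangent_chart_cases:
  assumes irr: "irreducible_germ f"
  obtains (FS) c where "tangent_chart f = Finite_slope c" "poly (form_poly f (mult0 f)) c = 0" "f $ 0 $ mult0 f \<noteq> 0"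
    | (V) "tangent_chart f = Vertical" "poly (form_poly (swap f) (mult0 (swap f))) 0 = 0" "f $ 0 $ mult0 f = 0"
proof (cases "f $ 0 $ mult0 f = 0")
  case True
  show ?thesis
  proof (rule V)
    show "poly (form_poly (swap f) (mult0 (swap f))) 0 = 0"
      using True by (simp add: coeff_form_poly poly_0_coeff_0)
  qed (use True in \<open>auto simp: tangent_chart_def\<close>)
next
  case False
  define m where "m = mult0 f"
  let ?P = "\<lambda>c. (\<Sum>j\<le>m. f $ (m - j) $ j * c ^ j) = 0"
  have m1: "1 \<le> m" using irreducible_germD[OF irr] by (simp add: m_def)
  have "poly.coeff (form_poly f m) m \<noteq> 0" using False by (simp add: coeff_form_poly m_def)
  then have "m \<le> degree (form_poly f m)" by (rule le_degree)
  then have "\<not> constant (poly (form_poly f m))" using m1 by (simp add: constant_degree)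
  then have "\<exists>c. poly (form_poly f m) c = 0" by (rule fundamental_theorem_of_algebra)
  then have "\<exists>c. ?P c" by (simp add: poly_form_poly)
  then have "?P (SOME c. ?P c)" by (rule someI_ex)
  then show ?thesis
    using False FS[of "SOME c. ?P c"] by (simp add: tangent_chart_def m_def[symmetric] poly_form_poly)
qed

lemma tangent_chart_strict:
  assumes irr: "irreducible_germ f"
  shows "irreducible_germ (strict_transform (tangent_chart f) f)"
    and "mult0 (strict_transform (tangent_chart f) f) \<le> mult0 f"
proof -
  have *: "irreducible_germ (strict_transform (Finite_slope c) f) \<and> mult0 (strict_transform (Finite_slope c) f) \<le> mult0 f"
    if fc: "irreducible_germ f" "poly (form_poly f (mult0 f)) c = 0" for f c
  proof -
    obtain \<kappa> where \<kappa>: "\<kappa> \<noteq> 0" "strict_transform (Finite_slope c) f $ 0 = fps_const \<kappa> * fps_X ^ mult0 f"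
      using strict_transform_irreducible(2)[OF fc] by blast
    then have "strict_transform (Finite_slope c) f $ 0 $ mult0 f \<noteq> 0" by simp
    from mult0_le[OF this] show ?thesis using strict_transform_irreducible(1)[OF fc] by simp
  qed
  have nz: "f \<noteq> 0" using irreducible_germD[OF irr] by blast
  have "irreducible_germ (strict_transform (tangent_chart f) f) \<and> mult0 (strict_transform (tangent_chart f) f) \<le> mult0 f"
    using irr
  proof (cases rule: tangent_chart_cases)
    case (FS c)
    then show ?thesis using *[OF irr FS(2)] by simp
  next
    case V
    then show ?thesis using *[OF _ V(2)] irr nz by (simp add: strict_transform_Vertical(1))
  qed
  then show "irreducible_germ (strict_transform (tangent_chart f) f)"
    and "mult0 (strict_transform (tangent_chart f) f) \<le> mult0 f" by auto
qed

lemma strict_eq_irreducible: "irreducible_germ f \<Longrightarrow> irreducible_germ (strict_eq f k)"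
  by (induction k) (auto intro: tangent_chart_strict)

lemma mult0_strict_eq_antimono:
  assumes "irreducible_germ f" shows "antimono (\<lambda>k. mult0 (strict_eq f k))"
  unfolding decseq_Suc_iff using tangent_chart_strict(2)[OF strict_eq_irreducible[OF assms]] by simp

text \<open>
  Multiplicities do not increase, so they are eventually constant, say equal to \<open>m\<close>.  As long as they
  are constant, the new exceptional curve is not tangent to the strict transform; therefore a chart
  \<open>Finite_slope\<close> is never followed by \<open>Vertical\<close>.  So the charts are eventually all of the first or
  all of the second kind, and \<open>multiplicity_drops_finite_slope\<close> excludes \<open>m \<ge> 2\<close>, in the second case
  after an exchange of the variables.
\<close>

lemma multiplicity_eventually_1:
  assumes irr: "irreducible_germ f"
  shows "\<exists>k0. \<forall>k\<ge>k0. mult0 (strict_eq f k) = 1"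
proof -
  define n where "n k = mult0 (strict_eq f k)" for k
  have anti: "n j \<le> n i" if "i \<le> j" for i j
    using mult0_strict_eq_antimono[OF irr] that unfolding n_def antimono_def by blast
  have irrk: "irreducible_germ (strict_eq f k)" for k by (rule strict_eq_irreducible[OF irr])
  have n1: "1 \<le> n k" for k unfolding n_def using irreducible_germD(4)[OF irrk] .
  define m where "m = (LEAST m. m \<in> range n)"
  have "m \<in> range n" unfolding m_def by (rule LeastI[of _ "n 0"]) simp
  then obtain k0 where k0: "n k0 = m" by blast
  have mk: "n k = m" if "k \<ge> k0" for k
    using anti[OF that] k0 Least_le[of "\<lambda>m. m \<in> range n" "n k"] by (simp add: m_def[symmetric])
  have "m = 1"
  proof (rule ccontr)
    assume "m \<noteq> 1"
    then have m2: "2 \<le> m" using n1[of k0] k0 by linarith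
    show False
    proof (cases "\<exists>k1\<ge>k0. chart_at f k1 \<noteq> Vertical")
      case True
      then obtain k1 where k1: "k1 \<ge> k0" "chart_at f k1 \<noteq> Vertical" by blast
      have FS: "\<exists>c. chart_at f (k1 + j) = Finite_slope c \<and> poly (form_poly (strict_eq f (k1 + j)) m) c = 0" for j
      proof (induction j)
        case 0
        show ?case using irrk[of k1]
        proof (cases rule: tangent_chart_cases)
          case (FS c) then show ?thesis using mk[OF k1(1)] by (auto simp: chart_at_def n_def)
        next
          case V then show ?thesis using k1 by (simp add: chart_at_def)
        qed
      next
        case (Suc j)
        then obtain c where c: "chart_at f (k1 + j) = Finite_slope c" "poly (form_poly (strict_eq f (k1 + j)) m) c = 0" by blast
        have mj: "mult0 (strict_eq f (k1 + j)) = m" "mult0 (strict_eq f (k1 + Suc j)) = m"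
          using mk[of "k1 + j"] mk[of "k1 + Suc j"] k1 by (simp_all add: n_def)
        obtain \<kappa> where "\<kappa> \<noteq> 0" "strict_eq f (k1 + Suc j) $ 0 = fps_const \<kappa> * fps_X ^ m"
          using strict_transform_irreducible(2)[OF irrk, of "k1 + j" c] c mj by (auto simp: chart_at_def)
        then have nz: "strict_eq f (k1 + Suc j) $ 0 $ m \<noteq> 0" by simp
        show ?case using irrk[of "k1 + Suc j"]
        proof (cases rule: tangent_chart_cases)
          case (FS c) then show ?thesis unfolding chart_at_def mj by blast
        next
          case V then show ?thesis using nz unfolding mj by blast
        qed
      qed
      then obtain c where c: "\<And>j. chart_at f (k1 + j) = Finite_slope (c j)" "\<And>j. poly (form_poly (strict_eq f (k1 + j)) m) (c j) = 0"
        by metis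
      show False
      proof (rule multiplicity_drops_finite_slope[of "\<lambda>j. strict_eq f (k1 + j)" m c])
        show "mult0 (strict_eq f (k1 + k)) = m" for k using mk[of "k1 + k"] k1 by (simp add: n_def)
        show "strict_eq f (k1 + Suc k) = strict_transform (Finite_slope (c k)) (strict_eq f (k1 + k))" for k
          using c(1)[of k] by (simp add: chart_at_def)
      qed (use irrk m2 c in auto)
    next
      case False
      then have V: "tangent_chart (strict_eq f k) = Vertical" if "k \<ge> k0" for k
        using that by (auto simp: chart_at_def)
      show False
      proof (rule multiplicity_drops_finite_slope[of "\<lambda>j. swap (strict_eq f (k0 + j))" m "\<lambda>_. 0"])
        show mm: "mult0 (swap (strict_eq f (k0 + k))) = m" for k using mk[of "k0 + k"] by (simp add: n_def)
        show "swap (strict_eq f (k0 + Suc k)) = strict_transform (Finite_slope 0) (swap (strict_eq f (k0 + k)))" for k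
          using V[of "k0 + k"] strict_transform_Vertical(1)[of "strict_eq f (k0 + k)"] irreducible_germD(2)[OF irrk, of "k0 + k"] by simp
        show "poly (form_poly (swap (strict_eq f (k0 + k))) m) 0 = 0" for k
          using irrk[of "k0 + k"]
        proof (cases rule: tangent_chart_cases)
          case (FS c) then show ?thesis using V[of "k0 + k"] by simp
        next
          case V' : V then show ?thesis unfolding mm by blast
        qed
      qed (use irrk m2 in auto)
    qed
  qed
  then show ?thesis using mk unfolding n_def by blast
qed

section \<open>Exceptional curves as coordinate axes\<close>

text \<open>
  In the chosen coordinates, the exceptional curves which pass through \<open>P\<^sub>k\<close> are coordinate axes.
\<close>

definition is_axis :: "series2 \<Rightarrow> bool" where
  "is_axis e \<longleftrightarrow> e = fps_X \<or> e = fps_const fps_X"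

text \<open>
  The restriction of \<open>g\<close> to the axis \<open>e\<close>; its order is the intersection multiplicity of \<open>g\<close> and \<open>e\<close> at
  the origin.
\<close>

definition restriction :: "series2 \<Rightarrow> series2 \<Rightarrow> complex fps" where
  "restriction e g = (if e = fps_X then g $ 0 else swap g $ 0)"

lemma x_neq_y [simp]: "(fps_X :: series2) \<noteq> fps_const fps_X" "fps_const fps_X \<noteq> (fps_X :: series2)"
proof -
  show "(fps_X :: series2) \<noteq> fps_const fps_X"
  proof
    assume "(fps_X :: series2) = fps_const fps_X"
    then have "(fps_X :: series2) $ 1 $ 0 = fps_const fps_X $ 1 $ 0" by simp
    then show False by simp
  qed
  then show "fps_const fps_X \<noteq> (fps_X :: series2)" by metis
qed

lemma restriction_x [simp]: "restriction fps_X g = g $ 0" by (simp add: restriction_def)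
lemma restriction_y [simp]: "restriction (fps_const fps_X) g = swap g $ 0" by (simp add: restriction_def)

lemma restriction_swap: "is_axis e \<Longrightarrow> restriction (swap e) (swap g) = restriction e g"
  by (auto simp: is_axis_def swap_x swap_y)

lemma is_axis_swap [simp]: "is_axis (swap e) \<longleftrightarrow> is_axis e"
  unfolding is_axis_def by (metis swap_swap swap_x swap_y)

lemma is_axis_nonunit: "is_axis e \<Longrightarrow> e $ 0 $ 0 = 0 \<and> mult0 e = 1 \<and> e \<noteq> 0"
proof -
  have x: "mult0 fps_X = 1"
    unfolding mult0_def
  proof (rule Least_equality)
    show "\<exists>i j. i + j = 1 \<and> (fps_X :: series2) $ i $ j \<noteq> 0" by (intro exI[of _ 1] exI[of _ 0]) simp
    fix n assume "\<exists>i j. i + j = n \<and> (fps_X :: series2) $ i $ j \<noteq> 0"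
    then show "1 \<le> n" by (cases n) auto
  qed
  then have y: "mult0 (fps_const fps_X) = 1" by (simp flip: swap_x)
  assume "is_axis e"
  then show ?thesis unfolding is_axis_def using x y by auto
qed

lemma mult0_eq_0: "g $ 0 $ 0 \<noteq> 0 \<Longrightarrow> mult0 g = 0"
  using mult0_le[of g 0 0] by simp

lemma strict_transform_unit:
  assumes "u $ 0 $ 0 \<noteq> 0" shows "strict_transform ch u $ 0 $ 0 \<noteq> 0"
proof -
  have u: "u \<noteq> 0" using assms by auto
  have FS: "strict_transform (Finite_slope c) u $ 0 $ 0 \<noteq> 0" if "u $ 0 $ 0 \<noteq> 0" "u \<noteq> 0" for u c
    using that by (simp add: strict_transform_FS(1) mult0_eq_0 pullback_nth_0)
  show ?thesis
  proof (cases ch)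
    case (Finite_slope c)
    then show ?thesis using FS[OF assms u] by simp
  next
    case Vertical
    have "strict_transform (Finite_slope 0) (swap u) $ 0 $ 0 \<noteq> 0" by (rule FS) (use assms u in auto)
    then show ?thesis using Vertical u by (simp add: strict_transform_Vertical(1))
  qed
qed

lemma strict_transform_FS_eqI:
  assumes "g \<noteq> 0" "pullback (Finite_slope c) g = fps_X ^ mult0 g * h"
  shows "strict_transform (Finite_slope c) g = h"
  using strict_transform_FS(2)[OF assms(1), of c] assms(2) by simp

lemma strict_transform_FS_x: "strict_transform (Finite_slope c) fps_X = 1"
  by (rule strict_transform_FS_eqI) (use is_axis_nonunit[of fps_X] in \<open>auto simp: is_axis_def\<close>)

lemma strict_transform_FS_y: "strict_transform (Finite_slope c) (fps_const fps_X) = fps_const (fps_X + fps_const c)"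
  by (rule strict_transform_FS_eqI) (use is_axis_nonunit[of "fps_const fps_X"] in \<open>auto simp: is_axis_def pullback_y\<close>)

lemma strict_transform_V_x: "strict_transform Vertical fps_X = fps_X"
  by (simp add: strict_transform_Vertical(1) swap_x strict_transform_FS_y swap_y)

lemma strict_transform_V_y: "strict_transform Vertical (fps_const fps_X) = 1"
  by (simp add: strict_transform_Vertical(1) swap_y strict_transform_FS_x)

lemma is_axis_exceptional: "is_axis (exceptional ch)"
  by (cases ch) (auto simp: is_axis_def)

text \<open>
  Each chart keeps at most one of the axes, and its exceptional curve is the other one.
\<close>

lemma strict_transform_axis:
  assumes "is_axis e"
  shows "is_axis (strict_transform ch e) \<or> strict_transform ch e $ 0 $ 0 \<noteq> 0"
    and "is_axis (strict_transform ch e) \<Longrightarrow> strict_transform ch e \<noteq> exceptional ch"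
    and "is_axis (strict_transform ch e) \<Longrightarrow> e = exceptional ch \<Longrightarrow> False"
proof -
  have ax: "is_axis (fps_const fps_X)" by (simp add: is_axis_def)
  have n1: "\<not> is_axis 1"
  proof
    assume "is_axis 1"
    from is_axis_nonunit[OF this] show False by simp
  qed
  have nc: "c = 0" if "is_axis (fps_const (fps_X + fps_const c))" for c
    using is_axis_nonunit[OF that] by simp
  have y: "is_axis (fps_const (fps_X + fps_const c)) \<or> fps_const (fps_X + fps_const c) $ 0 $ 0 \<noteq> 0" for c :: complex
    using ax by (cases "c = 0") simp_all
  have all: "(is_axis (strict_transform ch e) \<or> strict_transform ch e $ 0 $ 0 \<noteq> 0) \<and>
     (is_axis (strict_transform ch e) \<longrightarrow> strict_transform ch e \<noteq> exceptional ch \<and> e \<noteq> exceptional ch)"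
  proof (cases ch)
    case (Finite_slope c)
    consider "e = fps_X" | "e = fps_const fps_X" using assms unfolding is_axis_def by blast
    then show ?thesis
    proof cases
      case 1
      then show ?thesis using n1 by (simp add: Finite_slope strict_transform_FS_x)
    next
      case 2
      have "strict_transform ch e \<noteq> exceptional ch" if "is_axis (strict_transform ch e)"
        using nc[of c] that by (simp add: 2 Finite_slope strict_transform_FS_y)
      then show ?thesis using y[of c] by (simp add: 2 Finite_slope strict_transform_FS_y)
    qed
  next
    case Vertical
    consider "e = fps_X" | "e = fps_const fps_X" using assms unfolding is_axis_def by blast
    then show ?thesis
    proof cases
      case 1
      then show ?thesis using assms by (simp add: Vertical strict_transform_V_x)
    next
      case 2
      then show ?thesis using n1 by (simp add: Vertical strict_transform_V_y)
    qed
  qed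
  show "is_axis (strict_transform ch e) \<or> strict_transform ch e $ 0 $ 0 \<noteq> 0"
    and "is_axis (strict_transform ch e) \<Longrightarrow> strict_transform ch e \<noteq> exceptional ch"
    and "is_axis (strict_transform ch e) \<Longrightarrow> e = exceptional ch \<Longrightarrow> False"
    using all by blast+
qed

text \<open>
  Noether's formula for the intersection multiplicity of \<open>f\<close> with a smooth curve \<open>e\<close>, in a situation
  where the strict transform of \<open>f\<close> meets the exceptional curve only at the origin of the chart.
  Since the initial form of \<open>f\<close> is a multiple of \<open>(y - c x)\<^sup>m\<close>, its restrictions to the axes which are
  not tangent to \<open>f\<close> do not vanish, and the order of \<open>f\<close> on these axes is exactly \<open>m\<close>.
\<close>

lemma blowup_restriction_FS:
  assumes irr: "irreducible_germ f" and root: "poly (form_poly f (mult0 f)) c = 0"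
    and e: "is_axis e" "restriction e f \<noteq> 0"
  defines "f' \<equiv> strict_transform (Finite_slope c) f" and "e' \<equiv> strict_transform (Finite_slope c) e"
  shows "is_axis e' \<Longrightarrow> restriction e' f' \<noteq> 0 \<and> subdegree (restriction e f) = mult0 f + subdegree (restriction e' f')"
    and "\<not> is_axis e' \<Longrightarrow> subdegree (restriction e f) = mult0 f"
proof -
  define m where "m = mult0 f"
  note f = irreducible_germD[OF irr]
  obtain \<kappa> where \<kappa>: "\<kappa> \<noteq> 0" "f' $ 0 = fps_const \<kappa> * fps_X ^ m"
    using strict_transform_irreducible(2)[OF irr root] unfolding f'_def m_def by blast
  have pf: "pullback (Finite_slope c) f = fps_X ^ m * f'"
    unfolding f'_def m_def by (rule strict_transform_FS(2)[OF f(2)])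
  have "pullback (Finite_slope c) f $ m = f' $ 0" unfolding pf by (simp add: fps_X_power_mult_nth)
  then have "fps_of_poly (form_poly f m \<circ>\<^sub>p [:c, 1:]) = fps_of_poly (Polynomial.monom \<kappa> m)"
    unfolding pullback_nth \<kappa> by (simp add: fps_of_poly_monom)
  then have P: "form_poly f m \<circ>\<^sub>p [:c, 1:] = Polynomial.monom \<kappa> m"
    unfolding fps_of_poly_eq_iff .
  have top: "f $ 0 $ m \<noteq> 0"
  proof -
    have "degree (form_poly f m) = m"
      using arg_cong[OF P, of degree] \<kappa> by (simp add: degree_pcompose degree_monom_eq)
    moreover have "form_poly f m \<noteq> 0" unfolding m_def by (rule form_poly_mult0[OF f(2)])
    ultimately have "poly.coeff (form_poly f m) m \<noteq> 0" using leading_coeff_neq_0 by metis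
    then show ?thesis by (simp add: coeff_form_poly)
  qed
  have bot: "f $ m $ 0 = \<kappa> * (- c) ^ m"
    using arg_cong[OF P, of "\<lambda>p. poly p (- c)"]
    by (simp add: poly_pcompose poly_monom poly_0_coeff_0 coeff_form_poly)
  have sx: "subdegree (f $ 0) = m"
    using top by (intro subdegreeI) (auto simp: m_def below_mult0)
  consider "e = fps_X" | "e = fps_const fps_X" "c \<noteq> 0" | "e = fps_const fps_X" "c = 0"
    using e unfolding is_axis_def by blast
  then show "is_axis e' \<Longrightarrow> restriction e' f' \<noteq> 0 \<and> subdegree (restriction e f) = mult0 f + subdegree (restriction e' f')"
    and "\<not> is_axis e' \<Longrightarrow> subdegree (restriction e f) = mult0 f"
  proof (atomize (full), cases)
    case 1
    then have "\<not> is_axis e'" unfolding e'_def using strict_transform_axis(3)[of e "Finite_slope c"] e by auto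
    then show "(is_axis e' \<longrightarrow> restriction e' f' \<noteq> 0 \<and> subdegree (restriction e f) = mult0 f + subdegree (restriction e' f')) \<and>
        (\<not> is_axis e' \<longrightarrow> subdegree (restriction e f) = mult0 f)"
      using 1 sx by (simp add: m_def)
  next
    case 2
    then have "e' $ 0 $ 0 \<noteq> 0" by (simp add: e'_def strict_transform_FS_y)
    then have "\<not> is_axis e'" using is_axis_nonunit by blast
    moreover have "subdegree (swap f $ 0) = m"
      using 2 bot \<kappa> by (intro subdegreeI) (auto simp: m_def below_mult0)
    ultimately show "(is_axis e' \<longrightarrow> restriction e' f' \<noteq> 0 \<and> subdegree (restriction e f) = mult0 f + subdegree (restriction e' f')) \<and>
        (\<not> is_axis e' \<longrightarrow> subdegree (restriction e f) = mult0 f)"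
      using 2 by (simp add: m_def)
  next
    case 3
    then have e': "e' = fps_const fps_X" by (simp add: e'_def strict_transform_FS_y)
    have "swap f $ 0 = fps_X ^ m * (swap f' $ 0)"
    proof -
      have "swap (pullback (Finite_slope c) f) $ 0 = swap f $ 0"
        by (rule fps_ext) (simp add: pullback_nth 3 coeff_form_poly)
      then show ?thesis unfolding pf by (simp add: swap_mult swap_power swap_x)
    qed
    moreover from this have "swap f' $ 0 \<noteq> 0" using e 3 by auto
    ultimately show "(is_axis e' \<longrightarrow> restriction e' f' \<noteq> 0 \<and> subdegree (restriction e f) = mult0 f + subdegree (restriction e' f')) \<and>
        (\<not> is_axis e' \<longrightarrow> subdegree (restriction e f) = mult0 f)"
      using 3 e' by (simp add: m_def is_axis_def)
  qed
qed

lemma blowup_restriction: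
  assumes irr: "irreducible_germ f" and e: "is_axis e" "restriction e f \<noteq> 0"
  defines "f' \<equiv> strict_transform (tangent_chart f) f" and "e' \<equiv> strict_transform (tangent_chart f) e"
  shows "is_axis e' \<Longrightarrow> restriction e' f' \<noteq> 0 \<and> subdegree (restriction e f) = mult0 f + subdegree (restriction e' f')"
    and "\<not> is_axis e' \<Longrightarrow> subdegree (restriction e f) = mult0 f"
proof -
  have "(is_axis e' \<longrightarrow> restriction e' f' \<noteq> 0 \<and> subdegree (restriction e f) = mult0 f + subdegree (restriction e' f')) \<and>
        (\<not> is_axis e' \<longrightarrow> subdegree (restriction e f) = mult0 f)"
    using irr
  proof (cases rule: tangent_chart_cases)
    case (FS c)
    show ?thesis unfolding e'_def f'_def FS(1) using blowup_restriction_FS[OF irr FS(2) e] by blast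
  next
    case V
    have nz: "e \<noteq> 0" "f \<noteq> 0" using is_axis_nonunit[OF e(1)] irreducible_germD[OF irr] by auto
    let ?e = "swap e'" and ?f = "swap f'"
    have *: "strict_transform (Finite_slope 0) (swap f) = ?f" "strict_transform (Finite_slope 0) (swap e) = ?e"
      unfolding e'_def f'_def V(1) using nz by (simp_all add: strict_transform_Vertical(1))
    have "irreducible_germ (swap f)" "is_axis (swap e)" "restriction (swap e) (swap f) \<noteq> 0"
      using irr e by (auto simp: restriction_swap)
    from blowup_restriction_FS[OF this(1) V(2) this(2,3)] 
    show ?thesis unfolding * using e by (auto simp: restriction_swap)
  qed
  then show "is_axis e' \<Longrightarrow> restriction e' f' \<noteq> 0 \<and> subdegree (restriction e f) = mult0 f + subdegree (restriction e' f')"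
    and "\<not> is_axis e' \<Longrightarrow> subdegree (restriction e f) = mult0 f" by auto
qed

lemma restriction_exceptional:
  assumes irr: "irreducible_germ f"
  defines "f' \<equiv> strict_transform (tangent_chart f) f"
  shows "restriction (exceptional (tangent_chart f)) f' \<noteq> 0"
    and "subdegree (restriction (exceptional (tangent_chart f)) f') = mult0 f"
proof -
  have *: "strict_transform (Finite_slope c) f $ 0 \<noteq> 0 \<and> subdegree (strict_transform (Finite_slope c) f $ 0) = mult0 f"
    if fc: "irreducible_germ f" "poly (form_poly f (mult0 f)) c = 0" for f c
    using strict_transform_irreducible(2)[OF fc] by auto
  have "restriction (exceptional (tangent_chart f)) f' \<noteq> 0 \<and> subdegree (restriction (exceptional (tangent_chart f)) f') = mult0 f"
    using irr
  proof (cases rule: tangent_chart_cases)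
    case (FS c)
    show ?thesis unfolding f'_def FS(1) using *[OF irr FS(2)] by simp
  next
    case V
    show ?thesis unfolding f'_def V(1) using *[OF _ V(2)] irr irreducible_germD(2)[OF irr]
      by (simp add: strict_transform_Vertical(1))
  qed
  then show "restriction (exceptional (tangent_chart f)) f' \<noteq> 0"
    and "subdegree (restriction (exceptional (tangent_chart f)) f') = mult0 f" by auto
qed

section \<open>Proximity\<close>

lemma exc_eq_cases: 
  assumes "v < k" shows "(passes_through f k v \<and> is_axis (exc_eq f k v)) \<or> (\<not> passes_through f k v \<and> exc_eq f k v $ 0 $ 0 \<noteq> 0)"
proof -
  have "is_axis (exc_eq f k v) \<or> exc_eq f k v $ 0 $ 0 \<noteq> 0"
    using assms
  proof (induction k)
    case (Suc k)
    show ?case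
    proof (cases "v = k")
      case True then show ?thesis using is_axis_exceptional by simp
    next
      case False
      then have "is_axis (exc_eq f k v) \<or> exc_eq f k v $ 0 $ 0 \<noteq> 0" using Suc by simp
      then show ?thesis using False strict_transform_axis(1) strict_transform_unit by auto
    qed
  qed simp
  then show ?thesis using assms is_axis_nonunit unfolding passes_through_def by blast
qed

lemma passes_through_axis: "passes_through f k v \<Longrightarrow> is_axis (exc_eq f k v)"
  using exc_eq_cases[of v k f] is_axis_nonunit unfolding passes_through_def by blast

lemma passes_through_less: "passes_through f k v \<Longrightarrow> v < k"
  by (simp add: passes_through_def)

lemma passes_through_last: "passes_through f (Suc k) k"
  using is_axis_nonunit[OF is_axis_exceptional] by (simp add: passes_through_def)

lemma passes_through_Suc: "passes_through f (Suc k) v \<Longrightarrow> v < k \<Longrightarrow> passes_through f k v"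
  using exc_eq_cases[of v k f] strict_transform_unit by (fastforce simp: passes_through_def)

lemma passes_through_mono: "passes_through f k v \<Longrightarrow> v < j \<Longrightarrow> j \<le> k \<Longrightarrow> passes_through f j v"
proof (induction k)
  case (Suc k)
  show ?case
  proof (cases "j = Suc k")
    case False
    then have "v < k" "j \<le> k" using Suc.prems by auto
    then show ?thesis using Suc passes_through_Suc by blast
  qed (use Suc in simp)
qed simp

text \<open>
  Two different exceptional curves through the same point are different axes.
\<close>

lemma exc_eq_inj: "passes_through f k v \<Longrightarrow> passes_through f k w \<Longrightarrow> exc_eq f k v = exc_eq f k w \<Longrightarrow> v = w"
proof (induction k)
  case (Suc k)
  consider "v = k" "w = k" | "v = k" "w < k" | "v < k" "w = k" | "v < k" "w < k"
    using Suc.prems(1,2) passes_through_less by (metis less_antisym)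
  then show ?case
  proof cases
    case 2
    then have "exc_eq f (Suc k) w \<noteq> exceptional (chart_at f k)"
      using strict_transform_axis(2)[of "exc_eq f k w" "chart_at f k"] passes_through_axis Suc.prems passes_through_Suc by force
    then show ?thesis using 2 Suc.prems by simp
  next
    case 3
    then have "exc_eq f (Suc k) v \<noteq> exceptional (chart_at f k)"
      using strict_transform_axis(2)[of "exc_eq f k v" "chart_at f k"] passes_through_axis Suc.prems passes_through_Suc by force
    then show ?thesis using 3 Suc.prems by simp
  next
    case 4
    then have p: "passes_through f k v" "passes_through f k w" using Suc.prems passes_through_Suc by auto
    have "exc_eq f k u \<noteq> exceptional (chart_at f k)" if "u < k" "passes_through f (Suc k) u" for u
      using strict_transform_axis(3)[of "exc_eq f k u" "chart_at f k"] passes_through_axis[OF that(2)] 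
        passes_through_axis[OF passes_through_Suc[OF that(2,1)]] that by auto
    then have "exc_eq f k v \<noteq> exceptional (chart_at f k)" "exc_eq f k w \<noteq> exceptional (chart_at f k)"
      using 4 Suc.prems by auto
    then have "exc_eq f k v = exc_eq f k w"
      using passes_through_axis[OF p(1)] passes_through_axis[OF p(2)] is_axis_exceptional[of "chart_at f k"]
      unfolding is_axis_def by metis
    then show ?thesis using Suc.IH p by blast
  qed auto
qed (simp add: passes_through_def)

text \<open>
  One of the two axes is the exceptional curve created last.
\<close>

lemma passes_through_unique:
  assumes "passes_through f k v" "passes_through f k w" "Suc v < k" "Suc w < k"
  shows "v = w"
proof -
  obtain k' where k: "k = Suc k'" using assms by (cases k) auto
  have "passes_through f k k'" unfolding k by (rule passes_through_last)
  then have "exc_eq f k v \<noteq> exc_eq f k k'" "exc_eq f k w \<noteq> exc_eq f k k'"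
    using exc_eq_inj assms k by blast+
  then have "exc_eq f k v = exc_eq f k w"
    using passes_through_axis assms \<open>passes_through f k k'\<close> unfolding is_axis_def by metis
  then show ?thesis using exc_eq_inj assms by blast
qed

abbreviation mult_at :: "series2 \<Rightarrow> nat \<Rightarrow> nat" where
  "mult_at f k \<equiv> mult0 (strict_eq f k)"

text \<open>
  The intersection multiplicity with \<open>E\<^sub>v\<close> at its first point is the multiplicity of the strict
  transform at \<open>P\<^sub>v\<close>.  Blowing up a point of \<open>E\<^sub>v\<close> lowers it by the multiplicity at this point, until the
  curves are separated.
\<close>

lemma proximity:
  assumes irr: "irreducible_germ f" and "v < k"
  shows "passes_through f k v \<Longrightarrow> restriction (exc_eq f k v) (strict_eq f k) \<noteq> 0 \<and>
      mult_at f v = subdegree (restriction (exc_eq f k v) (strict_eq f k)) + (\<Sum>j | v < j \<and> j < k \<and> passes_through f j v. mult_at f j)"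
    and "\<not> passes_through f k v \<Longrightarrow> mult_at f v = (\<Sum>j | v < j \<and> j < k \<and> passes_through f j v. mult_at f j)"
proof -
  let ?S = "\<lambda>k. \<Sum>j | v < j \<and> j < k \<and> passes_through f j v. mult_at f j"
  let ?r = "\<lambda>k. restriction (exc_eq f k v) (strict_eq f k)"
  have S: "?S (Suc k) = ?S k + (if passes_through f k v then mult_at f k else 0)" if "v < k" for k
  proof -
    have "{j. v < j \<and> j < Suc k \<and> passes_through f j v} =
       (if passes_through f k v then insert k {j. v < j \<and> j < k \<and> passes_through f j v} else {j. v < j \<and> j < k \<and> passes_through f j v})"
      using that by (auto simp: less_Suc_eq)
    then show ?thesis by simp
  qed
  have "if passes_through f k v then ?r k \<noteq> 0 \<and> mult_at f v = subdegree (?r k) + ?S k else mult_at f v = ?S k"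
    using \<open>v < k\<close>
  proof (induction k)
    case (Suc k)
    show ?case
    proof (cases "v = k")
      case True
      have "{j. v < j \<and> j < Suc k \<and> passes_through f j v} = {}" using True by auto
      then have "?S (Suc k) = 0" by (simp only: sum.empty)
      moreover have "passes_through f (Suc k) v" using True passes_through_last by simp
      moreover have "?r (Suc k) \<noteq> 0" "subdegree (?r (Suc k)) = mult_at f v"
        using restriction_exceptional[OF strict_eq_irreducible[OF irr], of k] True by (simp_all add: chart_at_def)
      ultimately show ?thesis by simp
    next
      case False
      then have vk: "v < k" using Suc by simp
      have e': "exc_eq f (Suc k) v = strict_transform (tangent_chart (strict_eq f k)) (exc_eq f k v)"
        using False by (simp add: chart_at_def)
      show ?thesis
      proof (cases "passes_through f k v")
        case True
        note IH = Suc.IH[OF vk, unfolded if_P[OF True]]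
        note st = blowup_restriction[OF strict_eq_irreducible[OF irr, of k] passes_through_axis[OF True] conjunct1[OF IH],
              folded e']
        show ?thesis
        proof (cases "passes_through f (Suc k) v")
          case True' : True
          then have "is_axis (exc_eq f (Suc k) v)" by (rule passes_through_axis)
          from st(1)[OF this] show ?thesis using IH True True' S[OF vk] by simp
        next
          case False' : False
          then have "\<not> is_axis (exc_eq f (Suc k) v)"
            using exc_eq_cases[of v "Suc k" f] vk is_axis_nonunit by auto
          from st(2)[OF this] show ?thesis using IH True False' S[OF vk] by simp
        qed
      next
        case False
        then show ?thesis using Suc.IH[OF vk] S[OF vk] passes_through_Suc[OF _ vk] by auto
      qed
    qed
  qed simp
  then show "passes_through f k v \<Longrightarrow> ?r k \<noteq> 0 \<and> mult_at f v = subdegree (?r k) + ?S k"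
    and "\<not> passes_through f k v \<Longrightarrow> mult_at f v = ?S k" by simp_all
qed

lemma transversal_iff:
  assumes irr: "irreducible_germ f" and p: "passes_through f k v"
  shows "transversal (strict_eq f k) (exc_eq f k v) \<longleftrightarrow> subdegree (restriction (exc_eq f k v) (strict_eq f k)) = 1"
    and "subdegree (restriction (exc_eq f k v) (strict_eq f k)) \<ge> 1"
proof -
  let ?g = "strict_eq f k"
  have z: "?g $ 0 $ 0 = 0" using irreducible_germD(3)[OF strict_eq_irreducible[OF irr]] .
  have "restriction (exc_eq f k v) ?g \<noteq> 0" using proximity(1)[OF irr passes_through_less[OF p] p] by blast
  moreover have r0: "restriction (exc_eq f k v) ?g $ 0 = 0" using z by (simp add: restriction_def)
  ultimately show 1: "subdegree (restriction (exc_eq f k v) ?g) \<ge> 1"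
    by (simp add: Suc_le_eq subdegree_eq_0_iff flip: neq0_conv)
  have sub: "subdegree r = 1 \<longleftrightarrow> r $ 1 \<noteq> 0" if "r $ 0 = 0" "r \<noteq> 0" for r :: "complex fps"
  proof
    assume "subdegree r = 1" then show "r $ 1 \<noteq> 0" using nth_subdegree_nonzero[OF that(2)] by simp
  next
    assume "r $ 1 \<noteq> 0" then show "subdegree r = 1" using that(1) by (intro subdegreeI) auto
  qed
  have "transversal ?g (exc_eq f k v) \<longleftrightarrow> restriction (exc_eq f k v) ?g $ 1 \<noteq> 0"
    using passes_through_axis[OF p] unfolding is_axis_def by (auto simp: transversal_def)
  then show "transversal ?g (exc_eq f k v) \<longleftrightarrow> subdegree (restriction (exc_eq f k v) ?g) = 1"
    using sub[OF r0 \<open>restriction (exc_eq f k v) ?g \<noteq> 0\<close>] by simp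
qed

section \<open>The minimal good embedded resolution\<close>

lemma mult_at_pos: "irreducible_germ f \<Longrightarrow> 1 \<le> mult_at f k"
  using irreducible_germD(4)[OF strict_eq_irreducible] .

text \<open>
  If \<open>E\<^sub>v\<close> passes through \<open>P\<^sub>k\<close>, then it passes through all points between, each of which accounts for at
  least \<open>1\<close> in the intersection multiplicity, and \<open>P\<^sub>k\<close> accounts for at least \<open>1\<close> as well.
\<close>

lemma passes_through_bound:
  assumes irr: "irreducible_germ f" and p: "passes_through f k v"
  shows "k \<le> v + mult_at f v"
proof -
  have vk: "v < k" using passes_through_less[OF p] .
  have eq: "{j. v < j \<and> j < k \<and> passes_through f j v} = {v<..<k}"
    using passes_through_mono[OF p] by auto
  have "k - Suc v = (\<Sum>j\<in>{v<..<k}. 1)" by simp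
  also have "\<dots> \<le> (\<Sum>j\<in>{v<..<k}. mult_at f j)" by (intro sum_mono mult_at_pos[OF irr])
  also have "\<dots> < mult_at f v"
    using proximity(1)[OF irr vk p] transversal_iff(2)[OF irr p] unfolding eq by linarith
  finally show ?thesis using vk by linarith
qed

text \<open>
  Once the multiplicity is \<open>1\<close>, every new exceptional curve \<open>E\<^sub>v\<close> contains \<open>P\<^sub>v\<^sub>+\<^sub>1\<close> but no later point of the
  germ, and meets the germ transversally.  The finitely many older curves are left behind
  after finitely many steps, by \<open>passes_through_bound\<close>.
\<close>

lemma normal_crossing_exists:
  assumes irr: "irreducible_germ f" shows "\<exists>k. normal_crossing_at f k"
proof -
  obtain k0 where k0: "\<And>k. k0 \<le> k \<Longrightarrow> mult_at f k = 1" using multiplicity_eventually_1[OF irr] by blast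
  \<comment> \<open>Large enough that no curve \<open>E\<^sub>v\<close> with \<open>v < k0\<close> reaches the point after \<open>P\<^sub>l\<close>.\<close>
  define l where "l = k0 + (\<Sum>v<k0. v + mult_at f v)"
  have only: "v = l" if p: "passes_through f (Suc l) v" for v
  proof (cases "v < k0")
    case True
    then have "v + mult_at f v \<le> (\<Sum>v<k0. v + mult_at f v)"
      by (intro member_le_sum) auto
    then show ?thesis using passes_through_bound[OF irr p] by (simp add: l_def)
  next
    case False
    then have "mult_at f v = 1" by (intro k0) simp
    then show ?thesis using passes_through_bound[OF irr p] passes_through_less[OF p] by simp
  qed
  have set: "{v. passes_through f (Suc l) v} = {l}" using only passes_through_last by blast
  have "{j. l < j \<and> j < Suc l \<and> passes_through f j l} = {}" by auto
  then have "subdegree (restriction (exc_eq f (Suc l) l) (strict_eq f (Suc l))) = mult_at f l"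
    using proximity(1)[OF irr, of l "Suc l"] passes_through_last by (simp del: strict_eq.simps exc_eq.simps)
  also have "\<dots> = 1" by (rule k0) (simp add: l_def)
  finally have "transversal (strict_eq f (Suc l)) (exc_eq f (Suc l) l)"
    using transversal_iff(1)[OF irr passes_through_last] by blast
  moreover have "mult_at f (Suc l) = 1" by (rule k0) (simp add: l_def)
  ultimately have "normal_crossing_at f (Suc l)"
    unfolding normal_crossing_at_def using only set by (auto simp del: strict_eq.simps exc_eq.simps)
  then show ?thesis by blast
qed

lemma cuspD: "cusp f \<Longrightarrow> irreducible_germ f" "cusp f \<Longrightarrow> 2 \<le> mult_at f 0"
  by (simp_all add: cusp_def)

lemma normal_crossing_blow_up_count: "cusp f \<Longrightarrow> normal_crossing_at f (blow_up_count f)"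
  unfolding blow_up_count_def using normal_crossing_exists[OF cuspD(1)] by (rule LeastI_ex)

lemma blow_up_count_pos: "cusp f \<Longrightarrow> 0 < blow_up_count f"
  using normal_crossing_blow_up_count[of f] cuspD(2)[of f] by (cases "blow_up_count f") (auto simp: normal_crossing_at_def)

lemma mult_at_after:
  assumes "cusp f" "blow_up_count f \<le> k" shows "mult_at f k = 1"
proof -
  note irr = cuspD(1)[OF assms(1)]
  have "mult_at f k \<le> mult_at f (blow_up_count f)"
    using mult0_strict_eq_antimono[OF irr] assms(2) by (simp add: antimono_def)
  also have "\<dots> = 1" using normal_crossing_blow_up_count[OF assms(1)] by (simp add: normal_crossing_at_def)
  finally show ?thesis using mult_at_pos[OF irr, of k] by simp
qed

lemma passes_through_end:
  assumes "cusp f" shows "passes_through f (blow_up_count f) v \<longleftrightarrow> Suc v = blow_up_count f"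
proof -
  define N where "N = blow_up_count f"
  have nc: "normal_crossing_at f N" unfolding N_def by (rule normal_crossing_blow_up_count[OF assms])
  have N: "N = Suc (N - 1)" using blow_up_count_pos[OF assms] by (simp add: N_def)
  have last: "passes_through f N (N - 1)" by (subst N) (rule passes_through_last)
  have fin: "finite {v. passes_through f N v}"
    by (rule finite_subset[of _ "{..<N}"]) (auto dest: passes_through_less)
  have "card {v. passes_through f N v} \<le> 1" using nc by (simp add: normal_crossing_at_def)
  then have "passes_through f N v \<Longrightarrow> v = N - 1"
    using last card_le_Suc0_iff_eq[OF fin] by auto
  then show ?thesis using last N unfolding N_def[symmetric] by auto
qed

text \<open>
  The strict transform of the germ meets only the last exceptional curve, transversally in one
  point.  In terms of the intersection form: its class has product \<open>1\<close> with the last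
  exceptional curve and product \<open>0\<close> with the others.
\<close>

lemma proximity_end:
  assumes "cusp f" "v < blow_up_count f"
  shows "mult_at f v = (if Suc v = blow_up_count f then 1 else 0) + (\<Sum>j | j < blow_up_count f \<and> passes_through f j v. mult_at f j)"
proof -
  note irr = cuspD(1)[OF assms(1)]
  let ?N = "blow_up_count f"
  have eq: "{j. v < j \<and> j < ?N \<and> passes_through f j v} = {j. j < ?N \<and> passes_through f j v}"
    using passes_through_less by auto
  show ?thesis
  proof (cases "Suc v = ?N")
    case True
    then have p: "passes_through f ?N v" using passes_through_end[OF assms(1)] by simp
    have "subdegree (restriction (exc_eq f ?N v) (strict_eq f ?N)) = 1"
      using normal_crossing_blow_up_count[OF assms(1)] p transversal_iff(1)[OF irr p] by (simp add: normal_crossing_at_def)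
    then show ?thesis using proximity(1)[OF irr assms(2) p] True unfolding eq by simp
  next
    case False
    then have "\<not> passes_through f ?N v" using passes_through_end[OF assms(1)] by simp
    then show ?thesis using proximity(2)[OF irr assms(2)] False unfolding eq by simp
  qed
qed

lemma exc_self_int_eq:
  "v < k \<Longrightarrow> exc_self_int f k v = - 1 - int (card {j. j < k \<and> passes_through f j v})"
proof (induction k)
  case (Suc k)
  show ?case
  proof (cases "v = k")
    case True
    then have "{j. j < Suc k \<and> passes_through f j v} = {}" using passes_through_less by force
    then show ?thesis using True by (simp only: exc_self_int.simps card.empty) simp
  next
    case False
    have "{j. j < Suc k \<and> passes_through f j v} =
       (if passes_through f k v then insert k {j. j < k \<and> passes_through f j v} else {j. j < k \<and> passes_through f j v})"
      by (auto simp: less_Suc_eq)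
    then show ?thesis using Suc False by simp
  qed
qed simp

lemma exc_meet_sym: "exc_meet f k v w = exc_meet f k w v"
  by (induction k) auto

lemma exc_meet_iff:
  "v < w \<Longrightarrow> w < k \<Longrightarrow> exc_meet f k v w \<longleftrightarrow> passes_through f w v \<and> (\<forall>j<k. \<not> (passes_through f j v \<and> passes_through f j w))"
proof (induction k)
  case (Suc k)
  show ?case
  proof (cases "w = k")
    case True
    then have "\<not> passes_through f j w" if "j < Suc k" for j using that passes_through_less[of f j w] by auto
    then show ?thesis using Suc True by auto
  next
    case False
    then show ?thesis using Suc by (auto simp: less_Suc_eq)
  qed
qed simp

text \<open>
  The right-hand side is the intersection number of \<open>E\<^sub>v\<close> and \<open>E\<^sub>w\<close>, computed from the total transforms of
  which they are combinations.  If \<open>v < w\<close> and both curves contain \<open>P\<^sub>j\<close>, then \<open>j = w + 1\<close>; so the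
  cardinality is \<open>1\<close> if the curves have met and have been separated, and \<open>0\<close> otherwise.
\<close>

lemma exc_meet_count:
  assumes "v < k" "w < k" "v \<noteq> w"
  shows "(if exc_meet f k v w then 1 else 0) = (if passes_through f w v then 1 else 0) + (if passes_through f v w then 1 else 0)
     - int (card {j. j < k \<and> passes_through f j v \<and> passes_through f j w})"
proof -
  have *: "(if exc_meet f k v w then 1 else 0) = (if passes_through f w v then 1 else 0)
     - int (card {j. j < k \<and> passes_through f j v \<and> passes_through f j w})" if "v < w" "w < k" for v w
  proof -
    let ?S = "{j. j < k \<and> passes_through f j v \<and> passes_through f j w}"
    have jw: "j = Suc w \<and> passes_through f w v" if "j \<in> ?S" for j
    proof -
      have j: "passes_through f j v" "passes_through f j w" using that by auto
      have "w < j" using passes_through_less[OF j(2)] .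
      have "\<not> Suc w < j"
        using passes_through_unique[OF j] \<open>v < w\<close> by auto
      moreover have "passes_through f w v" using passes_through_mono[OF j(1)] \<open>v < w\<close> \<open>w < j\<close> by auto
      ultimately show ?thesis using \<open>w < j\<close> by auto
    qed
    show ?thesis
    proof (cases "?S = {}")
      case True
      then have "\<forall>j<k. \<not> (passes_through f j v \<and> passes_through f j w)" by blast
      moreover have "card ?S = 0" unfolding True by simp
      ultimately show ?thesis using exc_meet_iff[OF that] by simp
    next
      case False
      then obtain j where j: "j \<in> ?S" by blast
      then have "?S = {Suc w}" using jw by blast
      then have "card ?S = 1" by simp
      moreover have "passes_through f w v" using jw[OF j] by simp
      moreover have "\<not> exc_meet f k v w" using exc_meet_iff[OF that] j by blast
      ultimately show ?thesis by simp
    qed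
  qed
  show ?thesis
  proof (cases "v < w")
    case True
    then have "\<not> passes_through f v w" using passes_through_less by fastforce
    then show ?thesis using *[OF True assms(2)] by simp
  next
    case False
    then have "w < v" using assms by simp
    then have "\<not> passes_through f w v" using passes_through_less by fastforce
    then show ?thesis using *[OF \<open>w < v\<close> assms(1)] exc_meet_sym[of f k v w] by (simp add: conj_commute)
  qed
qed

text \<open>
  Every curve \<open>E\<^sub>v\<close> except the last one contains the point \<open>P\<^sub>v\<^sub>+\<^sub>1\<close>, which is blown up.
\<close>

lemma minus_one_vertex_eq:
  assumes "cusp f" shows "minus_one_vertex (resolution_graph f) = blow_up_count f - 1"
proof -
  define N where "N = blow_up_count f"
  have N: "0 < N" using blow_up_count_pos[OF assms] by (simp add: N_def)
  have last: "exc_self_int f N (N - 1) = - 1"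
  proof -
    have "{j. j < N \<and> passes_through f j (N - 1)} = {}" using passes_through_less by fastforce
    then show ?thesis using exc_self_int_eq[of "N - 1" N f] N by simp
  qed
  have "v = N - 1" if "v < N" "exc_self_int f N v = - 1" for v
  proof (rule ccontr)
    assume "v \<noteq> N - 1"
    then have "Suc v \<in> {j. j < N \<and> passes_through f j v}" using that passes_through_last by simp
    moreover have "finite {j. j < N \<and> passes_through f j v}" by simp
    ultimately have "card {j. j < N \<and> passes_through f j v} \<noteq> 0" by (metis card_0_eq empty_iff)
    then show False using exc_self_int_eq[OF that(1), of f] that(2) by linarith
  qed
  then show ?thesis
    unfolding minus_one_vertex_def resolution_graph_def N_def[symmetric] using N last
    by (intro the_equality) auto
qed

section \<open>Multiplicities of the total transform\<close>

lemma pullback_eq_strict: "g \<noteq> 0 \<Longrightarrow> pullback ch g = exceptional ch ^ mult0 g * strict_transform ch g"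
  using strict_transform_FS(2) strict_transform_Vertical(2) by (cases ch) auto

lemma pullback_times: "pullback ch (g * h) = pullback ch g * pullback ch h"
  by (cases ch) (simp_all add: pullback_slope_mult pullback_Vertical swap_mult)

lemma pullback_one: "pullback ch 1 = 1"
  by (cases ch) (simp_all add: pullback_Vertical)

lemma pullback_prod: "pullback ch (\<Prod>i\<in>A. g i) = (\<Prod>i\<in>A. pullback ch (g i))"
  by (induction A rule: infinite_finite_induct) (simp_all add: pullback_times pullback_one)

lemma pullback_pow: "pullback ch (g ^ n) = pullback ch g ^ n"
  by (induction n) (simp_all add: pullback_times pullback_one)

text \<open>
  The multiplicity of the total transform of \<open>f\<close> along \<open>E\<^sub>k\<close>, which equals its multiplicity at the
  point \<open>P\<^sub>k\<close>.
\<close>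

fun total_mult :: "series2 \<Rightarrow> nat \<Rightarrow> nat" where
  "total_mult f k = mult_at f k + (\<Sum>v<k. if passes_through f k v then total_mult f v else 0)"

declare total_mult.simps [simp del]

lemma exc_eq_nz: "v < k \<Longrightarrow> exc_eq f k v \<noteq> 0"
  using exc_eq_cases[of v k f] is_axis_nonunit by auto

lemma mult0_exc_eq: "v < k \<Longrightarrow> mult0 (exc_eq f k v) = (if passes_through f k v then 1 else 0)"
  using exc_eq_cases[of v k f] is_axis_nonunit mult0_eq_0 by auto

lemma total_eq_factorisation:
  assumes irr: "irreducible_germ f"
  shows "total_eq f k = (\<Prod>v<k. exc_eq f k v ^ total_mult f v) * strict_eq f k"
proof (induction k)
  case (Suc k)
  define ch where "ch = chart_at f k"
  let ?e = "exceptional ch" and ?exc = "\<lambda>v. strict_transform ch (exc_eq f k v)"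
  have "total_eq f (Suc k) = (\<Prod>v<k. pullback ch (exc_eq f k v) ^ total_mult f v) * pullback ch (strict_eq f k)"
    by (simp add: Suc ch_def pullback_times pullback_prod pullback_pow)
  also have "pullback ch (strict_eq f k) = ?e ^ mult_at f k * strict_eq f (Suc k)"
    using pullback_eq_strict[OF irreducible_germD(2)[OF strict_eq_irreducible[OF irr]], of ch k] by (simp add: ch_def chart_at_def)
  also have "(\<Prod>v<k. pullback ch (exc_eq f k v) ^ total_mult f v)
    = (\<Prod>v<k. ?e ^ (if passes_through f k v then total_mult f v else 0) * ?exc v ^ total_mult f v)"
  proof (rule prod.cong[OF refl])
    fix v assume "v \<in> {..<k}"
    then have "v < k" by simp
    show "pullback ch (exc_eq f k v) ^ total_mult f v = ?e ^ (if passes_through f k v then total_mult f v else 0) * ?exc v ^ total_mult f v"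
      unfolding pullback_eq_strict[OF exc_eq_nz[OF \<open>v < k\<close>]] mult0_exc_eq[OF \<open>v < k\<close>] by (simp add: power_mult_distrib)
  qed
  also have "\<dots> = ?e ^ (\<Sum>v<k. if passes_through f k v then total_mult f v else 0) * (\<Prod>v<k. ?exc v ^ total_mult f v)"
    by (simp add: prod.distrib power_sum)
  also have "\<dots> * (?e ^ mult_at f k * strict_eq f (Suc k)) = ?e ^ total_mult f k * (\<Prod>v<k. ?exc v ^ total_mult f v) * strict_eq f (Suc k)"
    by (simp add: total_mult.simps[of f k] power_add mult_ac)
  also have "?e ^ total_mult f k * (\<Prod>v<k. ?exc v ^ total_mult f v) = (\<Prod>v<Suc k. exc_eq f (Suc k) v ^ total_mult f v)"
    by (simp add: ch_def mult.commute)
  finally show ?case .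
qed simp

lemma restriction_times: "restriction e (g * h) = restriction e g * restriction e h"
  by (simp add: restriction_def swap_mult)

lemma restriction_one: "restriction e 1 = 1"
  by (simp add: restriction_def)

lemma restriction_pow: "restriction e (g ^ n) = restriction e g ^ n"
  by (induction n) (simp_all add: restriction_times restriction_one)

lemma restriction_prod: "restriction e (\<Prod>i\<in>A. g i) = (\<Prod>i\<in>A. restriction e (g i))"
  by (induction A rule: infinite_finite_induct) (simp_all add: restriction_times restriction_one)

lemma restriction_self: "is_axis e \<Longrightarrow> restriction e e = 0"
  by (auto simp: is_axis_def swap_y)

text \<open>
  The factors of the total transform other than the power of the equation of \<open>E\<^sub>v\<close> have non-zero
  restriction to \<open>E\<^sub>v\<close>.
\<close>

lemma pullback_mult_eq:
  assumes irr: "irreducible_germ f" shows "pullback_mult f v = total_mult f v"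
proof -
  let ?e = "exc_eq f (Suc v) v"
  define R where "R = (\<Prod>u<v. exc_eq f (Suc v) u ^ total_mult f u) * strict_eq f (Suc v)"
  have ax: "is_axis ?e" by (rule passes_through_axis[OF passes_through_last])
  have tot: "total_eq f (Suc v) = ?e ^ total_mult f v * R"
    unfolding total_eq_factorisation[OF irr] R_def by (simp del: exc_eq.simps strict_eq.simps add: mult_ac)
  have "restriction ?e R \<noteq> 0"
  proof -
    have "restriction ?e (exc_eq f (Suc v) u) \<noteq> 0" if "u < v" for u
    proof (cases "passes_through f (Suc v) u")
      case True
      then have "exc_eq f (Suc v) u \<noteq> ?e" using exc_eq_inj[OF True passes_through_last] that by blast
      moreover have "is_axis (exc_eq f (Suc v) u)" by (rule passes_through_axis[OF True])
      ultimately show ?thesis using ax unfolding is_axis_def by (auto simp: swap_x simp del: exc_eq.simps)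
    next
      case False
      then have "exc_eq f (Suc v) u $ 0 $ 0 \<noteq> 0" using exc_eq_cases[of u "Suc v" f] that by simp
      then have "restriction ?e (exc_eq f (Suc v) u) $ 0 \<noteq> 0" by (simp add: restriction_def del: exc_eq.simps)
      then show ?thesis by (metis fps_zero_nth)
    qed
    moreover have "restriction ?e (strict_eq f (Suc v)) \<noteq> 0"
      using proximity(1)[OF irr _ passes_through_last] by blast
    ultimately show ?thesis unfolding R_def restriction_times restriction_prod restriction_pow
      by (simp del: exc_eq.simps strict_eq.simps)
  qed
  then have nd: "\<not> ?e dvd R"
    using restriction_self[OF ax] by (auto simp: restriction_times elim!: dvdE simp del: exc_eq.simps)
  have enz: "?e \<noteq> 0" using is_axis_nonunit[OF ax] by blast
  show ?thesis unfolding pullback_mult_def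
  proof (rule Greatest_equality)
    show "?e ^ total_mult f v dvd total_eq f (Suc v)" unfolding tot by simp
    fix n assume "?e ^ n dvd total_eq f (Suc v)"
    then have d: "?e ^ n dvd ?e ^ total_mult f v * R" unfolding tot .
    show "n \<le> total_mult f v"
    proof (rule ccontr)
      assume "\<not> n \<le> total_mult f v"
      then have "?e ^ Suc (total_mult f v) dvd ?e ^ n" by (intro le_imp_power_dvd) simp
      then have "?e ^ total_mult f v * ?e dvd ?e ^ total_mult f v * R" using d by (metis dvd_trans power_Suc2)
      then show False using nd enz by (simp del: exc_eq.simps)
    qed
  qed
qed

text \<open>
  Double counting over the pairs \<open>(v, k)\<close> such that \<open>P\<^sub>k\<close> lies on \<open>E\<^sub>v\<close>: the recursion for the
  multiplicities of the total transform and the equalities \<open>proximity_end\<close> are transposed to each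
  other.
\<close>

lemma pullback_mult_end:
  assumes "cusp f" shows "pullback_mult f (blow_up_count f - 1) = (\<Sum>k<blow_up_count f. mult_at f k ^ 2)"
proof -
  note irr = cuspD(1)[OF assms]
  define N where "N = blow_up_count f"
  have N: "0 < N" using blow_up_count_pos[OF assms] by (simp add: N_def)
  let ?\<mu> = "total_mult f" and ?n = "mult_at f"
  have "(\<Sum>v<N. ?\<mu> v * ?n v) = (\<Sum>v<N. ?\<mu> v * (if Suc v = N then 1 else 0)) + (\<Sum>v<N. \<Sum>k<N. if passes_through f k v then ?\<mu> v * ?n k else 0)"
    unfolding sum.distrib[symmetric]
  proof (rule sum.cong[OF refl])
    fix v assume "v \<in> {..<N}"
    then have "?n v = (if Suc v = N then 1 else 0) + (\<Sum>j | j < N \<and> passes_through f j v. ?n j)"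
      using proximity_end[OF assms] by (simp add: N_def)
    also have "(\<Sum>j | j < N \<and> passes_through f j v. ?n j) = (\<Sum>j<N. if passes_through f j v then ?n j else 0)"
      by (simp add: sum.If_cases Int_def lessThan_def)
    finally have nv: "?n v = (if Suc v = N then 1 else 0) + (\<Sum>j<N. if passes_through f j v then ?n j else 0)" .
    show "?\<mu> v * ?n v = ?\<mu> v * (if Suc v = N then 1 else 0) + (\<Sum>k<N. if passes_through f k v then ?\<mu> v * ?n k else 0)"
      by (subst nv) (simp add: distrib_left sum_distrib_left if_distrib cong: if_cong)
  qed
  also have "(\<Sum>v<N. ?\<mu> v * (if Suc v = N then 1 else 0)) = (\<Sum>v\<in>{N - 1}. ?\<mu> v * (if Suc v = N then 1 else 0))"
    using N by (intro sum.mono_neutral_right) auto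
  also have "\<dots> = ?\<mu> (N - 1)" using N by simp
  also have "(\<Sum>v<N. \<Sum>k<N. if passes_through f k v then ?\<mu> v * ?n k else 0) = (\<Sum>k<N. \<Sum>v<N. if passes_through f k v then ?\<mu> v * ?n k else 0)"
    by (rule sum.swap)
  finally have 1: "(\<Sum>v<N. ?\<mu> v * ?n v) = ?\<mu> (N - 1) + (\<Sum>k<N. \<Sum>v<N. if passes_through f k v then ?\<mu> v * ?n k else 0)" .
  have "(\<Sum>k<N. ?\<mu> k * ?n k) = (\<Sum>k<N. ?n k ^ 2) + (\<Sum>k<N. \<Sum>v<N. if passes_through f k v then ?\<mu> v * ?n k else 0)"
    unfolding sum.distrib[symmetric]
  proof (rule sum.cong[OF refl])
    fix k assume "k \<in> {..<N}"
    have "(\<Sum>v<k. if passes_through f k v then ?\<mu> v else 0) = (\<Sum>v<N. if passes_through f k v then ?\<mu> v else 0)"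
      by (rule sum.mono_neutral_left) (use \<open>k \<in> {..<N}\<close> in \<open>auto dest: passes_through_less\<close>)
    then have "?\<mu> k = ?n k + (\<Sum>v<N. if passes_through f k v then ?\<mu> v else 0)"
      by (subst total_mult.simps) simp
    then show "?\<mu> k * ?n k = ?n k ^ 2 + (\<Sum>v<N. if passes_through f k v then ?\<mu> v * ?n k else 0)"
      by (auto simp: distrib_right sum_distrib_right power2_eq_square intro!: sum.cong)
  qed
  then have "(\<Sum>k<N. ?n k ^ 2) = ?\<mu> (N - 1)" using 1 by simp
  then show ?thesis using pullback_mult_eq[OF irr] by (simp add: N_def)
qed

text \<open>
  The resolution blows up more points than the multiplicity sequence has entries; at the additional
  ones the multiplicity is \<open>1\<close>.
\<close>

lemma multiplicity_sequence_mset: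
  assumes "cusp f"
  shows "filter_mset (\<lambda>n. n \<noteq> 1) (mset (multiplicity_sequence f)) =
     image_mset (mult_at f) (mset_set {k. k < blow_up_count f \<and> mult_at f k \<noteq> 1})"
proof -
  let ?P = "\<lambda>n. \<forall>k\<ge>n. mult_at f k = 1"
  define r where "r = (LEAST n. ?P n)"
  have PN: "?P (blow_up_count f)" using mult_at_after[OF assms] by blast
  have r: "?P r" unfolding r_def by (rule LeastI[of ?P, OF PN])
  have rN: "r \<le> blow_up_count f" unfolding r_def by (rule Least_le[of ?P, OF PN])
  have "mset (multiplicity_sequence f) = image_mset (mult_at f) (mset_set {0..<r})"
    by (simp add: multiplicity_sequence_def r_def)
  then have "filter_mset (\<lambda>n. n \<noteq> 1) (mset (multiplicity_sequence f)) = image_mset (mult_at f) (mset_set {k \<in> {0..<r}. mult_at f k \<noteq> 1})"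
    by (simp add: filter_mset_image_mset)
  also have "{k \<in> {0..<r}. mult_at f k \<noteq> 1} = {k. k < blow_up_count f \<and> mult_at f k \<noteq> 1}"
    using r rN by (auto simp: not_less[symmetric])
  finally show ?thesis .
qed

section \<open>Cocycles of degree zero\<close>

abbreviation e0 :: "nat \<Rightarrow> real" where "e0 \<equiv> (\<lambda>j. if j = 0 then 1 else 0)"

definition point_simplex :: "'a \<Rightarrow> (nat \<Rightarrow> real) \<Rightarrow> 'a" where
  "point_simplex a = restrict (\<lambda>_. a) (standard_simplex 0)"

lemma e0_in [simp]: "e0 \<in> standard_simplex 0"
  by (simp add: standard_simplex_0)

lemma point_simplex_e0 [simp]: "point_simplex a e0 = a"
  unfolding point_simplex_def by (rule restrict_apply') (rule e0_in)

lemma singular_point_simplex: "singular_simplex 0 X (point_simplex a) \<longleftrightarrow> a \<in> topspace X"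
proof
  assume "singular_simplex 0 X (point_simplex a)"
  then have "\<forall>t\<in>standard_simplex 0. point_simplex a t \<in> topspace X"
    unfolding singular_simplex_def continuous_map_def by (auto simp: Pi_iff)
  then have "point_simplex a e0 \<in> topspace X" using e0_in by blast
  then show "a \<in> topspace X" by simp
next
  assume "a \<in> topspace X"
  then show "singular_simplex 0 X (point_simplex a)"
    unfolding singular_simplex_def point_simplex_def
    by (auto intro: continuous_map_eq[of _ _ "\<lambda>_. a"])
qed

lemma singular_simplex_0_eq: 
  assumes "singular_simplex 0 X \<sigma>" shows "\<sigma> = point_simplex (\<sigma> e0)" "\<sigma> e0 \<in> topspace X"
proof -
  have "\<sigma> \<in> extensional (standard_simplex 0)" using assms by (simp add: singular_simplex_def)
  then show "\<sigma> = point_simplex (\<sigma> e0)"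
    by (auto simp: point_simplex_def restrict_def extensional_def standard_simplex_0)
  show "\<sigma> e0 \<in> topspace X"
    using assms unfolding singular_simplex_def continuous_map_def using e0_in by (auto simp: Pi_iff)
qed

text \<open>
  This is the cocycle condition in degree \<open>0\<close>.
\<close>

definition path_constant :: "'a topology \<Rightarrow> ('a \<Rightarrow> int) \<Rightarrow> bool" where
  "path_constant X u \<longleftrightarrow> (\<forall>g. pathin X g \<longrightarrow> u (g 0) = u (g 1))"

lemma path_constantD: "path_constant X u \<Longrightarrow> pathin X g \<Longrightarrow> u (g 0) = u (g 1)"
  by (simp add: path_constant_def)

lemma path_boundary:
  assumes g: "pathin X g"
  shows "\<exists>c. singular_chain 1 X c \<and> chain_boundary 1 c = frag_of (point_simplex (g 0)) - frag_of (point_simplex (g 1))"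
proof -
  define X' where "X' = subtopology X (g ` {0..1})"
  have top: "topspace X' = g ` {0..1}"
    unfolding X'_def using path_image_subset_topspace[OF g] by auto
  have "path_connectedin X (g ` {0..1})"
    using g by (rule path_connectedin_path_image)
  then have "path_connected_space X'" by (simp add: X'_def path_connectedin_def)
  moreover have "singular_simplex 0 X' (point_simplex (g 0))" "singular_simplex 0 X' (point_simplex (g 1))"
    by (simp_all add: singular_point_simplex top)
  ultimately have "homologous_rel 0 X' {} (frag_of (point_simplex (g 0))) (frag_of (point_simplex (g 1)))"
    by (rule iso_integer_zeroth_homology_group_aux)
  then obtain c where "singular_chain 1 X' c" "chain_boundary 1 c = frag_of (point_simplex (g 0)) - frag_of (point_simplex (g 1))"
    by (auto simp: homologous_rel_def singular_boundary)
  then show ?thesis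
    unfolding X'_def singular_chain_subtopology by blast
qed

definition evaluate :: "('a \<Rightarrow> int) \<Rightarrow> 'a chain \<Rightarrow> int" where
  "evaluate u c = (\<Sum>s\<in>Poly_Mapping.keys c. Poly_Mapping.lookup c s * u (s e0))"

lemma evaluate_superset:
  assumes "finite A" "Poly_Mapping.keys c \<subseteq> A"
  shows "evaluate u c = (\<Sum>s\<in>A. Poly_Mapping.lookup c s * u (s e0))"
  unfolding evaluate_def by (rule sum.mono_neutral_left) (use assms in \<open>auto simp: in_keys_iff\<close>)

lemma evaluate_add: "evaluate u (c + d) = evaluate u c + evaluate u d"
proof -
  let ?A = "Poly_Mapping.keys c \<union> Poly_Mapping.keys d"
  have "evaluate u x = (\<Sum>s\<in>?A. Poly_Mapping.lookup x s * u (s e0))" if "x \<in> {c, d, c + d}" for x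
    by (rule evaluate_superset) (use that keys_add[of c d] in auto)
  then show ?thesis by (simp add: lookup_add distrib_right sum.distrib)
qed

lemma evaluate_0 [simp]: "evaluate u 0 = 0"
  by (simp add: evaluate_def)

lemma evaluate_diff: "evaluate u (c - d) = evaluate u c - evaluate u d"
  using evaluate_add[of u "c - d" d] by simp

lemma evaluate_of [simp]: "evaluate u (frag_of s) = u (s e0)"
  by (simp add: evaluate_def)

lemma edge_path:
  assumes "singular_simplex 1 X \<sigma>"
  defines "g \<equiv> \<lambda>t. \<sigma> (\<lambda>j. if j = 0 then 1 - t else if j = 1 then t else 0)"
  shows "pathin X g" "singular_face 1 0 \<sigma> e0 = g 1" "singular_face 1 1 \<sigma> e0 = g 0"
proof -
  let ?i = "\<lambda>t::real. (\<lambda>j::nat. if j = 0 then 1 - t else if j = 1 then t else 0)"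
  have "continuous_map (top_of_set {0..1}) (subtopology (powertop_real UNIV) (standard_simplex 1)) ?i"
    unfolding continuous_map_in_subtopology
  proof
    show "continuous_map (top_of_set {0..1}) (powertop_real UNIV) ?i"
      unfolding continuous_map_componentwise_UNIV
    proof
      fix k :: nat
      consider "k = 0" | "k = 1" | "k \<noteq> 0" "k \<noteq> 1" by blast
      then show "continuous_map (top_of_set {0..1}) euclideanreal (\<lambda>t. ?i t k)"
        by cases (auto intro!: continuous_intros)
    qed
    show "?i \<in> topspace (top_of_set {0..1}) \<rightarrow> standard_simplex 1"
      by (auto simp: standard_simplex_def)
  qed
  then have "continuous_map (top_of_set {0..1}) X (\<sigma> \<circ> ?i)"
    using assms(1) unfolding singular_simplex_def by (intro continuous_map_compose) auto
  then show "pathin X g" by (simp add: pathin_def g_def o_def)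
  have "simplical_face 0 e0 = ?i 1" "simplical_face 1 e0 = ?i 0"
    by (auto simp: simplical_face_def fun_eq_iff)
  then show "singular_face 1 0 \<sigma> e0 = g 1" "singular_face 1 1 \<sigma> e0 = g 0"
    using e0_in unfolding g_def singular_face_def by simp_all
qed

lemma evaluate_boundary:
  assumes u: "path_constant X u" and c: "singular_chain 1 X c"
  shows "evaluate u (chain_boundary 1 c) = 0"
proof -
  have "Poly_Mapping.keys c \<subseteq> singular_simplex_set 1 X" using c by (simp add: singular_chain_def)
  then show ?thesis
  proof (induction c rule: frag_induction)
    case zero then show ?case by simp
  next
    case (one \<sigma>)
    then have \<sigma>: "singular_simplex 1 X \<sigma>" by simp
    have "evaluate u (chain_boundary 1 (frag_of \<sigma>)) = u (singular_face 1 0 \<sigma> e0) - u (singular_face 1 1 \<sigma> e0)"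
      by (simp add: chain_boundary_of evaluate_diff)
    also have "\<dots> = 0"
      using path_constantD[OF u edge_path(1)[OF \<sigma>]] unfolding edge_path(2,3)[OF \<sigma>] by simp
    finally show ?case .
  next
    case (diff a b)
    then show ?case by (simp add: chain_boundary_diff evaluate_diff)
  qed
qed

definition cocycle_value :: "('a chain \<Rightarrow> int) \<Rightarrow> 'a \<Rightarrow> int" where
  "cocycle_value \<phi> a = \<phi> (frag_of (point_simplex a))"

text \<open>
  A cocycle is determined by its values on points; the two definitions pass back and forth
  between cocycles and functions which are constant along paths.
\<close>

definition cocycle_of :: "'a topology \<Rightarrow> ('a \<Rightarrow> int) \<Rightarrow> 'a chain \<Rightarrow> int" where
  "cocycle_of X u = restrict (evaluate u) (singular_chain_set 0 X)"

lemma in_cohomology0_iff: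
  "\<phi> \<in> carrier (cohomology0 X) \<longleftrightarrow> \<phi> \<in> extensional (singular_chain_set 0 X) \<and>
     (\<forall>c d. singular_chain 0 X c \<longrightarrow> singular_chain 0 X d \<longrightarrow> \<phi> (c + d) = \<phi> c + \<phi> d) \<and>
     (\<forall>c. singular_chain 1 X c \<longrightarrow> \<phi> (chain_boundary 1 c) = 0)"
proof -
  have "coboundary 0 X \<phi> = \<one>\<^bsub>cochain_group 1 X\<^esub> \<longleftrightarrow> (\<forall>c. singular_chain 1 X c \<longrightarrow> \<phi> (chain_boundary 1 c) = 0)"
    by (auto simp: coboundary_def cochain_group_def restrict_def fun_eq_iff)
  then show ?thesis
    by (auto simp: cohomology0_def cochain_group_def kernel_def hom_def integer_group_def)
qed

lemma mult_cohomology0: "\<phi> \<otimes>\<^bsub>cohomology0 X\<^esub> \<psi> = (\<lambda>c\<in>singular_chain_set 0 X. \<phi> c + \<psi> c)"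
  by (simp add: cohomology0_def cochain_group_def)

lemma one_cohomology0: "\<one>\<^bsub>cohomology0 X\<^esub> = (\<lambda>c\<in>singular_chain_set 0 X. 0)"
  by (simp add: cohomology0_def cochain_group_def)

lemma cocycle_path_constant:
  assumes "\<phi> \<in> carrier (cohomology0 X)" shows "path_constant X (cocycle_value \<phi>)"
  unfolding path_constant_def
proof (intro allI impI)
  fix g assume g: "pathin X g"
  let ?a = "frag_of (point_simplex (g 0))" and ?b = "frag_of (point_simplex (g 1))"
  have ab: "singular_chain 0 X ?a" "singular_chain 0 X ?b"
    using path_start_in_topspace[OF g] path_finish_in_topspace[OF g] by (simp_all add: singular_chain_of singular_point_simplex)
  obtain c where c: "singular_chain 1 X c" "chain_boundary 1 c = ?a - ?b" using path_boundary[OF g] by blast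
  have "\<phi> ((?a - ?b) + ?b) = \<phi> (?a - ?b) + \<phi> ?b"
    using assms ab singular_chain_diff[OF ab] unfolding in_cohomology0_iff by blast
  moreover have "\<phi> (?a - ?b) = 0" using assms c unfolding in_cohomology0_iff by metis
  ultimately show "cocycle_value \<phi> (g 0) = cocycle_value \<phi> (g 1)" by (simp add: cocycle_value_def)
qed

lemma cocycle_of_carrier:
  assumes "path_constant X u" shows "cocycle_of X u \<in> carrier (cohomology0 X)"
  unfolding in_cohomology0_iff
proof (intro conjI allI impI)
  fix c assume c: "singular_chain 1 X c"
  then have "singular_chain 0 X (chain_boundary 1 c)" using singular_chain_boundary[of 1 X c] by simp
  then show "cocycle_of X u (chain_boundary 1 c) = 0"
    using evaluate_boundary[OF assms c] by (simp add: cocycle_of_def)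
qed (auto simp: cocycle_of_def evaluate_add singular_chain_add)

lemma cocycle_value_of: "a \<in> topspace X \<Longrightarrow> cocycle_value (cocycle_of X u) a = u a"
  by (simp add: cocycle_value_def cocycle_of_def singular_chain_of singular_point_simplex)

lemma cocycle_of_value:
  assumes \<phi>: "\<phi> \<in> carrier (cohomology0 X)" and u: "\<And>a. a \<in> topspace X \<Longrightarrow> cocycle_value \<phi> a = u a"
  shows "\<phi> = cocycle_of X u"
proof
  fix c
  have add: "\<phi> (c + d) = \<phi> c + \<phi> d" if "singular_chain 0 X c" "singular_chain 0 X d" for c d
    using \<phi> that unfolding in_cohomology0_iff by blast
  show "\<phi> c = cocycle_of X u c"
  proof (cases "singular_chain 0 X c")
    case True
    then have "Poly_Mapping.keys c \<subseteq> singular_simplex_set 0 X" by (simp add: singular_chain_def)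
    then have "singular_chain 0 X c \<and> \<phi> c = evaluate u c"
    proof (induction c rule: frag_induction)
      case zero
      show ?case using add[of 0 0] by simp
    next
      case (one \<sigma>)
      then show ?case
        using singular_simplex_0_eq[of X \<sigma>] u[of "\<sigma> e0"] by (simp add: singular_chain_of cocycle_value_def)
    next
      case (diff a b)
      then show ?case using add[of "a - b" b] by (simp add: singular_chain_diff evaluate_diff)
    qed
    then show ?thesis using True by (simp add: cocycle_of_def)
  next
    case False
    then show ?thesis using \<phi> by (simp add: in_cohomology0_iff extensional_def cocycle_of_def)
  qed
qed

lemma cocycle_eqI:
  assumes "\<phi> \<in> carrier (cohomology0 X)" "\<psi> \<in> carrier (cohomology0 X)"
    and "\<And>a. a \<in> topspace X \<Longrightarrow> cocycle_value \<phi> a = cocycle_value \<psi> a"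
  shows "\<phi> = \<psi>"
  using cocycle_of_value[OF assms(1), of "cocycle_value \<psi>"] cocycle_of_value[OF assms(2), of "cocycle_value \<psi>"] assms(3) by simp

lemma cocycle_value_mult: "a \<in> topspace X \<Longrightarrow> cocycle_value (\<phi> \<otimes>\<^bsub>cohomology0 X\<^esub> \<psi>) a = cocycle_value \<phi> a + cocycle_value \<psi> a"
  by (simp add: cocycle_value_def mult_cohomology0 singular_chain_of singular_point_simplex)

lemma comm_group_cohomology0: "comm_group (cohomology0 X)"
proof -
  let ?C = "carrier (cohomology0 X)" and ?S = "singular_chain_set 0 X"
  have bd: "singular_chain 0 X (chain_boundary (Suc 0) c)" if "singular_chain (Suc 0) X c" for c
    using singular_chain_boundary[OF that] by simp
  have closed: "\<phi> \<otimes>\<^bsub>cohomology0 X\<^esub> \<psi> \<in> ?C" if "\<phi> \<in> ?C" "\<psi> \<in> ?C" for \<phi> \<psi>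
    using that unfolding in_cohomology0_iff mult_cohomology0 by (auto simp: singular_chain_add bd)
  have one: "\<one>\<^bsub>cohomology0 X\<^esub> \<in> ?C" unfolding in_cohomology0_iff one_cohomology0 by (auto simp: singular_chain_add bd)
  show ?thesis
  proof (rule comm_groupI)
    fix \<phi> assume \<phi>: "\<phi> \<in> ?C"
    show "\<one>\<^bsub>cohomology0 X\<^esub> \<otimes>\<^bsub>cohomology0 X\<^esub> \<phi> = \<phi>"
      using \<phi> unfolding in_cohomology0_iff mult_cohomology0 one_cohomology0 by (auto simp: restrict_def extensional_def)
    have "(\<lambda>c\<in>?S. - \<phi> c) \<in> ?C" using \<phi> unfolding in_cohomology0_iff by (auto simp: singular_chain_add bd)
    moreover have "(\<lambda>c\<in>?S. - \<phi> c) \<otimes>\<^bsub>cohomology0 X\<^esub> \<phi> = \<one>\<^bsub>cohomology0 X\<^esub>"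
      unfolding mult_cohomology0 one_cohomology0 by (auto simp: restrict_def)
    ultimately show "\<exists>\<psi>\<in>?C. \<psi> \<otimes>\<^bsub>cohomology0 X\<^esub> \<phi> = \<one>\<^bsub>cohomology0 X\<^esub>" by blast
  qed (use closed one in \<open>auto simp: mult_cohomology0 restrict_def\<close>)
qed

section \<open>Paths in sublevel sets\<close>

definition lattice_point :: "('v \<Rightarrow> int) \<Rightarrow> 'v \<Rightarrow> real" where
  "lattice_point l = (\<lambda>v. of_int (l v))"

definition floor_point :: "('v \<Rightarrow> real) \<Rightarrow> 'v \<Rightarrow> int" where
  "floor_point x = (\<lambda>v. \<lfloor>x v\<rfloor>)"

definition sublevel_points :: "'v set \<Rightarrow> (('v \<Rightarrow> int) \<Rightarrow> int) \<Rightarrow> int \<Rightarrow> ('v \<Rightarrow> int) set" where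
  "sublevel_points V w n = {l \<in> lattice V. w l \<le> n}"

definition translate :: "('v \<Rightarrow> int) \<Rightarrow> 'v set \<Rightarrow> 'v \<Rightarrow> int" where
  "translate l J = (\<lambda>v. l v + (if v \<in> J then 1 else 0))"

definition lattice_step :: "'v set \<Rightarrow> (('v \<Rightarrow> int) \<Rightarrow> int) \<Rightarrow> int \<Rightarrow> ('v \<Rightarrow> int) \<Rightarrow> ('v \<Rightarrow> int) \<Rightarrow> bool" where
  "lattice_step V w n l l' \<longleftrightarrow> l \<in> sublevel_points V w n \<and> l' \<in> sublevel_points V w n \<and>
     (\<exists>v\<in>V. l' = translate l {v} \<or> l = translate l' {v})"

lemma lattice_step_sym: "lattice_step V w n l l' \<Longrightarrow> lattice_step V w n l' l"
  unfolding lattice_step_def by blast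

lemma floor_lattice_point [simp]: "floor_point (lattice_point l) = l"
  by (simp add: floor_point_def lattice_point_def)

lemma topspace_sublevel:
  "topspace (sublevel V w n) = \<Union>{cube l I |l I. l \<in> lattice V \<and> I \<subseteq> V \<and> cube_weight w l I \<le> n}"
  by (simp add: sublevel_def)

lemma cube_weight_le_iff:
  assumes "finite I" shows "cube_weight w l I \<le> n \<longleftrightarrow> (\<forall>J\<subseteq>I. w (translate l J) \<le> n)"
  unfolding cube_weight_def translate_def using assms by (subst Max_le_iff) auto

lemma sublevelE:
  assumes "finite V" "x \<in> topspace (sublevel V w n)"
  obtains l I where "l \<in> lattice V" "I \<subseteq> V" "\<forall>J\<subseteq>I. w (translate l J) \<le> n" "x \<in> cube l I"
proof -
  obtain l I where lI: "l \<in> lattice V" "I \<subseteq> V" "cube_weight w l I \<le> n" "x \<in> cube l I"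
    using assms(2) unfolding topspace_sublevel by blast
  then show ?thesis using that cube_weight_le_iff[of I w l n] finite_subset[OF _ assms(1)] by metis
qed

lemma sublevelI:
  assumes "finite V" "l \<in> lattice V" "I \<subseteq> V" "\<forall>J\<subseteq>I. w (translate l J) \<le> n" "x \<in> cube l I"
  shows "x \<in> topspace (sublevel V w n)"
proof -
  have "cube_weight w l I \<le> n" using cube_weight_le_iff[of I w l n] finite_subset[OF assms(3,1)] assms(4) by blast
  then show ?thesis using assms unfolding topspace_sublevel by blast
qed

lemma translate_lattice: "l \<in> lattice V \<Longrightarrow> J \<subseteq> V \<Longrightarrow> translate l J \<in> lattice V"
  by (auto simp: lattice_def translate_def)

text \<open>
  The smallest cube which contains \<open>x\<close> is spanned by the non-integral coordinates of \<open>x\<close>.  It is a face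
  of any cube through \<open>x\<close>, in particular of one which lies in the sublevel set.
\<close>

lemma minimal_cube:
  assumes V: "finite V" and x: "x \<in> topspace (sublevel V w n)" and J: "\<And>v. v \<in> J \<Longrightarrow> x v \<noteq> of_int \<lfloor>x v\<rfloor>"
  shows "translate (floor_point x) J \<in> sublevel_points V w n" and "J \<subseteq> V"
proof -
  obtain l I where lI: "l \<in> lattice V" "I \<subseteq> V" "\<forall>J\<subseteq>I. w (translate l J) \<le> n" "x \<in> cube l I"
    using sublevelE[OF V x] by metis
  define J0 where "J0 = {v\<in>I. x v = of_int (l v) + 1}"
  have fl: "\<lfloor>x v\<rfloor> = l v + (if v \<in> J0 then 1 else 0)" for v
  proof (cases "v \<in> I")
    case True
    then have "of_int (l v) \<le> x v" "x v \<le> of_int (l v) + 1" using lI(4) by (auto simp: cube_def)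
    then show ?thesis using True by (cases "x v = of_int (l v) + 1") (auto simp: J0_def floor_eq_iff)
  next
    case False
    then show ?thesis using lI(4) by (auto simp: cube_def J0_def)
  qed
  have JI: "v \<in> I \<and> v \<notin> J0" if "v \<in> J" for v
    using J[OF that] fl[of v] lI(4) by (cases "v \<in> I") (auto simp: cube_def J0_def)
  then show "J \<subseteq> V" using lI by blast
  have eq: "translate (floor_point x) J = translate l (J0 \<union> J)"
    using JI by (auto simp: translate_def floor_point_def fl fun_eq_iff)
  have sub: "J0 \<union> J \<subseteq> I" using JI by (auto simp: J0_def)
  show "translate (floor_point x) J \<in> sublevel_points V w n"
    unfolding eq sublevel_points_def using lI(3) sub translate_lattice[OF lI(1), of "J0 \<union> J"] lI(2) by blast
qed

lemma translate_empty [simp]: "translate l {} = l"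
  by (simp add: translate_def)

lemma floor_point_sublevel:
  "finite V \<Longrightarrow> x \<in> topspace (sublevel V w n) \<Longrightarrow> floor_point x \<in> sublevel_points V w n"
  using minimal_cube(1)[of V x w n "{}"] by simp

lemma minimal_cube_constant:
  assumes V: "finite V" and x: "x \<in> topspace (sublevel V w n)" and J: "\<And>v. v \<in> J \<Longrightarrow> x v \<noteq> of_int \<lfloor>x v\<rfloor>"
    and f: "\<And>l l'. lattice_step V w n l l' \<Longrightarrow> f l = f l'"
  shows "f (translate (floor_point x) J) = f (floor_point x)"
proof -
  have "J \<subseteq> V" using minimal_cube(2)[OF V x J] .
  then have "finite J" using V finite_subset by blast
  then show ?thesis using J \<open>J \<subseteq> V\<close>
  proof (induction J rule: finite_induct)
    case (insert v J)
    have eq: "translate (floor_point x) (insert v J) = translate (translate (floor_point x) J) {v}"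
      using insert(2) by (auto simp: translate_def)
    have "lattice_step V w n (translate (floor_point x) J) (translate (floor_point x) (insert v J))"
      unfolding lattice_step_def using minimal_cube(1)[OF V x, of J] minimal_cube(1)[OF V x, of "insert v J"] insert.prems eq by blast
    then show ?case using insert f by force
  qed simp
qed

text \<open>
  The function is locally constant on the sublevel set: if \<open>y\<close> is close to \<open>x0\<close>, then rounding \<open>x0\<close>
  down gives a vertex of the smallest cube which contains \<open>y\<close>, and the vertices of this cube are
  joined by lattice steps.
\<close>

lemma path_constant_floor:
  assumes V: "finite V" and f: "\<And>l l'. lattice_step V w n l l' \<Longrightarrow> f l = f l'"
  shows "path_constant (sublevel V w n) (\<lambda>x. f (floor_point x))"
  unfolding path_constant_def
proof (intro allI impI)
  fix g assume g: "pathin (sublevel V w n) g"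
  let ?S = "topspace (sublevel V w n)"
  have gS: "g t \<in> ?S" if "t \<in> {0..1}" for t using path_image_subset_topspace[OF g] that by auto
  have zero: "x v = 0" if "x \<in> ?S" "v \<notin> V" for x v
  proof -
    obtain l I where "l \<in> lattice V" "I \<subseteq> V" "x \<in> cube l I" using sublevelE[OF V \<open>x \<in> ?S\<close>] by metis
    then show ?thesis using that(2) by (auto simp: cube_def lattice_def)
  qed
  have cont: "continuous_on {0..1} (\<lambda>t. g t v)" for v
    using g unfolding pathin_def sublevel_def continuous_map_in_subtopology continuous_map_componentwise_UNIV by simp
  have "(\<lambda>t. f (floor_point (g t))) constant_on {0..1}"
  proof (rule locally_constant_imp_constant)
    show "connected {0..1::real}" by simp
    fix t0 :: real assume t0: "t0 \<in> {0..1}"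
    define x0 where "x0 = g t0"
    \<comment> \<open>The distance from \<open>x0 v\<close> to the nearest integer different from \<open>x0 v\<close>.\<close>
    define \<delta> where "\<delta> v = (if x0 v = of_int \<lfloor>x0 v\<rfloor> then 1 else min (x0 v - of_int \<lfloor>x0 v\<rfloor>) (of_int \<lfloor>x0 v\<rfloor> + 1 - x0 v))" for v
    have \<delta>: "\<delta> v > 0" for v
    proof -
      have "of_int \<lfloor>x0 v\<rfloor> \<le> x0 v" "x0 v < of_int \<lfloor>x0 v\<rfloor> + 1" by linarith+
      then have "0 < x0 v - of_int \<lfloor>x0 v\<rfloor>" if "x0 v \<noteq> of_int \<lfloor>x0 v\<rfloor>" using that by linarith
      then show ?thesis using \<open>x0 v < of_int \<lfloor>x0 v\<rfloor> + 1\<close> by (auto simp: \<delta>_def)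
    qed
    define T where "T = {t \<in> {0..1}. \<forall>v\<in>V. g t v \<in> ball (x0 v) (\<delta> v)}"
    have op: "openin (top_of_set {0..1}) {t \<in> {0..1}. g t v \<in> ball (x0 v) (\<delta> v)}" for v
    proof -
      have "{t \<in> {0..1}. g t v \<in> ball (x0 v) (\<delta> v)} = {0..1} \<inter> (\<lambda>t. g t v) -` ball (x0 v) (\<delta> v)" by auto
      then show ?thesis using continuous_openin_preimage_gen[OF cont open_ball] by simp
    qed
    have "openin (top_of_set {0..1}) (\<Inter>v\<in>V. {t \<in> {0..1}. g t v \<in> ball (x0 v) (\<delta> v)})" if "V \<noteq> {}"
      using V that op by (intro openin_Inter) auto
    moreover have "T = (if V = {} then {0..1} else (\<Inter>v\<in>V. {t \<in> {0..1}. g t v \<in> ball (x0 v) (\<delta> v)}))"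
      by (auto simp: T_def)
    ultimately have "openin (top_of_set {0..1}) T" by auto
    moreover have "t0 \<in> T" using t0 \<delta> by (auto simp: T_def x0_def)
    moreover have "f (floor_point (g t)) = f (floor_point (g t0))" if "t \<in> T" for t
    proof -
      define y where "y = g t"
      have y: "y \<in> ?S" using gS that by (simp add: T_def y_def)
      have x0S: "x0 \<in> ?S" using gS[OF t0] by (simp add: x0_def)
      have near: "\<bar>y v - x0 v\<bar> < \<delta> v" if "v \<in> V" for v
        using \<open>t \<in> T\<close> that by (auto simp: T_def y_def dist_real_def abs_minus_commute)
      define J where "J = {v. \<lfloor>x0 v\<rfloor> = \<lfloor>y v\<rfloor> + 1}"
      have fl: "\<lfloor>x0 v\<rfloor> = \<lfloor>y v\<rfloor> + (if v \<in> J then 1 else 0) \<and> (v \<in> J \<longrightarrow> y v \<noteq> of_int \<lfloor>y v\<rfloor>)" for v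
      proof (cases "v \<in> V")
        case False
        then show ?thesis using zero[OF y] zero[OF x0S] by (simp add: J_def)
      next
        case True
        note n = near[OF True]
        show ?thesis
        proof (cases "x0 v = of_int \<lfloor>x0 v\<rfloor>")
          case True
          then have "\<bar>y v - of_int \<lfloor>x0 v\<rfloor>\<bar> < 1" using n by (simp add: \<delta>_def)
          then have "\<lfloor>y v\<rfloor> = \<lfloor>x0 v\<rfloor> \<or> (\<lfloor>y v\<rfloor> + 1 = \<lfloor>x0 v\<rfloor> \<and> y v \<noteq> of_int \<lfloor>y v\<rfloor>)"
            by linarith
          then show ?thesis by (auto simp: J_def)
        next
          case False
          then have "of_int \<lfloor>x0 v\<rfloor> < y v" "y v < of_int \<lfloor>x0 v\<rfloor> + 1" using n by (auto simp: \<delta>_def)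
          then have "\<lfloor>y v\<rfloor> = \<lfloor>x0 v\<rfloor>" by linarith
          then show ?thesis by (simp add: J_def)
        qed
      qed
      have "floor_point x0 = translate (floor_point y) J"
        using fl by (auto simp: floor_point_def translate_def)
      then have "f (floor_point x0) = f (floor_point y)"
        using minimal_cube_constant[OF V y, of J f] fl f by auto
      then show ?thesis by (simp add: x0_def y_def)
    qed
    ultimately show "\<exists>T. openin (top_of_set {0..1}) T \<and> t0 \<in> T \<and> (\<forall>x\<in>T. f (floor_point (g x)) = f (floor_point (g t0)))"
      by blast
  qed
  then show "f (floor_point (g 0)) = f (floor_point (g 1))"
    unfolding constant_on_def by (metis atLeastAtMost_iff order.refl zero_le_one)
qed

lemma segment_path:
  assumes V: "finite V" and l: "l \<in> lattice V" "I \<subseteq> V" "\<forall>J\<subseteq>I. w (translate l J) \<le> n"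
    and xy: "x \<in> cube l I" "y \<in> cube l I"
  shows "pathin (sublevel V w n) (\<lambda>t v. (1 - t) * x v + t * y v)"
  unfolding pathin_def sublevel_def continuous_map_in_subtopology
proof
  show "continuous_map (top_of_set {0..1}) (powertop_real UNIV) (\<lambda>t v. (1 - t) * x v + t * y v)"
    unfolding continuous_map_componentwise_UNIV by (auto intro!: continuous_intros)
  show "(\<lambda>t v. (1 - t) * x v + t * y v) \<in> topspace (top_of_set {0..1}) \<rightarrow> 
    \<Union> {cube l I |l I. l \<in> lattice V \<and> I \<subseteq> V \<and> cube_weight w l I \<le> n}"
  proof (rule funcsetI)
    fix t :: real assume "t \<in> topspace (top_of_set {0..1})"
    then have t: "0 \<le> t" "t \<le> 1" by auto
    have "(\<lambda>v. (1 - t) * x v + t * y v) \<in> cube l I"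
    proof -
      have "of_int (l v) \<le> (1 - t) * x v + t * y v \<and> (1 - t) * x v + t * y v \<le> of_int (l v) + 1" if "v \<in> I" for v
        using xy that t convex_bound_le[of "x v" "of_int (l v) + 1" "y v" "1 - t" t]
          convex_bound_le[of "- x v" "- of_int (l v)" "- y v" "1 - t" t] by (auto simp: cube_def)
      moreover have "(1 - t) * x v + t * y v = of_int (l v)" if "v \<notin> I" for v
        using xy that by (simp add: cube_def algebra_simps)
      ultimately show ?thesis by (simp add: cube_def)
    qed
    from sublevelI[OF V l this]
    show "(\<lambda>v. (1 - t) * x v + t * y v) \<in> \<Union> {cube l I |l I. l \<in> lattice V \<and> I \<subseteq> V \<and> cube_weight w l I \<le> n}"
      unfolding topspace_sublevel .
  qed
qed

lemma path_constant_cube: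
  assumes V: "finite V" and l: "l \<in> lattice V" "I \<subseteq> V" "\<forall>J\<subseteq>I. w (translate l J) \<le> n"
    and xy: "x \<in> cube l I" "y \<in> cube l I" and u: "path_constant (sublevel V w n) u"
  shows "u x = u y"
  using path_constantD[OF u segment_path[OF assms(1-6)]] by simp

lemma lattice_point_in_sublevel:
  assumes "finite V" "l \<in> sublevel_points V w n" shows "lattice_point l \<in> topspace (sublevel V w n)"
  by (rule sublevelI[of V l "{}"]) (use assms in \<open>auto simp: sublevel_points_def cube_def lattice_point_def\<close>)

lemma path_constant_step:
  assumes V: "finite V" and u: "path_constant (sublevel V w n) u" and s: "lattice_step V w n l l'"
  shows "u (lattice_point l) = u (lattice_point l')"
proof -
  have *: "u (lattice_point l) = u (lattice_point (translate l {v}))"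
    if "l \<in> sublevel_points V w n" "translate l {v} \<in> sublevel_points V w n" "v \<in> V" for l v
  proof (rule path_constant_cube[OF V, of l "{v}" w n])
    show "\<forall>J\<subseteq>{v}. w (translate l J) \<le> n"
      using \<open>l \<in> _\<close> \<open>translate l {v} \<in> _\<close> by (auto simp: sublevel_points_def dest!: subset_singletonD)
  qed (use that u in \<open>auto simp: sublevel_points_def cube_def lattice_point_def translate_def\<close>)
  show ?thesis using s *[of l] *[of l'] unfolding lattice_step_def by force
qed

text \<open>
  A point and its componentwise floor lie in a common cube, which is convex.
\<close>

lemma path_constant_floor_eq:
  assumes V: "finite V" and u: "path_constant (sublevel V w n) u" and x: "x \<in> topspace (sublevel V w n)"
  shows "u x = u (lattice_point (floor_point x))"
proof -
  obtain l I where lI: "l \<in> lattice V" "I \<subseteq> V" "\<forall>J\<subseteq>I. w (translate l J) \<le> n" "x \<in> cube l I"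
    using sublevelE[OF V x] by metis
  have "lattice_point (floor_point x) \<in> cube l I"
    using lI(4) by (auto simp: cube_def lattice_point_def floor_point_def le_floor_iff intro: order_trans[OF of_int_floor_le])
  then show ?thesis using path_constant_cube[OF V lI(1-4) _ u] by blast
qed

section \<open>Ranks and quotients of isomorphic groups\<close>

lemma hom_finprod_comm:
  assumes G: "comm_group G" and H: "comm_group H" and h: "h \<in> hom G H" and "finite B" "f \<in> B \<rightarrow> carrier G"
  shows "h (finprod G f B) = finprod H (\<lambda>x. h (f x)) B"
proof -
  interpret G: comm_group G by fact
  interpret H: comm_group H by fact
  interpret group_hom G H h by unfold_locales (rule h)
  show ?thesis using assms(4,5)
  proof (induction B rule: finite_induct)
    case (insert x B)
    have "(\<lambda>x. h (f x)) \<in> B \<rightarrow> carrier H" using insert by (auto simp: Pi_iff)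
    then show ?case using insert by (simp add: Pi_iff)
  qed simp
qed

lemma int_independent_image:
  assumes G: "comm_group G" and H: "comm_group H" and h: "h \<in> iso G H" and B: "int_independent G B"
  shows "int_independent H (h ` B) \<and> card (h ` B) = card B"
proof -
  interpret G: comm_group G by fact
  interpret H: comm_group H by fact
  have hom: "h \<in> hom G H" and inj: "inj_on h (carrier G)" using h by (auto simp: iso_def bij_betw_def)
  interpret group_hom G H h by unfold_locales (rule hom)
  have BG: "finite B" "B \<subseteq> carrier G" using B by (auto simp: int_independent_def)
  have injB: "inj_on h B" using inj BG inj_on_subset by blast
  have "\<forall>y\<in>h ` B. c y = 0" if c: "finprod H (\<lambda>y. y [^]\<^bsub>H\<^esub> c y) (h ` B) = \<one>\<^bsub>H\<^esub>" for c :: "_ \<Rightarrow> int"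
  proof -
    have "finprod H (\<lambda>y. y [^]\<^bsub>H\<^esub> c y) (h ` B) = finprod H (\<lambda>x. h x [^]\<^bsub>H\<^esub> c (h x)) B"
      by (rule H.finprod_reindex) (use BG injB in auto)
    also have "\<dots> = finprod H (\<lambda>x. h (x [^]\<^bsub>G\<^esub> c (h x))) B"
      using BG by (intro H.finprod_cong') (auto simp: hom_int_pow)
    also have "\<dots> = h (finprod G (\<lambda>x. x [^]\<^bsub>G\<^esub> c (h x)) B)"
      using BG by (intro hom_finprod_comm[symmetric] G H hom) auto
    finally have "h (finprod G (\<lambda>x. x [^]\<^bsub>G\<^esub> c (h x)) B) = h \<one>\<^bsub>G\<^esub>" using c by simp
    moreover have "finprod G (\<lambda>x. x [^]\<^bsub>G\<^esub> c (h x)) B \<in> carrier G" using BG by (intro G.finprod_closed) auto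
    ultimately have "finprod G (\<lambda>x. x [^]\<^bsub>G\<^esub> c (h x)) B = \<one>\<^bsub>G\<^esub>"
      using inj by (auto simp: inj_on_def)
    then show ?thesis using B unfolding int_independent_def by (auto dest!: spec[of _ "\<lambda>x. c (h x)"])
  qed
  moreover have "h ` B \<subseteq> carrier H" using BG by auto
  ultimately show ?thesis using BG injB by (simp add: int_independent_def card_image)
qed

lemma abelian_rank_iso:
  assumes G: "comm_group G" and H: "comm_group H" and iso: "G \<cong> H"
  shows "abelian_rank G = abelian_rank H"
proof -
  have *: "{card B |B. int_independent G B} \<subseteq> {card B |B. int_independent H B}"
    if "comm_group G" "comm_group H" "G \<cong> H" for G :: "('x, 'y) monoid_scheme" and H :: "('z, 'w) monoid_scheme"
  proof -
    obtain h where "h \<in> iso G H" using \<open>G \<cong> H\<close> by (auto simp: is_iso_def)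
    then have "int_independent H (h ` B) \<and> card B = card (h ` B)" if "int_independent G B" for B
      using int_independent_image[of G H h B] that \<open>comm_group G\<close> \<open>comm_group H\<close> by simp
    then show ?thesis by blast
  qed
  have "H \<cong> G" using iso G by (simp add: comm_group_def group.iso_sym)
  then show ?thesis unfolding abelian_rank_def using *[OF G H iso] *[OF H G] by simp
qed

text \<open>
  The isomorphism followed by the projection is surjective, and its kernel is \<open>N\<close>.
\<close>

lemma FactGroup_iso_FactGroup:
  assumes G: "comm_group G" and G': "comm_group G'" and k: "k \<in> iso G G'"
    and N: "N \<subseteq> carrier G" "subgroup N' G'" "k ` N = N'"
  shows "G Mod N \<cong> G' Mod N'"
proof -
  interpret G: comm_group G by fact
  interpret G': comm_group G' by fact
  have hom: "k \<in> hom G G'" and inj: "inj_on k (carrier G)" and im: "k ` carrier G = carrier G'"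
    using k by (auto simp: iso_def bij_betw_def)
  interpret N': normal N' G' using G'.subgroup_imp_normal N by blast
  let ?h = "\<lambda>g. N' #>\<^bsub>G'\<^esub> k g"
  have "?h \<in> hom G (G' Mod N')"
    using hom_compose[OF hom N'.r_coset_hom_Mod] by (simp add: o_def)
  then interpret h: group_hom G "G' Mod N'" ?h
    using N'.factorgroup_is_group by (simp add: group_hom_def group_hom_axioms_def G.is_group)
  have ker: "kernel G (G' Mod N') ?h = N"
  proof
    show "N \<subseteq> kernel G (G' Mod N') ?h"
      using N im G'.coset_join2[OF _ N(2)] by (auto simp: kernel_def FactGroup_def)
    show "kernel G (G' Mod N') ?h \<subseteq> N"
    proof
      fix g assume "g \<in> kernel G (G' Mod N') ?h"
      then have g: "g \<in> carrier G" "N' #>\<^bsub>G'\<^esub> k g = N'" by (auto simp: kernel_def FactGroup_def)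
      then have "k g \<in> N'" using im G'.coset_join1[OF _ _ N(2)] by blast
      then obtain x where "x \<in> N" "k g = k x" using N by blast
      then show "g \<in> N" using inj g N by (metis inj_onD subsetD)
    qed
  qed
  have "?h ` carrier G = carrier (G' Mod N')"
    unfolding FactGroup_def RCOSETS_def partial_object.simps im[symmetric] by blast
  from h.FactGroup_iso[OF this] show ?thesis unfolding ker .
qed

lemma comm_group_sum_group:
  assumes "\<And>i. i \<in> I \<Longrightarrow> comm_group (G i)" shows "comm_group (sum_group I G)"
proof (rule group.group_comm_groupI)
  have gr: "\<And>i. i \<in> I \<Longrightarrow> group (G i)" using assms by (simp add: comm_group_def)
  then show "group (sum_group I G)" by simp
  fix x y assume xy: "x \<in> carrier (sum_group I G)" "y \<in> carrier (sum_group I G)"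
  have "x i \<otimes>\<^bsub>G i\<^esub> y i = y i \<otimes>\<^bsub>G i\<^esub> x i" if i: "i \<in> I" for i
  proof -
    have "z i \<in> carrier (G i)" if "z \<in> carrier (sum_group I G)" for z
      using that i carrier_sum_group[of I G, OF gr] by (auto simp: PiE_iff)
    then show ?thesis using comm_monoid.m_comm[OF comm_group.axioms(1)[OF assms[OF i]]] xy by blast
  qed
  then show "x \<otimes>\<^bsub>sum_group I G\<^esub> y = y \<otimes>\<^bsub>sum_group I G\<^esub> x" by (auto simp: restrict_def)
qed

section \<open>Reduction of lattice cohomology to a line\<close>

lemma augmentation_cochains_eq: "augmentation_cochains X = range (\<lambda>k. cocycle_of X (\<lambda>_. k))"
proof -
  have "(\<lambda>c\<in>singular_chain_set 0 X. k * (\<Sum>s\<in>Poly_Mapping.keys c. Poly_Mapping.lookup c s)) = cocycle_of X (\<lambda>_. k)" for k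
    by (auto simp: cocycle_of_def evaluate_def sum_distrib_left mult.commute restrict_def)
  then show ?thesis by (simp add: augmentation_cochains_def)
qed

lemma const_path_constant: "path_constant X (\<lambda>_. k)"
  by (simp add: path_constant_def)

lemma augmentation_subgroup: "subgroup (augmentation_cochains X) (cohomology0 X)"
proof -
  interpret comm_group "cohomology0 X" by (rule comm_group_cohomology0)
  let ?c = "\<lambda>k. cocycle_of X (\<lambda>_. k)"
  have carr: "?c k \<in> carrier (cohomology0 X)" for k by (rule cocycle_of_carrier[OF const_path_constant])
  have mult: "?c k \<otimes>\<^bsub>cohomology0 X\<^esub> ?c l = ?c (k + l)" for k l
    by (rule cocycle_eqI) (auto simp: carr cocycle_value_mult cocycle_value_of)
  have one: "?c 0 = \<one>\<^bsub>cohomology0 X\<^esub>"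
    by (auto simp: one_cohomology0 cocycle_of_def evaluate_def restrict_def)
  have inv: "inv\<^bsub>cohomology0 X\<^esub> ?c k = ?c (- k)" for k
    by (rule inv_equality) (auto simp: mult carr one)
  show ?thesis
    unfolding augmentation_cochains_eq
    by (rule subgroupI) (auto simp: carr mult inv)
qed

text \<open>
  The group \<open>H\<^sup>0\<close> of a graph whose vertices are the integers \<open>x\<close> with \<open>A x \<le> n\<close> and which joins \<open>x\<close> and
  \<open>x + 1\<close> if \<open>E n x\<close> holds.
\<close>

definition line_functions :: "(int \<Rightarrow> int) \<Rightarrow> (int \<Rightarrow> int \<Rightarrow> bool) \<Rightarrow> int \<Rightarrow> (int \<Rightarrow> int) set" where
  "line_functions A E n = {f \<in> extensional {x. A x \<le> n}. \<forall>x. E n x \<longrightarrow> f x = f (x + 1)}"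

text \<open>
  The sublevel sets of \<open>w\<close> have the same connected components as such graphs.  The function \<open>\<xi>\<close>
  projects the lattice to the line, \<open>\<psi>\<close> is a section, and each fibre of \<open>\<xi>\<close> in a
  sublevel set is connected.
\<close>

locale line_reduction =
  fixes V :: "'v set" and w :: "('v \<Rightarrow> int) \<Rightarrow> int" and A :: "int \<Rightarrow> int" and E :: "int \<Rightarrow> int \<Rightarrow> bool"
    and \<xi> :: "('v \<Rightarrow> int) \<Rightarrow> int" and \<psi> :: "int \<Rightarrow> 'v \<Rightarrow> int"
  assumes fin: "finite V"
    and \<xi>: "l \<in> sublevel_points V w n \<Longrightarrow> A (\<xi> l) \<le> n"
    and \<psi>: "A x \<le> n \<Longrightarrow> \<psi> x \<in> sublevel_points V w n"
    and \<xi>\<psi>: "\<xi> (\<psi> x) = x"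
    and slice: "l \<in> sublevel_points V w n \<Longrightarrow> (lattice_step V w n)\<^sup>*\<^sup>* l (\<psi> (\<xi> l))"
    and step: "lattice_step V w n l l' \<Longrightarrow> \<xi> l = \<xi> l' \<or> (\<xi> l' = \<xi> l + 1 \<and> E n (\<xi> l)) \<or> (\<xi> l = \<xi> l' + 1 \<and> E n (\<xi> l'))"
    and edge: "E n x \<Longrightarrow> A x \<le> n \<and> A (x + 1) \<le> n \<and> (lattice_step V w n)\<^sup>*\<^sup>* (\<psi> x) (\<psi> (x + 1))"
begin

abbreviation "S n \<equiv> sublevel V w n"

definition line_values :: "int \<Rightarrow> (('v \<Rightarrow> real) chain \<Rightarrow> int) \<Rightarrow> int \<Rightarrow> int" where
  "line_values n \<phi> = (\<lambda>x\<in>{x. A x \<le> n}. cocycle_value \<phi> (lattice_point (\<psi> x)))"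

lemma path_constant_steps:
  assumes "path_constant (S n) u" "(lattice_step V w n)\<^sup>*\<^sup>* l l'"
  shows "u (lattice_point l) = u (lattice_point l')"
  using assms(2)
proof (induction rule: rtranclp_induct)
  case (step l' l'')
  show ?case using path_constant_step[OF fin assms(1) step.hyps(2)] step.IH by simp
qed simp

lemma \<psi>_top: "A x \<le> n \<Longrightarrow> lattice_point (\<psi> x) \<in> topspace (S n)"
  by (intro lattice_point_in_sublevel fin \<psi>)

lemma cocycle_value_line:
  assumes \<phi>: "\<phi> \<in> carrier (cohomology0 (S n))" and a: "a \<in> topspace (S n)"
  shows "cocycle_value \<phi> a = line_values n \<phi> (\<xi> (floor_point a))"
proof -
  note pc = cocycle_path_constant[OF \<phi>]
  have fl: "floor_point a \<in> sublevel_points V w n" by (rule floor_point_sublevel[OF fin a])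
  have "cocycle_value \<phi> a = cocycle_value \<phi> (lattice_point (floor_point a))"
    by (rule path_constant_floor_eq[OF fin pc a])
  also have "\<dots> = cocycle_value \<phi> (lattice_point (\<psi> (\<xi> (floor_point a))))"
    by (rule path_constant_steps[OF pc slice[OF fl]])
  finally show ?thesis using \<xi>[OF fl] by (simp add: line_values_def)
qed

lemma line_values_bij: "bij_betw (line_values n) (carrier (cohomology0 (S n))) (line_functions A E n)"
  unfolding bij_betw_def
proof
  show "inj_on (line_values n) (carrier (cohomology0 (S n)))"
    by (rule inj_onI, rule cocycle_eqI) (auto simp: cocycle_value_line)
  show "line_values n ` carrier (cohomology0 (S n)) = line_functions A E n"
  proof
    show "line_values n ` carrier (cohomology0 (S n)) \<subseteq> line_functions A E n"
    proof (rule image_subsetI)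
      fix \<phi> assume "\<phi> \<in> carrier (cohomology0 (S n))"
      note pc = cocycle_path_constant[OF this]
      show "line_values n \<phi> \<in> line_functions A E n"
        unfolding line_functions_def using path_constant_steps[OF pc] edge by (auto simp: line_values_def)
    qed
    show "line_functions A E n \<subseteq> line_values n ` carrier (cohomology0 (S n))"
    proof
      fix f assume f: "f \<in> line_functions A E n"
      let ?u = "\<lambda>a. f (\<xi> (floor_point a))"
      have "path_constant (S n) ?u"
      proof (rule path_constant_floor[OF fin, where f = "\<lambda>l. f (\<xi> l)"])
        fix l l' assume "lattice_step V w n l l'"
        from step[OF this] show "f (\<xi> l) = f (\<xi> l')" using f unfolding line_functions_def by force
      qed
      then have "cocycle_of (S n) ?u \<in> carrier (cohomology0 (S n))" by (rule cocycle_of_carrier)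
      moreover have "line_values n (cocycle_of (S n) ?u) = f"
        using f by (auto simp: line_values_def line_functions_def cocycle_value_of \<psi>_top \<xi>\<psi> extensional_def)
      ultimately show "f \<in> line_values n ` carrier (cohomology0 (S n))" by (metis imageI)
    qed
  qed
qed

lemma line_values_mult:
  "line_values n (\<phi> \<otimes>\<^bsub>cohomology0 (S n)\<^esub> \<psi>') = (\<lambda>x\<in>{x. A x \<le> n}. line_values n \<phi> x + line_values n \<psi>' x)"
  by (auto simp: line_values_def cocycle_value_mult \<psi>_top)

lemma line_values_const: "line_values n (cocycle_of (S n) (\<lambda>_. k)) = (\<lambda>x\<in>{x. A x \<le> n}. k)"
  by (auto simp: line_values_def cocycle_value_of \<psi>_top)

lemma sublevel_mono: "singular_chain p (S n) c \<Longrightarrow> singular_chain p (S (n + 1)) c"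
  unfolding sublevel_def
proof (erule singular_chain_mono, rule Union_mono, rule subsetI)
  fix Q assume "Q \<in> {cube l I |l I. l \<in> Defs.lattice V \<and> I \<subseteq> V \<and> cube_weight w l I \<le> n}"
  then obtain l I where "Q = cube l I" "l \<in> Defs.lattice V" "I \<subseteq> V" "cube_weight w l I \<le> n" by blast
  moreover from this have "cube_weight w l I \<le> n + 1" by linarith
  ultimately show "Q \<in> {cube l I |l I. l \<in> Defs.lattice V \<and> I \<subseteq> V \<and> cube_weight w l I \<le> n + 1}" by blast
qed

lemma restrict_carrier:
  assumes "\<phi> \<in> carrier (cohomology0 (S (n + 1)))"
  shows "restrict \<phi> (singular_chain_set 0 (S n)) \<in> carrier (cohomology0 (S n))"
proof -
  have \<phi>: "singular_chain 0 (S (n + 1)) c \<Longrightarrow> singular_chain 0 (S (n + 1)) d \<Longrightarrow> \<phi> (c + d) = \<phi> c + \<phi> d"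
    "singular_chain 1 (S (n + 1)) b \<Longrightarrow> \<phi> (chain_boundary 1 b) = 0" for b c d
    using assms unfolding in_cohomology0_iff by blast+
  show ?thesis
    unfolding in_cohomology0_iff
  proof (intro conjI allI impI)
    fix c d assume cd: "singular_chain 0 (S n) c" "singular_chain 0 (S n) d"
    then show "restrict \<phi> (singular_chain_set 0 (S n)) (c + d)
        = restrict \<phi> (singular_chain_set 0 (S n)) c + restrict \<phi> (singular_chain_set 0 (S n)) d"
      using \<phi>(1)[OF sublevel_mono[OF cd(1)] sublevel_mono[OF cd(2)]] singular_chain_add[OF cd] by simp
  next
    fix b assume b: "singular_chain 1 (S n) b"
    have "singular_chain 0 (S n) (chain_boundary 1 b)" using singular_chain_boundary[OF b] by simp
    then show "restrict \<phi> (singular_chain_set 0 (S n)) (chain_boundary 1 b) = 0"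
      using \<phi>(2)[OF sublevel_mono[OF b]] by simp
  qed simp
qed

lemma line_values_restrict:
  "line_values n (restrict \<phi> (singular_chain_set 0 (S n))) = restrict (line_values (n + 1) \<phi>) {x. A x \<le> n}"
  using \<psi>_top[of _ n] by (auto simp: line_values_def cocycle_value_def singular_chain_of singular_point_simplex restrict_def)

end

text \<open>
  For each \<open>n\<close> both groups \<open>H\<^sup>0\<close> are identified with the functions on the same graph, by taking values
  at the points of the sections.  These identifications commute with the restrictions from level
  \<open>n + 1\<close> to level \<open>n\<close> and take constant functions to constant functions, so that they yield
  an isomorphism of graded modules and also one of the reduced groups.
\<close>

lemma two_line_reductions:
  assumes "line_reduction V w A E \<xi> \<psi>" and "line_reduction V' w' A E \<xi>' \<psi>'"
    and min: "min_weight V w = min_weight V' w'"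
  shows "lattice_cohomology0_isomorphic V w V' w'" and "eu0 V w = eu0 V' w'"
proof -
  interpret P: line_reduction V w A E \<xi> \<psi> by fact
  interpret Q: line_reduction V' w' A E \<xi>' \<psi>' by fact
  define m where "m = min_weight V w"
  let ?C = "\<lambda>n. cohomology0 (sublevel V w n)" and ?D = "\<lambda>n. cohomology0 (sublevel V' w' n)"
  have C: "comm_group (?C n)" and D: "comm_group (?D n)" for n by (rule comm_group_cohomology0)+
  have Cg: "group (?C n)" and Dg: "group (?D n)" for n using C D by (simp_all add: comm_group_def)
  define k where "k n \<phi> = the_inv_into (carrier (?D n)) (Q.line_values n) (P.line_values n \<phi>)" for n \<phi>
  have kbij: "bij_betw (k n) (carrier (?C n)) (carrier (?D n))" for n
  proof -
    have "bij_betw (the_inv_into (carrier (?D n)) (Q.line_values n)) (line_functions A E n) (carrier (?D n))"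
      by (rule bij_betw_the_inv_into[OF Q.line_values_bij])
    from bij_betw_trans[OF P.line_values_bij this] show ?thesis by (simp add: k_def[abs_def] o_def)
  qed
  have kD: "k n \<phi> \<in> carrier (?D n)" if "\<phi> \<in> carrier (?C n)" for n \<phi>
    using kbij[of n] that by (auto simp: bij_betw_def)
  have lv: "Q.line_values n (k n \<phi>) = P.line_values n \<phi>" if "\<phi> \<in> carrier (?C n)" for n \<phi>
  proof -
    have "P.line_values n \<phi> \<in> Q.line_values n ` carrier (?D n)"
      using P.line_values_bij[of n] Q.line_values_bij[of n] that by (auto simp: bij_betw_def)
    moreover have "inj_on (Q.line_values n) (carrier (?D n))"
      using Q.line_values_bij[of n] by (simp add: bij_betw_def)
    ultimately show ?thesis
      using f_the_inv_into_f[of "Q.line_values n" "carrier (?D n)" "P.line_values n \<phi>"] by (simp add: k_def)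
  qed
  have keq: "k n \<phi> = \<psi>" if "\<phi> \<in> carrier (?C n)" "\<psi> \<in> carrier (?D n)" "Q.line_values n \<psi> = P.line_values n \<phi>" for n \<phi> \<psi>
  proof -
    have "inj_on (Q.line_values n) (carrier (?D n))"
      using Q.line_values_bij[of n] by (simp add: bij_betw_def)
    from inj_onD[OF this _ kD[OF that(1)] that(2)] show ?thesis using lv[OF that(1)] that(3) by simp
  qed
  have khom: "k n (\<phi> \<otimes>\<^bsub>?C n\<^esub> \<psi>) = k n \<phi> \<otimes>\<^bsub>?D n\<^esub> k n \<psi>" if "\<phi> \<in> carrier (?C n)" "\<psi> \<in> carrier (?C n)" for n \<phi> \<psi>
  proof (rule keq)
    show "\<phi> \<otimes>\<^bsub>?C n\<^esub> \<psi> \<in> carrier (?C n)" using Cg that by (simp add: group.is_monoid monoid.m_closed)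
    show "k n \<phi> \<otimes>\<^bsub>?D n\<^esub> k n \<psi> \<in> carrier (?D n)" using Dg kD that by (simp add: group.is_monoid monoid.m_closed)
  qed (use that in \<open>simp add: P.line_values_mult Q.line_values_mult lv\<close>)
  have kiso: "k n \<in> iso (?C n) (?D n)" for n
    using kbij khom kD by (auto simp: iso_def hom_def)
  have kone: "k n \<one>\<^bsub>?C n\<^esub> = \<one>\<^bsub>?D n\<^esub>" for n
    using kiso[of n] hom_one[OF _ Cg Dg] by (auto simp: iso_def)
  have kone_iff: "k n \<phi> = \<one>\<^bsub>?D n\<^esub> \<longleftrightarrow> \<phi> = \<one>\<^bsub>?C n\<^esub>" if "\<phi> \<in> carrier (?C n)" for n \<phi>
  proof -
    have "inj_on (k n) (carrier (?C n))" using kbij[of n] by (simp add: bij_betw_def)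
    moreover have "\<one>\<^bsub>?C n\<^esub> \<in> carrier (?C n)" using Cg by (simp add: group.is_monoid monoid.one_closed)
    ultimately show ?thesis using kone[of n] that inj_on_eq_iff by fastforce
  qed
  have krestrict: "k n (restrict \<phi> (singular_chain_set 0 (sublevel V w n)))
      = restrict (k (n + 1) \<phi>) (singular_chain_set 0 (sublevel V' w' n))" if "\<phi> \<in> carrier (?C (n + 1))" for n \<phi>
    by (rule keq) (use that in \<open>simp_all add: P.restrict_carrier Q.restrict_carrier kD P.line_values_restrict Q.line_values_restrict lv\<close>)
  define I where "I = {m..}"
  let ?L = "sum_group I ?C" and ?M = "sum_group I ?D"
  have LM: "lattice_cohomology0 V w = ?L" "lattice_cohomology0 V' w' = ?M"
    by (simp_all add: lattice_cohomology0_def I_def m_def min)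
  have cL: "carrier ?L = {x \<in> \<Pi>\<^sub>E i\<in>I. carrier (?C i). finite {i \<in> I. x i \<noteq> \<one>\<^bsub>?C i\<^esub>}}"
    by (rule carrier_sum_group) (rule Cg)
  have cM: "carrier ?M = {x \<in> \<Pi>\<^sub>E i\<in>I. carrier (?D i). finite {i \<in> I. x i \<noteq> \<one>\<^bsub>?D i\<^esub>}}"
    by (rule carrier_sum_group) (rule Dg)
  define F where "F x = (\<lambda>n\<in>I. k n (x n))" for x
  define F' where "F' y = (\<lambda>n\<in>I. the_inv_into (carrier (?C n)) (k n) (y n))" for y
  have inv: "the_inv_into (carrier (?C n)) (k n) \<psi> \<in> carrier (?C n)" "k n (the_inv_into (carrier (?C n)) (k n) \<psi>) = \<psi>"
    if "\<psi> \<in> carrier (?D n)" for n \<psi>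
    using kbij[of n] that the_inv_into_into[of "k n" "carrier (?C n)" \<psi> "carrier (?C n)"]
      f_the_inv_into_f[of "k n" "carrier (?C n)" \<psi>] by (simp_all add: bij_betw_def)
  have inv': "the_inv_into (carrier (?C n)) (k n) (k n \<phi>) = \<phi>" if "\<phi> \<in> carrier (?C n)" for n \<phi>
    using kbij[of n] that by (auto simp: bij_betw_def intro: the_inv_into_f_f)
  have FM: "F x \<in> carrier ?M" if "x \<in> carrier ?L" for x
  proof -
    have "{i \<in> I. F x i \<noteq> \<one>\<^bsub>?D i\<^esub>} = {i \<in> I. x i \<noteq> \<one>\<^bsub>?C i\<^esub>}"
      using that kone_iff unfolding cL by (auto simp: F_def PiE_iff)
    then show ?thesis using that kD unfolding cL cM by (auto simp: F_def PiE_iff)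
  qed
  have F'L: "F' y \<in> carrier ?L" if "y \<in> carrier ?M" for y
  proof -
    have yi: "y i \<in> carrier (?D i)" if "i \<in> I" for i using \<open>y \<in> carrier ?M\<close> that unfolding cM by (auto simp: PiE_iff)
    have "{i \<in> I. F' y i \<noteq> \<one>\<^bsub>?C i\<^esub>} = {i \<in> I. y i \<noteq> \<one>\<^bsub>?D i\<^esub>}"
    proof (rule Collect_cong, rule conj_cong[OF refl])
      fix i assume "i \<in> I"
      then show "F' y i \<noteq> \<one>\<^bsub>?C i\<^esub> \<longleftrightarrow> y i \<noteq> \<one>\<^bsub>?D i\<^esub>"
        using kone_iff[OF inv(1)[OF yi[OF \<open>i \<in> I\<close>]]] inv(2)[OF yi[OF \<open>i \<in> I\<close>]] by (simp add: F'_def)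
    qed
    then show ?thesis using that inv(1) yi unfolding cL cM by (auto simp: F'_def PiE_iff)
  qed
  have FF': "F (F' y) = y" if "y \<in> carrier ?M" for y
    using that inv unfolding cM by (auto simp: F_def F'_def PiE_iff extensional_def)
  have F'F: "F' (F x) = x" if "x \<in> carrier ?L" for x
    using that inv' unfolding cL by (auto simp: F_def F'_def PiE_iff extensional_def)
  have Fiso: "F \<in> iso ?L ?M"
  proof -
    have "bij_betw F (carrier ?L) (carrier ?M)"
      by (rule bij_betw_byWitness[of _ F']) (use FM F'L FF' F'F in auto)
    moreover have "F \<in> hom ?L ?M"
      using FM khom by (auto simp: hom_def F_def cL PiE_iff)
    ultimately show ?thesis by (simp add: iso_def)
  qed
  have FU: "F (U_action V w x) = U_action V' w' (F x)" if "x \<in> carrier ?L" for x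
    using that krestrict unfolding cL U_action_def m_def[symmetric] min[symmetric]
    by (auto simp: F_def I_def PiE_iff)
  have Fhom: "F ` homogeneous_part V w n = homogeneous_part V' w' n" for n
  proof
    show "F ` homogeneous_part V w n \<subseteq> homogeneous_part V' w' n"
      using FM unfolding homogeneous_part_def LM m_def[symmetric] min[symmetric] I_def[symmetric]
      by (auto simp: F_def kone)
    show "homogeneous_part V' w' n \<subseteq> F ` homogeneous_part V w n"
    proof
      fix y assume y: "y \<in> homogeneous_part V' w' n"
      then have yM: "y \<in> carrier ?M" and y1: "\<forall>i\<in>I. i \<noteq> n \<longrightarrow> y i = \<one>\<^bsub>?D i\<^esub>"
        unfolding homogeneous_part_def LM m_def[symmetric] min[symmetric] I_def[symmetric] by auto
      have "F' y i = \<one>\<^bsub>?C i\<^esub>" if "i \<in> I" "i \<noteq> n" for i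
      proof -
        have "F (F' y) i = \<one>\<^bsub>?D i\<^esub>" using FF'[OF yM] y1 that by simp
        moreover have "F' y i \<in> carrier (?C i)" using F'L[OF yM] that unfolding cL by (auto simp: PiE_iff)
        ultimately show ?thesis using kone_iff that by (simp add: F_def)
      qed
      then have "F' y \<in> homogeneous_part V w n"
        using F'L[OF yM] unfolding homogeneous_part_def LM m_def[symmetric] I_def[symmetric] by auto
      then show "y \<in> F ` homogeneous_part V w n" using FF'[OF yM] by (metis imageI)
    qed
  qed
  show "lattice_cohomology0_isomorphic V w V' w'"
    unfolding lattice_cohomology0_isomorphic_def LM using Fiso FU Fhom by blast
  have kaug: "k n ` augmentation_cochains (sublevel V w n) = augmentation_cochains (sublevel V' w' n)" for n
  proof -
    have "k n (cocycle_of (sublevel V w n) (\<lambda>_. c)) = cocycle_of (sublevel V' w' n) (\<lambda>_. c)" for c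
      by (rule keq) (auto simp: cocycle_of_carrier const_path_constant P.line_values_const Q.line_values_const)
    then show ?thesis unfolding augmentation_cochains_eq by (simp add: image_image)
  qed
  have "reduced_lattice_cohomology0 V w \<cong> reduced_lattice_cohomology0 V' w'"
    unfolding reduced_lattice_cohomology0_def m_def[symmetric] min[symmetric] reduced_cohomology0_def
  proof (rule iso_sum_groupI)
    fix n
    show "?C n Mod augmentation_cochains (sublevel V w n) \<cong> ?D n Mod augmentation_cochains (sublevel V' w' n)"
      by (rule FactGroup_iso_FactGroup[OF C D kiso _ augmentation_subgroup kaug])
         (rule subgroup.subset[OF augmentation_subgroup])
    show "group (?C n Mod augmentation_cochains (sublevel V w n))" "group (?D n Mod augmentation_cochains (sublevel V' w' n))"
      by (rule normal.factorgroup_is_group comm_group.subgroup_imp_normal comm_group_cohomology0 augmentation_subgroup)+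
  qed
  moreover have "comm_group (reduced_lattice_cohomology0 V w)" "comm_group (reduced_lattice_cohomology0 V' w')"
    unfolding reduced_lattice_cohomology0_def reduced_cohomology0_def
    by (intro comm_group_sum_group comm_group.abelian_FactGroup[OF comm_group_cohomology0 augmentation_subgroup])+
  ultimately have "abelian_rank (reduced_lattice_cohomology0 V w) = abelian_rank (reduced_lattice_cohomology0 V' w')"
    by (intro abelian_rank_iso)
  then show "eu0 V w = eu0 V' w'" by (simp add: eu0_def min)
qed

section \<open>Unitriangular changes of basis\<close>

definition tri :: "int \<Rightarrow> int" where "tri y = y * (y + 1) div 2"

lemma two_tri: "2 * tri y = y * (y + 1)"
  unfolding tri_def by (rule dvd_mult_div_cancel) (simp add: even_mult_iff)

lemma tri_nonneg: "0 \<le> tri y"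
proof -
  have "0 \<le> y * (y + 1)" by (cases "0 \<le> y") (auto intro: mult_nonneg_nonneg mult_nonpos_nonpos)
  then show ?thesis by (simp add: tri_def)
qed

lemma tri_0 [simp]: "tri 0 = 0" and tri_m1 [simp]: "tri (- 1) = 0"
  by (simp_all add: tri_def)

lemma tri_Suc: "tri (y + 1) = tri y + y + 1"
  using two_tri[of y] two_tri[of "y + 1"] by (simp add: algebra_simps)

lemma tri_pred: "tri (y - 1) = tri y - y"
  using tri_Suc[of "y - 1"] by simp

lemma tri_reflect: "tri (- 1 - y) = tri y"
  using two_tri[of y] two_tri[of "- 1 - y"] by (simp add: algebra_simps)

locale unitriangular =
  fixes V :: "'v set" and M :: "'v \<Rightarrow> 'v \<Rightarrow> int" and rank :: "'v \<Rightarrow> nat"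
  assumes fin: "finite V"
    and diag: "p \<in> V \<Longrightarrow> M p p = 1"
    and triangular: "p \<in> V \<Longrightarrow> u \<in> V \<Longrightarrow> u \<noteq> p \<Longrightarrow> M p u \<noteq> 0 \<Longrightarrow> rank u < rank p"
begin

definition coord :: "('v \<Rightarrow> 'a :: comm_ring_1) \<Rightarrow> 'v \<Rightarrow> 'a" where
  "coord l p = (\<Sum>u\<in>V. of_int (M p u) * l u)"

lemma coord_split:
  assumes "p \<in> V"
  shows "coord l p = l p + (\<Sum>u | u \<in> V \<and> rank u < rank p. of_int (M p u) * l u)"
proof -
  have "coord l p = of_int (M p p) * l p + (\<Sum>u\<in>V - {p}. of_int (M p u) * l u)"
    unfolding coord_def by (rule sum.remove[OF fin assms])
  also have "(\<Sum>u\<in>V - {p}. of_int (M p u) * l u) = (\<Sum>u | u \<in> V \<and> rank u < rank p. of_int (M p u) * l u)"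
  proof (rule sum.mono_neutral_right)
    show "\<forall>u\<in>V - {p} - {u. u \<in> V \<and> rank u < rank p}. of_int (M p u) * l u = 0"
    proof
      fix u assume u: "u \<in> V - {p} - {u. u \<in> V \<and> rank u < rank p}"
      then have "M p u = 0" using triangular[of p u] assms by blast
      then show "of_int (M p u) * l u = 0" by simp
    qed
  qed (use fin in auto)
  finally show ?thesis using diag[OF assms] by simp
qed

lemma coord_unique:
  assumes "\<And>p. p \<in> V \<Longrightarrow> coord l p = coord l' p" "p \<in> V"
  shows "l p = (l' p :: 'a :: comm_ring_1)"
  using assms(2)
proof (induction "rank p" arbitrary: p rule: less_induct)
  case less
  have "(\<Sum>u | u \<in> V \<and> rank u < rank p. of_int (M p u) * l u) = (\<Sum>u | u \<in> V \<and> rank u < rank p. of_int (M p u) * l' u)"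
    by (rule sum.cong[OF refl]) (use less.hyps in auto)
  then show ?case using coord_split[OF less.prems, of l] coord_split[OF less.prems, of l'] assms(1)[OF less.prems] by simp
qed

lemma coord_solve:
  obtains l :: "'v \<Rightarrow> 'a :: comm_ring_1" where "\<And>p. p \<notin> V \<Longrightarrow> l p = 0" "\<And>p. p \<in> V \<Longrightarrow> coord l p = z p"
proof -
  have "\<exists>l :: 'v \<Rightarrow> 'a. (\<forall>p. p \<notin> V \<longrightarrow> l p = 0) \<and> (\<forall>p\<in>V. rank p < n \<longrightarrow> coord l p = z p)" for n
  proof (induction n)
    case 0 show ?case by (intro exI[of _ "\<lambda>_. 0"]) auto
  next
    case (Suc n)
    then obtain l :: "'v \<Rightarrow> 'a" where l: "\<forall>p. p \<notin> V \<longrightarrow> l p = 0" "\<forall>p\<in>V. rank p < n \<longrightarrow> coord l p = z p" by blast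
    define l' where "l' p = (if p \<in> V \<and> rank p = n then z p - (\<Sum>u | u \<in> V \<and> rank u < rank p. of_int (M p u) * l u) else l p)" for p
    have low: "(\<Sum>u | u \<in> V \<and> rank u < rank p. of_int (M p u) * l' u) = (\<Sum>u | u \<in> V \<and> rank u < rank p. of_int (M p u) * l u)"
      if "rank p \<le> n" for p
      by (rule sum.cong[OF refl]) (use that in \<open>auto simp: l'_def\<close>)
    have "coord l' p = z p" if "p \<in> V" "rank p < Suc n" for p
    proof (cases "rank p = n")
      case True
      then show ?thesis using coord_split[OF that(1), of l'] low[of p] that by (simp add: l'_def)
    next
      case False
      then have "coord l' p = coord l p"
        using coord_split[OF that(1), of l'] coord_split[OF that(1), of l] low[of p] that by (simp add: l'_def)
      then show ?thesis using l that False by auto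
    qed
    moreover have "\<forall>p. p \<notin> V \<longrightarrow> l' p = 0" using l by (simp add: l'_def)
    ultimately show ?case by blast
  qed
  from this[of "Suc (Max (rank ` V))"] obtain l :: "'v \<Rightarrow> 'a" where l: "\<forall>p. p \<notin> V \<longrightarrow> l p = 0" 
    "\<forall>p\<in>V. rank p < Suc (Max (rank ` V)) \<longrightarrow> coord l p = z p" by blast
  have "rank p < Suc (Max (rank ` V))" if "p \<in> V" for p
    using fin that by (simp add: le_imp_less_Suc)
  then show ?thesis using l that by blast
qed

text \<open>
  Descending induction on the rank; this gives the non-degeneracy of the intersection form.
\<close>

lemma transpose_injective:
  assumes z: "\<And>v. v \<in> V \<Longrightarrow> (\<Sum>p\<in>V. z p * of_int (M p v)) = 0" and "p \<in> V"
  shows "z p = (0 :: 'a :: comm_ring_1)"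
proof -
  define R where "R = Max (rank ` V)"
  have R: "rank p \<le> R" if "p \<in> V" for p using fin that by (simp add: R_def)
  show ?thesis using \<open>p \<in> V\<close>
  proof (induction "R - rank p" arbitrary: p rule: less_induct)
    case less
    have "(\<Sum>q\<in>V. z q * of_int (M q p)) = (\<Sum>q\<in>{p}. z q * of_int (M q p))"
    proof (rule sum.mono_neutral_right)
      show "\<forall>q\<in>V - {p}. z q * of_int (M q p) = 0"
      proof
        fix q assume q: "q \<in> V - {p}"
        show "z q * of_int (M q p) = 0"
        proof (cases "M q p = 0")
          case False
          then have "rank p < rank q" using triangular[of q p] q less.prems by auto
          then have "R - rank q < R - rank p" using R[of q] q by simp
          then show ?thesis using less.hyps q by simp
        qed simp
      qed
    qed (use fin less.prems in auto)
    then show ?case using z[OF less.prems] diag[OF less.prems] by simp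
  qed
qed

end

section \<open>Connectedness of slices\<close>

text \<open>
  The row \<open>M p\<close> expresses the coordinate along the \<open>p\<close>-th vector of an orthogonal basis through the
  coordinates with respect to the vertices.  The vertex \<open>b0\<close> plays the role of \<open>E\<^sub>+\<close>, and \<open>nn p\<close> is the
  multiplicity of the germ at the point belonging to \<open>p\<close>.
\<close>

locale slice_lattice = unitriangular V M rank
  for V :: "'v set" and M rank +
  fixes b0 :: 'v and nn :: "'v \<Rightarrow> int" and A :: "int \<Rightarrow> int" and w :: "('v \<Rightarrow> int) \<Rightarrow> int"
  assumes base: "b0 \<in> V"
    and rank_inj: "inj_on rank V"
    and M_base: "u \<in> V \<Longrightarrow> u \<noteq> b0 \<Longrightarrow> M b0 u = 0"
    and M_nn: "p \<in> V \<Longrightarrow> p \<noteq> b0 \<Longrightarrow> M p b0 = - nn p"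
    and M_01: "p \<in> V \<Longrightarrow> u \<in> V \<Longrightarrow> u \<noteq> b0 \<Longrightarrow> u \<noteq> p \<Longrightarrow> M p u = 0 \<or> M p u = - 1"
    and weight: "l \<in> Defs.lattice V \<Longrightarrow> w l = A (l b0) + (\<Sum>p\<in>V - {b0}. tri (coord l p))"
begin

definition slice_edge :: "int \<Rightarrow> int \<Rightarrow> bool" where
  "slice_edge n x \<longleftrightarrow> (\<exists>y. A x + (\<Sum>p\<in>V - {b0}. tri (y p)) \<le> n \<and> A (x + 1) + (\<Sum>p\<in>V - {b0}. tri (y p - nn p)) \<le> n)"

abbreviation reach :: "int \<Rightarrow> ('v \<Rightarrow> int) \<Rightarrow> ('v \<Rightarrow> int) \<Rightarrow> bool" where
  "reach n \<equiv> (lattice_step V w n)\<^sup>*\<^sup>*"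

lemma reach_sym: "reach n l l' \<Longrightarrow> reach n l' l"
  by (induction rule: rtranclp_induct) (auto intro: converse_rtranclp_into_rtranclp lattice_step_sym)

lemma coord_translate:
  assumes "v \<in> V" shows "coord (translate l {v}) p = coord l p + M p v"
proof -
  have "coord (translate l {v}) p = (\<Sum>u\<in>V. M p u * l u + (if u = v then M p v else 0))"
    unfolding coord_def translate_def by (rule sum.cong) (auto simp: algebra_simps)
  also have "\<dots> = coord l p + M p v"
    using assms fin by (simp add: sum.distrib coord_def)
  finally show ?thesis .
qed

lemma coord_base: "coord l b0 = (l b0 :: int)"
proof -
  have "coord l b0 = (\<Sum>u\<in>{b0}. of_int (M b0 u) * l u)"
    unfolding coord_def by (rule sum.mono_neutral_right) (use fin base M_base in auto)
  then show ?thesis using diag[OF base] by simp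
qed

lemma translate_neg: "translate (\<lambda>u. l u - (if u = v then 1 else 0)) {v} = l"
  by (auto simp: translate_def)

text \<open>
  The reflection in the second case preserves triangular numbers and exchanges adding and
  subtracting a basis vector; it allows to treat upward and downward moves at once.
\<close>

definition flip :: "bool \<Rightarrow> int \<Rightarrow> int" where
  "flip s y = (if s then y else - 1 - y)"

lemma tri_flip: "tri (flip s y) = tri y"
  by (simp add: flip_def tri_reflect)

text \<open>
  Adding the basis vector of \<open>v\<close> raises the coordinate of \<open>v\<close> by \<open>1\<close>, which does not raise its triangular
  number as long as the coordinate is negative, and lowers some coordinates of higher rank
  by \<open>1\<close>, which does not raise their triangular numbers as long as they are non-negative before.
\<close>

lemma single_move:
  assumes l: "l \<in> sublevel_points V w n" and v: "v \<in> V" "v \<noteq> b0"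
    and neg: "flip s (coord l v) < 0" and nonneg: "\<And>p. p \<in> V - {b0} \<Longrightarrow> rank v < rank p \<Longrightarrow> 0 \<le> flip s (coord l p)"
  obtains l' where "reach n l l'" "l' b0 = l b0" "l' \<in> sublevel_points V w n"
    "flip s (coord l' v) = flip s (coord l v) + 1"
    "\<And>p. p \<in> V - {v} \<Longrightarrow> flip s (coord l' p) = flip s (coord l p) \<or> (rank v < rank p \<and> flip s (coord l' p) = flip s (coord l p) - 1)"
proof -
  define l' where "l' = (if s then translate l {v} else (\<lambda>u. l u - (if u = v then 1 else 0)))"
  have lat: "l \<in> Defs.lattice V" using l by (simp add: sublevel_points_def)
  have lat': "l' \<in> Defs.lattice V"
    using lat v by (auto simp: l'_def lattice_def translate_def)
  have c: "flip s (coord l' p) = flip s (coord l p) + M p v" for p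
    using coord_translate[OF v(1), of l p] coord_translate[OF v(1), of l' p] translate_neg[of l v]
    by (auto simp: l'_def flip_def)
  have M: "M p v = 0 \<or> (rank v < rank p \<and> M p v = - 1)" if "p \<in> V - {v}" for p
    using M_01[of p v] triangular[of p v] v that by auto
  have lo: "l' b0 = l b0" using v by (auto simp: l'_def translate_def)
  have "tri (coord l' p) \<le> tri (coord l p)" if p: "p \<in> V - {b0}" for p
  proof (cases "p = v")
    case True
    have "tri (flip s (coord l v) + 1) \<le> tri (flip s (coord l v))" using neg by (simp add: tri_Suc)
    then show ?thesis using c[of v] diag[OF v(1)] True by (metis tri_flip)
  next
    case False
    then consider "M p v = 0" | "rank v < rank p" "M p v = - 1" using M p by blast
    then show ?thesis
    proof cases
      case 1
      then show ?thesis using c[of p] by (metis add.right_neutral order.refl tri_flip)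
    next
      case 2
      then have "tri (flip s (coord l p) - 1) \<le> tri (flip s (coord l p))" using nonneg[OF p] by (simp add: tri_pred)
      moreover have "flip s (coord l' p) = flip s (coord l p) - 1" using c[of p] 2 by simp
      ultimately show ?thesis by (metis tri_flip)
    qed
  qed
  then have "w l' \<le> w l"
    unfolding weight[OF lat] weight[OF lat'] lo by (intro add_left_mono sum_mono)
  then have l'n: "l' \<in> sublevel_points V w n" using l lat' by (simp add: sublevel_points_def)
  have "lattice_step V w n l l'"
  proof -
    have "l' = translate l {v} \<or> l = translate l' {v}" by (simp add: l'_def translate_neg)
    then show ?thesis unfolding lattice_step_def using l l'n v by blast
  qed
  then show ?thesis
    using that[of l'] lo l'n c diag[OF v(1)] M by auto
qed

text \<open>
  Coordinates of rank at least \<open>r\<close> can be made non-negative without leaving the sublevel set.  By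
  descending induction on \<open>r\<close>, all coordinates of rank above \<open>r\<close> may be assumed non-negative; then a
  single move raises the coordinate of rank \<open>r\<close>, and the coordinates of higher rank, which it may have
  made negative, are repaired by the induction hypothesis.
\<close>

lemma push:
  assumes "l \<in> sublevel_points V w n"
  shows "\<exists>l'. reach n l l' \<and> l' \<in> sublevel_points V w n \<and> l' b0 = l b0 \<and> (\<forall>p\<in>V. rank p < r \<longrightarrow> coord l' p = coord l p) \<and>
    (\<forall>p\<in>V - {b0}. r \<le> rank p \<longrightarrow> 0 \<le> flip s (coord l' p)) \<and>
    ((\<forall>p\<in>V - {b0}. flip s (coord l p) \<le> 0) \<longrightarrow> (\<forall>p\<in>V - {b0}. flip s (coord l' p) \<le> 0))"
    (is "\<exists>l'. ?P r l l'")
proof -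
  define R where "R = Suc (Max (rank ` V))"
  have R: "rank p < R" if "p \<in> V" for p using fin that by (simp add: R_def le_imp_less_Suc)
  have "\<exists>l'. ?P (R - k) l l'" if "l \<in> sublevel_points V w n" for k l
    using that
  proof (induction k arbitrary: l)
    case 0
    have "\<not> R \<le> rank p" if "p \<in> V" for p using R[OF that] by simp
    then have "?P R l l" using 0 by auto
    then show ?case by auto
  next
    case (Suc k)
    define q where "q = R - Suc k"
    show ?case
    proof (cases "R \<le> k")
      case True
      then show ?thesis using Suc.IH[OF Suc.prems] by simp
    next
      case False
      then have q: "R - k = Suc q" "R - Suc k = q" by (auto simp: q_def)
      have IH: "\<exists>l'. ?P (Suc q) l l'" if "l \<in> sublevel_points V w n" for l using Suc.IH[OF that] q by simp
      show ?thesis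
      proof (cases "\<exists>v\<in>V - {b0}. rank v = q")
        case False
        obtain l' where l': "?P (Suc q) l l'" using IH[OF Suc.prems] by blast
        have "Suc q \<le> rank p" if "p \<in> V - {b0}" "q \<le> rank p" for p
          using False that by (auto simp: Suc_le_eq order_less_le)
        then have "?P q l l'" using l' by simp
        then show ?thesis using q by auto
      next
        case True
        then obtain v where v: "v \<in> V" "v \<noteq> b0" "rank v = q" by blast
        have other: "p = v" if "p \<in> V" "rank p = q" for p using rank_inj that v by (auto simp: inj_on_def)
        \<comment> \<open>The number of moves needed at \<open>v\<close> is known in advance, since the repairs leave this coordinate alone.\<close>
        have "\<exists>l'. ?P q l l'" if "l \<in> sublevel_points V w n" "nat (- flip s (coord l v)) = j" for j l
          using that
        proof (induction j arbitrary: l rule: less_induct)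
          case (less j)
          obtain l1 where l1: "?P (Suc q) l l1" using IH[OF less.prems(1)] by blast
          have c1: "coord l1 v = coord l v" using l1 v by auto
          show ?case
          proof (cases "0 \<le> flip s (coord l v)")
            case True
            have "p = v \<or> Suc q \<le> rank p" if "p \<in> V - {b0}" "q \<le> rank p" for p
              using other that by (auto simp: Suc_le_eq order_less_le)
            then have "0 \<le> flip s (coord l1 p)" if "p \<in> V - {b0}" "q \<le> rank p" for p
              using that l1 True c1 by fastforce
            then have "?P q l l1" using l1 by simp
            then show ?thesis by blast
          next
            case False
            then have neg: "flip s (coord l1 v) < 0" using c1 by simp
            obtain l2 where l2: "reach n l1 l2" "l2 b0 = l1 b0" "l2 \<in> sublevel_points V w n"
              "flip s (coord l2 v) = flip s (coord l1 v) + 1"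
              "\<And>p. p \<in> V - {v} \<Longrightarrow> flip s (coord l2 p) = flip s (coord l1 p) \<or> (rank v < rank p \<and> flip s (coord l2 p) = flip s (coord l1 p) - 1)"
              using single_move[of l1 n v s] l1 v neg by (auto simp: Suc_le_eq)
            have "nat (- flip s (coord l2 v)) < j" using less.prems(2) False l2(4) c1 by simp
            then obtain l3 where l3: "?P q l2 l3" using less.IH[OF _ l2(3) refl] by blast
            have "reach n l l3" using l1 l2(1) l3 by (meson rtranclp_trans)
            moreover have "coord l3 p = coord l p" if "p \<in> V" "rank p < q" for p
            proof -
              have "flip s (coord l2 p) = flip s (coord l1 p)" using l2(5)[of p] that v by auto
              then have "coord l2 p = coord l1 p" by (auto simp: flip_def split: if_splits)
              then show ?thesis using l1 l3 that by auto
            qed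
            moreover have "\<forall>p\<in>V - {b0}. flip s (coord l3 p) \<le> 0" if "\<forall>p\<in>V - {b0}. flip s (coord l p) \<le> 0"
            proof -
              have l1': "\<forall>p\<in>V - {b0}. flip s (coord l1 p) \<le> 0" using l1 that by blast
              have "flip s (coord l2 p) \<le> 0" if p: "p \<in> V - {b0}" for p
              proof (cases "p = v")
                case True then show ?thesis using l2(4) neg by simp
              next
                case False
                then have "flip s (coord l2 p) = flip s (coord l1 p) \<or> flip s (coord l2 p) = flip s (coord l1 p) - 1"
                  using l2(5)[of p] p by auto
                moreover have "flip s (coord l1 p) \<le> 0" using l1' p by blast
                ultimately show ?thesis by linarith
              qed
              then show ?thesis using l3 by blast
            qed
            ultimately have "?P q l l3" using l1 l2 l3 by auto
            then show ?thesis by blast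
          qed
        qed
        then show ?thesis using Suc.prems q by auto
      qed
    qed
  qed
  from this[OF assms, of "R - r"] obtain l' where l': "?P (R - (R - r)) l l'" by blast
  show ?thesis
  proof (cases "r \<le> R")
    case True then show ?thesis using l' by auto
  next
    case False
    then have "?P r l l" using assms R by (force simp: not_le)
    then show ?thesis by blast
  qed
qed

definition zero_section :: "int \<Rightarrow> 'v \<Rightarrow> int" where
  "zero_section x = (SOME l. l \<in> Defs.lattice V \<and> (\<forall>p\<in>V. coord l p = (if p = b0 then x else 0)))"

lemma zero_section: "zero_section x \<in> Defs.lattice V" "p \<in> V \<Longrightarrow> coord (zero_section x) p = (if p = b0 then x else 0)"
proof -
  obtain l where "\<And>p. p \<notin> V \<Longrightarrow> l p = 0" "\<And>p. p \<in> V \<Longrightarrow> coord l p = (if p = b0 then x else 0)"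
    using coord_solve[of "\<lambda>p. if p = b0 then x else 0"] by blast
  then have "\<exists>l. l \<in> Defs.lattice V \<and> (\<forall>p\<in>V. coord l p = (if p = b0 then x else 0))"
    by (intro exI[of _ l]) (simp add: lattice_def)
  from someI_ex[OF this]
  show "zero_section x \<in> Defs.lattice V" "p \<in> V \<Longrightarrow> coord (zero_section x) p = (if p = b0 then x else 0)"
    unfolding zero_section_def by auto
qed

lemma zero_section_base: "zero_section x b0 = x"
  using zero_section(2)[OF base, of x] coord_base[of "zero_section x"] by simp

lemma zero_section_weight: "w (zero_section x) = A x"
  unfolding weight[OF zero_section(1)] zero_section_base by (simp add: zero_section(2))

lemma lattice_eqI:
  assumes "l \<in> Defs.lattice V" "l' \<in> Defs.lattice V" "\<And>p. p \<in> V \<Longrightarrow> coord l p = coord l' p" shows "l = l'"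
proof
  fix p show "l p = l' p"
    using assms coord_unique[OF assms(3), of p] by (cases "p \<in> V") (auto simp: lattice_def)
qed

lemma weight_ge: "l \<in> Defs.lattice V \<Longrightarrow> A (l b0) \<le> w l"
  by (simp add: weight sum_nonneg tri_nonneg)

text \<open>
  Go down until all coordinates are at most \<open>-1\<close>, then up until they are all non-negative.  On the
  way up no coordinate exceeds \<open>0\<close>, hence the walk ends at the zero section.
\<close>

lemma slice_connected:
  assumes "l \<in> sublevel_points V w n" shows "reach n l (zero_section (l b0))"
proof -
  obtain l1 where l1: "reach n l l1" "l1 \<in> sublevel_points V w n" "l1 b0 = l b0" "\<forall>p\<in>V - {b0}. 0 \<le> flip False (coord l1 p)"
    using push[OF assms, of 0 False] by auto
  have "\<forall>p\<in>V - {b0}. flip True (coord l1 p) \<le> 0" using l1(4) by (force simp: flip_def)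
  then obtain l2 where l2: "reach n l1 l2" "l2 \<in> sublevel_points V w n" "l2 b0 = l1 b0"
    "\<forall>p\<in>V - {b0}. 0 \<le> flip True (coord l2 p)" "\<forall>p\<in>V - {b0}. flip True (coord l2 p) \<le> 0"
    using push[OF l1(2), of 0 True] by auto
  have "l2 = zero_section (l b0)"
  proof (rule lattice_eqI)
    fix p assume "p \<in> V"
    then show "coord l2 p = coord (zero_section (l b0)) p"
      using l2 l1 coord_base[of l2] by (cases "p = b0") (force simp: zero_section(2) flip_def)+
  qed (use l2 zero_section in \<open>auto simp: sublevel_points_def\<close>)
  then show ?thesis using l1 l2 by (meson rtranclp_trans)
qed

sublocale line_reduction V w A slice_edge "\<lambda>l. l b0" zero_section
proof
  show "finite V" by (rule fin)
  show "A (l b0) \<le> n" if "l \<in> sublevel_points V w n" for l n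
    using that weight_ge[of l] by (auto simp: sublevel_points_def)
  show "zero_section x \<in> sublevel_points V w n" if "A x \<le> n" for x n
    using that zero_section zero_section_weight by (simp add: sublevel_points_def)
  show "zero_section x b0 = x" for x by (rule zero_section_base)
  show "reach n l (zero_section (l b0))" if "l \<in> sublevel_points V w n" for l n
    by (rule slice_connected[OF that])
next
  fix n l l' assume st: "lattice_step V w n l l'"
  have *: "l b0 = translate l {v} b0 \<or> (translate l {v} b0 = l b0 + 1 \<and> slice_edge n (l b0))"
    if "l \<in> sublevel_points V w n" "translate l {v} \<in> sublevel_points V w n" "v \<in> V" for l v
  proof (cases "v = b0")
    case False then show ?thesis by (simp add: translate_def)
  next
    case True
    let ?l = "translate l {v}"
    have lat: "l \<in> Defs.lattice V" "?l \<in> Defs.lattice V" using that by (simp_all add: sublevel_points_def)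
    have x: "?l b0 = l b0 + 1" using True by (simp add: translate_def)
    have "w ?l = A (l b0 + 1) + (\<Sum>p\<in>V - {b0}. tri (coord l p - nn p))"
      unfolding weight[OF lat(2)] x using coord_translate[OF that(3), of l] True
      by (intro arg_cong2[where f = "(+)"] refl sum.cong) (simp_all add: M_nn)
    then have "slice_edge n (l b0)"
      unfolding slice_edge_def using that weight[OF lat(1)] by (intro exI[of _ "coord l"]) (simp add: sublevel_points_def)
    then show ?thesis using x by simp
  qed
  from st obtain v where v: "v \<in> V" "l' = translate l {v} \<or> l = translate l' {v}"
    and ll: "l \<in> sublevel_points V w n" "l' \<in> sublevel_points V w n" unfolding lattice_step_def by blast
  from v(2) show "l b0 = l' b0 \<or> (l' b0 = l b0 + 1 \<and> slice_edge n (l b0)) \<or> (l b0 = l' b0 + 1 \<and> slice_edge n (l' b0))"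
  proof
    assume "l' = translate l {v}" then show ?thesis using *[of l v] v ll by auto
  next
    assume "l = translate l' {v}" then show ?thesis using *[of l' v] v ll by auto
  qed
next
  fix n x assume "slice_edge n x"
  then obtain y where y: "A x + (\<Sum>p\<in>V - {b0}. tri (y p)) \<le> n" "A (x + 1) + (\<Sum>p\<in>V - {b0}. tri (y p - nn p)) \<le> n"
    unfolding slice_edge_def by blast
  obtain l where l: "\<And>p. p \<notin> V \<Longrightarrow> l p = 0" "\<And>p. p \<in> V \<Longrightarrow> coord l p = (if p = b0 then x else y p)"
    using coord_solve[of "\<lambda>p. if p = b0 then x else y p"] by blast
  let ?l = "translate l {b0}"
  have lat: "l \<in> Defs.lattice V" "?l \<in> Defs.lattice V" using l(1) base by (auto simp: lattice_def translate_def)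
  have lo: "l b0 = x" using l(2)[OF base] coord_base[of l] by simp
  then have lb0: "?l b0 = x + 1" by (simp add: translate_def)
  have "w l = A x + (\<Sum>p\<in>V - {b0}. tri (y p))"
    unfolding weight[OF lat(1)] lo using l(2) by (intro arg_cong2[where f = "(+)"] refl sum.cong) simp_all
  then have s: "l \<in> sublevel_points V w n" using y lat by (simp add: sublevel_points_def)
  have "w ?l = A (x + 1) + (\<Sum>p\<in>V - {b0}. tri (y p - nn p))"
    unfolding weight[OF lat(2)] lb0 using l(2) coord_translate[OF base, of l]
    by (intro arg_cong2[where f = "(+)"] refl sum.cong) (simp_all add: M_nn)
  then have s': "?l \<in> sublevel_points V w n" using y lat by (simp add: sublevel_points_def)
  have "lattice_step V w n l ?l" unfolding lattice_step_def using s s' base by blast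
  moreover have "reach n l (zero_section x)" using slice_connected[OF s] lo by simp
  moreover have "reach n ?l (zero_section (x + 1))" using slice_connected[OF s'] lb0 by simp
  ultimately have "reach n (zero_section x) (zero_section (x + 1))"
    using reach_sym by (meson r_into_rtranclp rtranclp_trans)
  moreover have "0 \<le> (\<Sum>p\<in>V - {b0}. tri (y p))" "0 \<le> (\<Sum>p\<in>V - {b0}. tri (y p - nn p))"
    by (simp_all add: sum_nonneg tri_nonneg)
  ultimately show "A x \<le> n \<and> A (x + 1) \<le> n \<and> reach n (zero_section x) (zero_section (x + 1))" using y by simp
qed

text \<open>
  The minimum is attained on the zero section, since triangular numbers are non-negative.
\<close>

lemma min_weight_eq:
  assumes "\<And>x. A x0 \<le> A x" shows "min_weight V w = A x0"
  unfolding min_weight_def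
proof (rule Least_equality)
  show "A x0 \<in> w ` Defs.lattice V" using zero_section(1)[of x0] zero_section_weight[of x0] by (metis imageI)
  fix n assume "n \<in> w ` Defs.lattice V"
  then show "A x0 \<le> n" using weight_ge assms by (auto intro: order_trans)
qed

end

section \<open>The lattice of the surgery graph\<close>

text \<open>
  The entry in row \<open>p\<close> and column \<open>u\<close> is the coefficient of \<open>e\<^sub>p\<close> in \<open>E\<^sub>u\<close>, where \<open>e\<^sub>p\<close> is the total transform
  of the exceptional curve belonging to \<open>p\<close>.  In the first column, the vertex \<open>E\<^sub>+\<close> is treated like the
  strict transform of all germs together.
\<close>

fun surgery_matrix :: "series2 list \<Rightarrow> vertex \<Rightarrow> vertex \<Rightarrow> int" where
  "surgery_matrix fs Plus Plus = 1"
| "surgery_matrix fs Plus (Exc j v) = 0"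
| "surgery_matrix fs (Exc i k) Plus = - int (mult_at (fs ! i) k)"
| "surgery_matrix fs (Exc i k) (Exc j v) =
     (if i = j then (if k = v then 1 else if passes_through (fs ! i) k v then - 1 else 0) else 0)"

text \<open>
  Injectivity of the rank is needed to raise the coordinates one at a time.
\<close>

fun surgery_rank :: "vertex \<Rightarrow> nat" where
  "surgery_rank Plus = 0"
| "surgery_rank (Exc i k) = Suc (prod_encode (i, k))"

fun vertex_mult :: "series2 list \<Rightarrow> vertex \<Rightarrow> nat" where
  "vertex_mult fs Plus = 1"
| "vertex_mult fs (Exc i k) = mult_at (fs ! i) k"

lemma surgery_verts_eq: "surgery_verts d fs = insert Plus {Exc i v |i v. i < length fs \<and> v < blow_up_count (fs ! i)}"
  by (simp add: surgery_verts_def surgery_graph_def resolution_graph_def)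

lemma sum_surgery_verts:
  "(\<Sum>p\<in>surgery_verts d fs - {Plus}. g p) = (\<Sum>i<length fs. \<Sum>k<blow_up_count (fs ! i). g (Exc i k))"
proof -
  have "surgery_verts d fs - {Plus} = (\<lambda>(i, k). Exc i k) ` (SIGMA i:{..<length fs}. {..<blow_up_count (fs ! i)})"
    by (auto simp: surgery_verts_eq)
  then have "(\<Sum>p\<in>surgery_verts d fs - {Plus}. g p) = (\<Sum>(i, k)\<in>(SIGMA i:{..<length fs}. {..<blow_up_count (fs ! i)}). g (Exc i k))"
    by (simp add: sum.reindex inj_on_def case_prod_unfold)
  then show ?thesis by (simp add: sum.Sigma)
qed

lemma finite_surgery_verts: "finite (surgery_verts d fs)"
proof -
  have "surgery_verts d fs = insert Plus ((\<lambda>(i, k). Exc i k) ` (SIGMA i:{..<length fs}. {..<blow_up_count (fs ! i)}))"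
    by (auto simp: surgery_verts_eq)
  then show ?thesis by simp
qed

lemma prod_encode_less: "a < b \<Longrightarrow> prod_encode (i, a) < prod_encode (i, b)"
proof -
  assume "a < b"
  then have "triangle (i + a) \<le> triangle (i + b)" "triangle (i + a) < triangle (i + b)"
  proof (induction b)
    case (Suc b)
    { case 1 then show ?case using Suc by (cases "a = b") (auto simp: less_Suc_eq) }
    { case 2 then show ?case using Suc by (cases "a = b") (auto simp: less_Suc_eq) }
  qed auto
  then show ?thesis by (simp add: prod_encode_def)
qed

locale surgery =
  fixes d :: int and fs :: "series2 list"
  assumes cusps: "\<And>f. f \<in> set fs \<Longrightarrow> cusp f" and d: "d > 0"
begin

abbreviation "V \<equiv> surgery_verts d fs"
abbreviation "M \<equiv> surgery_matrix fs"
abbreviation "N i \<equiv> blow_up_count (fs ! i)"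
abbreviation "gr \<equiv> surgery_graph d fs"

lemma cusp_i: "i < length fs \<Longrightarrow> cusp (fs ! i)"
  by (rule cusps) simp

lemma Plus_in: "Plus \<in> V"
  by (simp add: surgery_verts_eq)

sublocale unitriangular V M surgery_rank
proof
  show "finite V" by (rule finite_surgery_verts)
  show "M p p = 1" if "p \<in> V" for p by (cases p) auto
  show "surgery_rank u < surgery_rank p" if "p \<in> V" "u \<in> V" "u \<noteq> p" "M p u \<noteq> 0" for p u
    using that passes_through_less prod_encode_less by (cases p; cases u) (auto split: if_splits)
qed

lemma M_exc: "M (Exc i k) (Exc i v) = (if k = v then 1 else 0) - (if passes_through (fs ! i) k v then 1 else 0)"
  using passes_through_less[of "fs ! i" k v] by auto

lemma proximity_gram:
  fixes v w n :: nat
  assumes "v < n" "w < n"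
  shows "(\<Sum>k<n. ((if k = v then 1 else 0) - (if P k v then 1 else 0)) * ((if k = w then 1 else 0) - (if P k w then 1 else (0::int))))
     = (if v = w then 1 else 0) - (if P v w then 1 else 0) - (if P w v then 1 else 0) + int (card {k. k < n \<and> P k v \<and> P k w})"
proof -
  have "(\<Sum>k<n. ((if k = v then 1 else 0) - (if P k v then 1 else 0)) * ((if k = w then 1 else 0) - (if P k w then 1 else (0::int))))
    = (\<Sum>k<n. (if k = v then (if v = w then 1 else 0) else 0) - (if k = v then (if P v w then 1 else 0) else 0)
        - (if k = w then (if P w v then 1 else 0) else 0) + (if P k v \<and> P k w then 1 else 0))"
    by (rule sum.cong) auto
  also have "\<dots> = (if v = w then 1 else 0) - (if P v w then 1 else 0) - (if P w v then 1 else 0) + (\<Sum>k<n. if P k v \<and> P k w then 1 else 0)"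
  proof -
    have \<delta>: "(\<Sum>k<n. if k = v then c else 0) = c" "(\<Sum>k<n. if k = w then c else 0) = c" for c :: int
      using assms by simp_all
    show ?thesis by (simp only: sum.distrib sum_subtractf \<delta>)
  qed
  also have "(\<Sum>k<n. if P k v \<and> P k w then 1 else (0::int)) = int (card {k. k < n \<and> P k v \<and> P k w})"
    by (simp add: sum.If_cases Int_def lessThan_def)
  finally show ?thesis .
qed

definition entry :: "vertex \<Rightarrow> vertex \<Rightarrow> int" where
  "entry u v = (if u = v then euler_number gr u else if adjacent gr u v then 1 else 0)"

text \<open>
  Minus the self-intersection of the \<open>p\<close>-th vector of the orthogonal basis.
\<close>

definition diag_weight :: "vertex \<Rightarrow> int" where "diag_weight p = (if p = Plus then d else 1)"

lemma sum_V: "(\<Sum>p\<in>V. g p) = g Plus + (\<Sum>i<length fs. \<Sum>k<N i. g (Exc i k))" for g :: "vertex \<Rightarrow> 'b :: comm_monoid_add"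
  using sum.remove[OF finite_surgery_verts Plus_in, of g] by (simp add: sum_surgery_verts)

lemma entry_Exc_Exc:
  assumes "i < length fs" "v < N i" "j < length fs" "w < N j"
  shows "entry (Exc i v) (Exc j w) = - (\<Sum>p\<in>V. diag_weight p * M p (Exc i v) * M p (Exc j w))"
proof -
  have S: "(\<Sum>p\<in>V. diag_weight p * M p (Exc i v) * M p (Exc j w)) = (\<Sum>i'<length fs. \<Sum>k<N i'. M (Exc i' k) (Exc i v) * M (Exc i' k) (Exc j w))"
    unfolding sum_V by (simp add: diag_weight_def del: surgery_matrix.simps(4))
  show ?thesis
  proof (cases "i = j")
    case False
    then have "(\<Sum>i'<length fs. \<Sum>k<N i'. M (Exc i' k) (Exc i v) * M (Exc i' k) (Exc j w)) = 0"
      by (intro sum.neutral ballI) auto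
    then show ?thesis unfolding S using False by (simp add: entry_def surgery_graph_def)
  next
    case True
    let ?f = "fs ! i"
    have "(\<Sum>i'<length fs. \<Sum>k<N i'. M (Exc i' k) (Exc i v) * M (Exc i' k) (Exc j w))
        = (\<Sum>i'\<in>{i}. \<Sum>k<N i'. M (Exc i' k) (Exc i v) * M (Exc i' k) (Exc j w))"
      using assms by (intro sum.mono_neutral_right) auto
    also have "\<dots> = (\<Sum>k<N i. M (Exc i k) (Exc i v) * M (Exc i k) (Exc i w))" using True by simp
    also have "\<dots> = (if v = w then 1 else 0) - (if passes_through ?f v w then 1 else 0) - (if passes_through ?f w v then 1 else 0)
        + int (card {k. k < N i \<and> passes_through ?f k v \<and> passes_through ?f k w})"
      unfolding M_exc using proximity_gram[of v "N i" w "passes_through ?f"] assms True by simp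
    finally have S': "(\<Sum>p\<in>V. diag_weight p * M p (Exc i v) * M p (Exc j w)) = \<dots>" unfolding S .
    show ?thesis
    proof (cases "v = w")
      case vw: True
      have "\<not> passes_through ?f w w" using passes_through_less by blast
      then show ?thesis unfolding S' using True vw assms exc_self_int_eq[of v "N i" ?f]
        by (simp add: entry_def surgery_graph_def resolution_graph_def)
    next
      case False
      then have "entry (Exc i v) (Exc j w) = (if exc_meet ?f (N i) v w then 1 else 0)"
        using True by (simp add: entry_def surgery_graph_def resolution_graph_def)
      then show ?thesis unfolding S' using exc_meet_count[of v "N i" w ?f] assms False True by simp
    qed
  qed
qed

lemma entry_Plus_Exc:
  assumes "i < length fs" "v < N i"
  shows "entry Plus (Exc i v) = - (\<Sum>p\<in>V. diag_weight p * M p Plus * M p (Exc i v))" and "entry (Exc i v) Plus = entry Plus (Exc i v)"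
proof -
  let ?f = "fs ! i" and ?n = "\<lambda>k. int (mult_at (fs ! i) k)"
  have "(\<Sum>p\<in>V. diag_weight p * M p Plus * M p (Exc i v)) = (\<Sum>i'<length fs. \<Sum>k<N i'. M (Exc i' k) Plus * M (Exc i' k) (Exc i v))"
    unfolding sum_V by (simp add: diag_weight_def del: surgery_matrix.simps(4))
  also have "\<dots> = (\<Sum>i'\<in>{i}. \<Sum>k<N i'. M (Exc i' k) Plus * M (Exc i' k) (Exc i v))"
    using assms by (intro sum.mono_neutral_right) auto
  also have "\<dots> = (\<Sum>k<N i. - (if k = v then ?n v else 0) + (if passes_through ?f k v then ?n k else 0))"
    by (simp add: M_exc del: surgery_matrix.simps(4)) (rule sum.cong, auto)
  also have "\<dots> = - ?n v + (\<Sum>k | k < N i \<and> passes_through ?f k v. ?n k)"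
  proof -
    have "(\<Sum>k<N i. if k = v then ?n v else 0) = ?n v" using assms by simp
    moreover have "(\<Sum>k<N i. if passes_through ?f k v then ?n k else 0) = (\<Sum>k | k < N i \<and> passes_through ?f k v. ?n k)"
      by (simp add: sum.If_cases Int_def lessThan_def)
    ultimately show ?thesis by (simp only: sum.distrib sum_negf)
  qed
  also have "\<dots> = - (if Suc v = N i then 1 else 0)"
    using arg_cong[OF proximity_end[OF cusp_i[OF assms(1)] assms(2)], of int] by simp
  finally have S: "(\<Sum>p\<in>V. diag_weight p * M p Plus * M p (Exc i v)) = - (if Suc v = N i then 1 else 0)" .
  have "0 < N i" by (rule blow_up_count_pos[OF cusp_i[OF assms(1)]])
  then have "entry Plus (Exc i v) = (if Suc v = N i then 1 else 0)"
    using minus_one_vertex_eq[OF cusp_i[OF assms(1)]] by (auto simp: entry_def surgery_graph_def)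
  then show "entry Plus (Exc i v) = - (\<Sum>p\<in>V. diag_weight p * M p Plus * M p (Exc i v))" unfolding S by simp
  show "entry (Exc i v) Plus = entry Plus (Exc i v)" by (simp add: entry_def surgery_graph_def)
qed

lemma entry_Plus_Plus: "entry Plus Plus = - (\<Sum>p\<in>V. diag_weight p * M p Plus * M p Plus)"
proof -
  have "(\<Sum>f\<leftarrow>fs. int (pullback_mult f (minus_one_vertex (resolution_graph f))))
      = (\<Sum>i<length fs. int (pullback_mult (fs ! i) (minus_one_vertex (resolution_graph (fs ! i)))))"
    by (simp add: sum_list_sum_nth atLeast0LessThan)
  also have "\<dots> = (\<Sum>i<length fs. \<Sum>k<N i. int (mult_at (fs ! i) k) * int (mult_at (fs ! i) k))"
    by (rule sum.cong) (simp_all add: minus_one_vertex_eq[OF cusp_i] pullback_mult_end[OF cusp_i] power2_eq_square del: One_nat_def)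
  finally show ?thesis unfolding sum_V by (simp add: entry_def surgery_graph_def diag_weight_def)
qed

text \<open>
  The vectors \<open>e\<^sub>p\<close> are orthogonal.
\<close>

lemma entry_eq:
  assumes "u \<in> V" "v \<in> V" shows "entry u v = - (\<Sum>p\<in>V. diag_weight p * M p u * M p v)"
proof (cases u; cases v)
  fix i k assume "u = Exc i k" "v = Plus"
  then show ?thesis using entry_Plus_Exc[of i k] assms by (simp add: surgery_verts_eq mult_ac)
next
  fix i k assume "u = Plus" "v = Exc i k"
  then show ?thesis using entry_Plus_Exc(1)[of i k] assms by (simp add: surgery_verts_eq)
next
  fix i k j w assume "u = Exc i k" "v = Exc j w"
  then show ?thesis using entry_Exc_Exc[of i k j w] assms by (simp add: surgery_verts_eq)
next
  assume "u = Plus" "v = Plus"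
  then show ?thesis using entry_Plus_Plus by simp
qed

lemma intersection_form_eq:
  "intersection_form gr x y = - (\<Sum>p\<in>V. of_int (diag_weight p) * coord x p * coord y p)"
proof -
  have vs: "verts gr = V" by (simp add: surgery_verts_def)
  have "intersection_form gr x y = (\<Sum>v\<in>V. \<Sum>w\<in>V. x v * y w * of_int (entry v w))"
    unfolding intersection_form_def vs by (intro sum.cong) (auto simp: entry_def)
  also have "\<dots> = (\<Sum>v\<in>V. \<Sum>w\<in>V. - (\<Sum>p\<in>V. of_int (diag_weight p) * (of_int (M p v) * x v) * (of_int (M p w) * y w)))"
    by (intro sum.cong refl) (simp add: entry_eq sum_distrib_left mult_ac)
  also have "\<dots> = - (\<Sum>v\<in>V. \<Sum>w\<in>V. \<Sum>p\<in>V. of_int (diag_weight p) * (of_int (M p v) * x v) * (of_int (M p w) * y w))"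
    by (simp add: sum_negf)
  also have "(\<Sum>v\<in>V. \<Sum>w\<in>V. \<Sum>p\<in>V. of_int (diag_weight p) * (of_int (M p v) * x v) * (of_int (M p w) * y w))
     = (\<Sum>v\<in>V. \<Sum>p\<in>V. \<Sum>w\<in>V. of_int (diag_weight p) * (of_int (M p v) * x v) * (of_int (M p w) * y w))"
    by (intro sum.cong refl sum.swap)
  also have "\<dots> = (\<Sum>p\<in>V. \<Sum>v\<in>V. \<Sum>w\<in>V. of_int (diag_weight p) * (of_int (M p v) * x v) * (of_int (M p w) * y w))"
    by (rule sum.swap)
  also have "\<dots> = (\<Sum>p\<in>V. of_int (diag_weight p) * coord x p * coord y p)"
    unfolding coord_def by (simp add: sum_product sum_distrib_left sum_distrib_right mult_ac)
  finally show ?thesis .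
qed

lemma coord_basis: "v \<in> V \<Longrightarrow> coord (basis_rat v) p = of_int (M p v)"
proof -
  assume v: "v \<in> V"
  have "coord (basis_rat v) p = (\<Sum>u\<in>V. if u = v then of_int (M p v) else 0)"
    unfolding coord_def basis_rat_def by (rule sum.cong) auto
  then show ?thesis using v fin by simp
qed

lemma coord_Plus: "coord l Plus = l Plus" for l :: "vertex \<Rightarrow> 'b :: comm_ring_1"
proof -
  have "coord l Plus = (\<Sum>u\<in>{Plus}. of_int (M Plus u) * l u)"
    unfolding coord_def
  proof (rule sum.mono_neutral_right)
    show "\<forall>u\<in>V - {Plus}. of_int (M Plus u) * l u = 0" by (auto simp: surgery_verts_eq)
  qed (use fin Plus_in in auto)
  then show ?thesis by simp
qed

lemma coord_add: "coord (\<lambda>v. x v + y v) p = coord x p + coord y p" for x y :: "vertex \<Rightarrow> 'b :: comm_ring_1"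
  by (simp add: coord_def algebra_simps sum.distrib)

lemma coord_scale: "coord (\<lambda>v. c * x v) p = c * coord x p" for x :: "vertex \<Rightarrow> 'b :: comm_ring_1"
  by (simp add: coord_def sum_distrib_left mult_ac)

lemma coord_of_int: "coord (\<lambda>v. of_int (l v)) p = (of_int (coord l p) :: 'b :: comm_ring_1)"
  by (simp add: coord_def)

lemma the_dual:
  assumes k: "k \<in> lattice_rat V" "\<And>v. v \<in> V \<Longrightarrow> intersection_form gr k (basis_rat v) = t v"
  shows "(THE k. k \<in> lattice_rat (verts gr) \<and> (\<forall>v\<in>verts gr. intersection_form gr k (basis_rat v) = t v)) = k"
proof (rule the_equality)
  have vs: "verts gr = V" by (simp add: surgery_verts_def)
  show "k \<in> lattice_rat (verts gr) \<and> (\<forall>v\<in>verts gr. intersection_form gr k (basis_rat v) = t v)"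
    using k by (simp add: vs)
  fix k' assume "k' \<in> lattice_rat (verts gr) \<and> (\<forall>v\<in>verts gr. intersection_form gr k' (basis_rat v) = t v)"
  then have k': "k' \<in> lattice_rat V" "\<And>v. v \<in> V \<Longrightarrow> intersection_form gr k' (basis_rat v) = t v"
    by (auto simp: vs)
  have "coord k' p = coord k p" if "p \<in> V" for p
  proof -
    have "of_int (diag_weight p) * (coord k' p - coord k p) = 0"
    proof (rule transpose_injective[OF _ that])
      fix v assume v: "v \<in> V"
      have "(\<Sum>p\<in>V. of_int (diag_weight p) * coord k' p * of_int (M p v)) = (\<Sum>p\<in>V. of_int (diag_weight p) * coord k p * of_int (M p v))"
        using k(2)[OF v] k'(2)[OF v] by (simp add: intersection_form_eq coord_basis[OF v])
      then show "(\<Sum>p\<in>V. of_int (diag_weight p) * (coord k' p - coord k p) * of_int (M p v)) = 0"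
        by (simp add: algebra_simps sum_subtractf)
    qed
    moreover have "diag_weight p \<noteq> 0" using d by (simp add: diag_weight_def)
    ultimately show ?thesis by simp
  qed
  then show "k' = k"
  proof (intro ext)
    fix x show "k' x = k x" if "\<And>p. p \<in> V \<Longrightarrow> coord k' p = coord k p"
      using coord_unique[OF that, of x] k(1) k'(1) by (cases "x \<in> V") (auto simp: lattice_rat_def)
  qed
qed

text \<open>
  The sum of the delta invariants of the germs: \<open>tri (- n) = n (n - 1) / 2\<close>.
\<close>

definition delta_total :: int where "delta_total = (\<Sum>p\<in>V - {Plus}. tri (- int (vertex_mult fs p)))"

lemma sum_V': "(\<Sum>p\<in>V. g p) = g Plus + (\<Sum>p\<in>V - {Plus}. g p)" for g :: "vertex \<Rightarrow> 'b :: comm_monoid_add"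
  by (rule sum.remove[OF finite_surgery_verts Plus_in])

lemma two_delta_total: "2 * delta_total = (\<Sum>p\<in>V - {Plus}. int (vertex_mult fs p) * (int (vertex_mult fs p) - 1))"
  unfolding delta_total_def sum_distrib_left two_tri by (rule sum.cong) (simp_all add: algebra_simps)

text \<open>
  The canonical class of an iterated blow-up is the sum of the total transforms \<open>e\<^sub>p\<close>; the coefficient at
  \<open>Plus\<close> is what the adjunction formula for \<open>E\<^sub>+\<close> then requires.
\<close>

lemma canonical_class_coord:
  "p \<in> V \<Longrightarrow> coord (canonical_class gr) p = (if p = Plus then (2 - of_int d - 2 * of_int delta_total) / of_int d else 1)"
proof -
  let ?\<kappa> = "(2 - of_int d - 2 * of_int delta_total) / of_int d :: rat"
  obtain K :: "vertex \<Rightarrow> rat" where K: "\<And>p. p \<notin> V \<Longrightarrow> K p = 0" "\<And>p. p \<in> V \<Longrightarrow> coord K p = (if p = Plus then ?\<kappa> else 1)"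
    using coord_solve[of "\<lambda>p. if p = Plus then ?\<kappa> else 1"] by blast
  have "intersection_form gr K (basis_rat v) = - intersection_form gr (basis_rat v) (basis_rat v) - 2" if v: "v \<in> V" for v
  proof -
    have "intersection_form gr K (basis_rat v) + intersection_form gr (basis_rat v) (basis_rat v)
      = - (\<Sum>p\<in>V. of_int (diag_weight p) * of_int (M p v) * (coord K p + of_int (M p v)))"
      unfolding intersection_form_eq coord_basis[OF v] by (simp add: sum.distrib algebra_simps flip: sum_negf)
    also have "\<dots> = - (of_int d * of_int (M Plus v) * (?\<kappa> + of_int (M Plus v)) + (\<Sum>p\<in>V - {Plus}. of_int (M p v * (1 + M p v))))"
      unfolding sum_V'[of "\<lambda>p. of_int (diag_weight p) * of_int (M p v) * (coord K p + of_int (M p v))"]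
      using K(2) Plus_in by (simp add: diag_weight_def)
    also have "\<dots> = - 2"
    proof (cases v)
      case Plus
      have "(\<Sum>p\<in>V - {Plus}. M p v * (1 + M p v)) = 2 * delta_total"
        unfolding two_delta_total Plus by (rule sum.cong) (auto simp: surgery_verts_eq algebra_simps)
      then have S: "(\<Sum>p\<in>V - {Plus}. of_int (M p v * (1 + M p v))) = (of_int (2 * delta_total) :: rat)"
        by (simp only: of_int_sum[symmetric])
      have X: "of_int d * of_int (M Plus v) * (?\<kappa> + of_int (M Plus v)) = 2 - 2 * (of_int delta_total :: rat)"
        using d by (simp add: Plus field_simps)
      show ?thesis unfolding S X by simp
    next
      case (Exc i k)
      have "(\<Sum>p\<in>V - {Plus}. M p v * (1 + M p v)) = (\<Sum>p\<in>{v}. M p v * (1 + M p v))"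
      proof (rule sum.mono_neutral_right)
        show "\<forall>p\<in>V - {Plus} - {v}. M p v * (1 + M p v) = 0"
        proof
          fix p assume p: "p \<in> V - {Plus} - {v}"
          then obtain j l where "p = Exc j l" by (cases p) auto
          then show "M p v * (1 + M p v) = 0" using p by (simp add: Exc)
        qed
      qed (use fin v in \<open>simp_all add: Exc\<close>)
      also have "\<dots> = 2" using diag[OF v] by simp
      finally have S: "(\<Sum>p\<in>V - {Plus}. of_int (M p v * (1 + M p v))) = (of_int 2 :: rat)"
        by (simp only: of_int_sum[symmetric])
      show ?thesis unfolding S by (simp add: Exc)
    qed
    finally show ?thesis by linarith
  qed
  moreover have "K \<in> lattice_rat V" using K(1) by (simp add: lattice_rat_def)
  ultimately have "canonical_class gr = K"
    unfolding canonical_class_def by (intro the_dual)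
  then show "p \<in> V \<Longrightarrow> coord (canonical_class gr) p = (if p = Plus then ?\<kappa> else 1)" using K(2) by simp
qed

lemma dual_vertex_coord: "p \<in> V \<Longrightarrow> coord (dual_vertex gr Plus) p = (if p = Plus then 1 / of_int d else 0)"
proof -
  obtain K :: "vertex \<Rightarrow> rat" where K: "\<And>p. p \<notin> V \<Longrightarrow> K p = 0" "\<And>p. p \<in> V \<Longrightarrow> coord K p = (if p = Plus then 1 / of_int d else 0)"
    using coord_solve[of "\<lambda>p. if p = Plus then 1 / of_int d else 0"] by blast
  have "intersection_form gr K (basis_rat v) = (if v = Plus then - 1 else 0)" if v: "v \<in> V" for v
  proof -
    have "intersection_form gr K (basis_rat v) = - (of_int d * (1 / of_int d) * of_int (M Plus v))"
      unfolding intersection_form_eq coord_basis[OF v] sum_V'[of "\<lambda>p. of_int (diag_weight p) * coord K p * of_int (M p v)"]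
      using K(2) Plus_in by (simp add: diag_weight_def)
    also have "\<dots> = (if v = Plus then - 1 else 0)" using d by (cases v) auto
    finally show ?thesis .
  qed
  moreover have "K \<in> lattice_rat V" using K(1) by (simp add: lattice_rat_def)
  ultimately have "dual_vertex gr Plus = K"
    unfolding dual_vertex_def by (intro the_dual)
  then show "p \<in> V \<Longrightarrow> coord (dual_vertex gr Plus) p = (if p = Plus then 1 / of_int d else 0)" using K(2) by simp
qed

definition line_weight :: "int \<Rightarrow> int \<Rightarrow> int" where
  "line_weight a x = d * tri (- x) + (a + 1) * x - x * delta_total"

lemma d_tri: "2 * (d * tri (- x)) = d * (x * (x - 1))"
proof -
  have "2 * (d * tri (- x)) = d * (2 * tri (- x))" by simp
  then show ?thesis unfolding two_tri by (simp add: algebra_simps)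
qed

lemma surgery_weight_eq:
  "surgery_weight d fs a l = line_weight a (l Plus) + (\<Sum>p\<in>V - {Plus}. tri (coord l p))"
proof -
  let ?c = "\<lambda>p. of_int (coord l p) :: rat" and ?x = "of_int (l Plus) :: rat"
  let ?y = "\<lambda>v. of_int (l v) + canonical_class gr v + 2 * of_int a * dual_vertex gr Plus v"
  have cy: "coord ?y p = ?c p + coord (canonical_class gr) p + 2 * of_int a * coord (dual_vertex gr Plus) p" for p
    by (simp add: coord_add coord_scale coord_of_int)
  have "- (1 / 2) * intersection_form gr (\<lambda>v. of_int (l v)) ?y = 1 / 2 * (\<Sum>p\<in>V. of_int (diag_weight p) * ?c p * coord ?y p)"
    by (simp add: intersection_form_eq coord_of_int)
  also have "(\<Sum>p\<in>V. of_int (diag_weight p) * ?c p * coord ?y p)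
     = of_int d * ?x * (?x + (2 - of_int d - 2 * of_int delta_total) / of_int d + 2 * of_int a * (1 / of_int d))
       + (\<Sum>p\<in>V - {Plus}. ?c p * (?c p + 1))"
  proof -
    have "coord ?y Plus = ?x + (2 - of_int d - 2 * of_int delta_total) / of_int d + 2 * of_int a * (1 / of_int d)"
      unfolding cy canonical_class_coord[OF Plus_in] dual_vertex_coord[OF Plus_in] coord_Plus[of l] by (simp only: if_True simp_thms)
    moreover have "?c Plus = ?x" unfolding coord_Plus[of l] ..
    moreover have "(\<Sum>p\<in>V - {Plus}. of_int (diag_weight p) * ?c p * coord ?y p) = (\<Sum>p\<in>V - {Plus}. ?c p * (?c p + 1))"
      unfolding cy by (rule sum.cong) (simp_all add: diag_weight_def canonical_class_coord dual_vertex_coord)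
    ultimately show ?thesis
      unfolding sum_V'[of "\<lambda>p. of_int (diag_weight p) * ?c p * coord ?y p"] by (simp only: diag_weight_def if_True simp_thms)
  qed
  also have "of_int d * ?x * (?x + (2 - of_int d - 2 * of_int delta_total) / of_int d + 2 * of_int a * (1 / of_int d))
     = of_int (d * (l Plus * (l Plus - 1)) + 2 * (a + 1) * l Plus - 2 * l Plus * delta_total)"
    using d by (simp add: field_simps)
  also have "d * (l Plus * (l Plus - 1)) = 2 * (d * tri (- l Plus))"
    by (rule d_tri[symmetric])
  also have "(\<Sum>p\<in>V - {Plus}. ?c p * (?c p + 1)) = of_int (\<Sum>p\<in>V - {Plus}. coord l p * (coord l p + 1))"
    by simp
  also have "(\<Sum>p\<in>V - {Plus}. coord l p * (coord l p + 1)) = 2 * (\<Sum>p\<in>V - {Plus}. tri (coord l p))"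
    by (simp add: sum_distrib_left two_tri)
  also have "1 / 2 * (of_int (2 * (d * tri (- l Plus)) + 2 * (a + 1) * l Plus - 2 * l Plus * delta_total)
       + of_int (2 * (\<Sum>p\<in>V - {Plus}. tri (coord l p)))) = (of_int (line_weight a (l Plus) + (\<Sum>p\<in>V - {Plus}. tri (coord l p))) :: rat)"
    by (simp add: line_weight_def field_simps)
  finally show ?thesis
    unfolding surgery_weight_def spinc_weight_def by (simp only: floor_of_int)
qed

lemma surgery_slice_lattice:
  "slice_lattice V M surgery_rank Plus (\<lambda>p. int (vertex_mult fs p)) (line_weight a) (surgery_weight d fs a)"
proof unfold_locales
  show "Plus \<in> V" by (rule Plus_in)
  show "inj_on surgery_rank V"
  proof (rule inj_onI)
    fix p q assume "surgery_rank p = surgery_rank q" then show "p = q" by (cases p; cases q) auto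
  qed
  show "M Plus u = 0" if "u \<noteq> Plus" for u using that by (cases u) auto
  show "M p Plus = - int (vertex_mult fs p)" if "p \<noteq> Plus" for p using that by (cases p) auto
  show "M p u = 0 \<or> M p u = - 1" if "u \<noteq> Plus" "u \<noteq> p" for p u using that by (cases p; cases u) auto
qed (rule surgery_weight_eq)

text \<open>
  The double of \<open>line_weight a x\<close> is \<open>d x\<^sup>2 + b x\<close> with \<open>d \<ge> 1\<close>, which is at least \<open>- b\<^sup>2\<close>.
\<close>

lemma line_weight_has_min: "\<exists>x0. \<forall>x. line_weight a x0 \<le> line_weight a x"
proof -
  define b where "b = 2 * (a + 1 - delta_total) - d"
  have two: "2 * line_weight a x = d * x * x + b * x" for x
    using d_tri[of x] by (simp add: line_weight_def b_def algebra_simps)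
  have bound: "- (b * b) \<le> 2 * line_weight a x" for x
  proof -
    have "0 \<le> (d - 1) * (x * x)" using d by (intro mult_nonneg_nonneg[of "d - 1" "x * x"]) simp_all
    then have "x * x \<le> d * (x * x)" by (simp add: algebra_simps)
    moreover have "0 \<le> (2 * x + b) * (2 * x + b)" by simp
    then have "0 \<le> 4 * (x * x) + 4 * (b * x) + b * b" by (simp add: algebra_simps)
    moreover have "0 \<le> b * b" by simp
    moreover have "2 * line_weight a x = d * (x * x) + b * x" unfolding two by simp
    ultimately show ?thesis by linarith
  qed
  obtain x0 where x0: "\<And>x. nat (2 * line_weight a x0 + b * b) \<le> nat (2 * line_weight a x + b * b)"
    using ex_has_least_nat[of "\<lambda>_. True" 0 "\<lambda>x. nat (2 * line_weight a x + b * b)"] by blast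
  have "line_weight a x0 \<le> line_weight a x" for x
    using x0[of x] bound[of x] bound[of x0] by linarith
  then show ?thesis by blast
qed

end

section \<open>Independence of the distribution of multiplicities\<close>

lemma fibre_bijection:
  fixes f :: "'a \<Rightarrow> 'c" and g :: "'b \<Rightarrow> 'c"
  assumes fin: "finite I" "finite J" and card: "\<And>c. c \<noteq> e \<Longrightarrow> card {p \<in> I. f p = c} = card {q \<in> J. g q = c}"
  shows "\<exists>h. bij_betw h {p \<in> I. f p \<noteq> e} {q \<in> J. g q \<noteq> e} \<and> (\<forall>p\<in>{p \<in> I. f p \<noteq> e}. g (h p) = f p)"
proof -
  define H where "H c = (SOME h. bij_betw h {p \<in> I. f p = c} {q \<in> J. g q = c})" for c
  have H: "bij_betw (H c) {p \<in> I. f p = c} {q \<in> J. g q = c}" if "c \<noteq> e" for c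
  proof -
    have "finite {p \<in> I. f p = c}" "finite {q \<in> J. g q = c}" using fin by simp_all
    then have "\<exists>h. bij_betw h {p \<in> I. f p = c} {q \<in> J. g q = c}"
      using card[OF that] by (rule finite_same_card_bij)
    then show ?thesis unfolding H_def by (rule someI_ex)
  qed
  define h where "h p = H (f p) p" for p
  have hp: "h p \<in> J \<and> g (h p) = f p" if "p \<in> I" "f p \<noteq> e" for p
    using H[OF that(2)] that unfolding h_def bij_betw_def by blast
  have "inj_on h {p \<in> I. f p \<noteq> e}"
  proof (rule inj_onI)
    fix p q assume pq: "p \<in> {p \<in> I. f p \<noteq> e}" "q \<in> {p \<in> I. f p \<noteq> e}" "h p = h q"
    then have "g (h p) = f p" "g (h q) = f q" using hp[of p] hp[of q] by simp_all
    then have "f p = f q" using pq(3) by simp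
    then show "p = q" using H[of "f p"] pq unfolding h_def bij_betw_def inj_on_def by auto
  qed
  moreover have "h ` {p \<in> I. f p \<noteq> e} = {q \<in> J. g q \<noteq> e}"
  proof
    show "h ` {p \<in> I. f p \<noteq> e} \<subseteq> {q \<in> J. g q \<noteq> e}"
    proof (rule image_subsetI)
      fix p assume "p \<in> {p \<in> I. f p \<noteq> e}"
      then show "h p \<in> {q \<in> J. g q \<noteq> e}" using hp[of p] by simp
    qed
    show "{q \<in> J. g q \<noteq> e} \<subseteq> h ` {p \<in> I. f p \<noteq> e}"
    proof
      fix q assume "q \<in> {q \<in> J. g q \<noteq> e}"
      then have q: "q \<in> J" "g q \<noteq> e" by auto
      then have "q \<in> H (g q) ` {p \<in> I. f p = g q}" using H[OF q(2)] unfolding bij_betw_def by blast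
      then obtain p where "p \<in> I" "f p = g q" "q = H (g q) p" by blast
      then show "q \<in> h ` {p \<in> I. f p \<noteq> e}" using q by (intro image_eqI[of _ _ p]) (auto simp: h_def)
    qed
  qed
  ultimately have "bij_betw h {p \<in> I. f p \<noteq> e} {q \<in> J. g q \<noteq> e}" by (simp add: bij_betw_def)
  then show ?thesis using hp by blast
qed

lemma card_vertex_mult:
  assumes cusps: "\<forall>f\<in>set fs. cusp f" and c: "c \<noteq> 1"
  shows "card {p \<in> surgery_verts d fs - {Plus}. vertex_mult fs p = c} = count (\<Sum>f\<leftarrow>fs. mset (multiplicity_sequence f)) c"
proof -
  have fin: "finite (surgery_verts d fs - {Plus})" using finite_surgery_verts by simp
  have "card {p \<in> surgery_verts d fs - {Plus}. vertex_mult fs p = c} = (\<Sum>p\<in>surgery_verts d fs - {Plus}. if vertex_mult fs p = c then 1 else 0)"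
    using fin by (simp add: sum.If_cases Int_def)
  also have "\<dots> = (\<Sum>i<length fs. \<Sum>k<blow_up_count (fs ! i). if mult_at (fs ! i) k = c then 1 else 0)"
    unfolding sum_surgery_verts by simp
  also have "\<dots> = (\<Sum>i<length fs. count (mset (multiplicity_sequence (fs ! i))) c)"
  proof (rule sum.cong[OF refl])
    fix i assume "i \<in> {..<length fs}"
    then have "cusp (fs ! i)" using cusps by simp
    let ?f = "fs ! i"
    have "count (mset (multiplicity_sequence ?f)) c = count (filter_mset (\<lambda>n. n \<noteq> 1) (mset (multiplicity_sequence ?f))) c"
      using c by simp
    also have "\<dots> = count (image_mset (mult_at ?f) (mset_set {k. k < blow_up_count ?f \<and> mult_at ?f k \<noteq> 1})) c"
      unfolding multiplicity_sequence_mset[OF \<open>cusp ?f\<close>] ..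
    also have "\<dots> = (\<Sum>k | k < blow_up_count ?f \<and> mult_at ?f k \<noteq> 1 \<and> c = mult_at ?f k. 1)"
      unfolding count_image_mset' by (rule sum.cong) auto
    also have "\<dots> = card {k. k < blow_up_count ?f \<and> mult_at ?f k = c}"
      using c by (auto intro!: arg_cong[where f = card])
    finally show "(\<Sum>k<blow_up_count ?f. if mult_at ?f k = c then 1 else 0) = count (mset (multiplicity_sequence ?f)) c"
      by (simp add: sum.If_cases Int_def lessThan_def)
  qed
  also have "\<dots> = count (\<Sum>i<length fs. mset (multiplicity_sequence (fs ! i))) c"
    by (simp add: count_sum)
  also have "(\<Sum>i<length fs. mset (multiplicity_sequence (fs ! i))) = (\<Sum>f\<leftarrow>fs. mset (multiplicity_sequence f))"
    by (simp add: sum_list_sum_nth atLeast0LessThan)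
  finally show ?thesis .
qed

text \<open>
  A bijection between the entries different from \<open>1\<close> transports \<open>y\<close>; at entries \<open>1\<close> the transported
  vector is \<open>0\<close> and costs nothing.
\<close>

lemma transfer_sum:
  fixes \<phi> :: "int \<Rightarrow> nat \<Rightarrow> int"
  assumes fin: "finite I" "finite J" and h: "bij_betw h {p \<in> I. f p \<noteq> 1} {q \<in> J. g q \<noteq> 1}" "\<forall>p\<in>{p \<in> I. f p \<noteq> 1}. g (h p) = f p"
    and \<phi>: "\<And>y n. 0 \<le> \<phi> y n" "\<phi> 0 1 = 0"
  defines "y' \<equiv> \<lambda>y q. if q \<in> {q \<in> J. g q \<noteq> 1} then y (the_inv_into {p \<in> I. f p \<noteq> 1} h q) else 0"
  shows "(\<Sum>q\<in>J. \<phi> (y' y q) (g q)) \<le> (\<Sum>p\<in>I. \<phi> (y p) (f p))"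
proof -
  let ?I = "{p \<in> I. f p \<noteq> 1}" and ?J = "{q \<in> J. g q \<noteq> 1}"
  have "(\<Sum>q\<in>J. \<phi> (y' y q) (g q)) = (\<Sum>q\<in>?J. \<phi> (y' y q) (g q))"
    by (rule sum.mono_neutral_right) (use fin \<phi> in \<open>auto simp: y'_def\<close>)
  also have "\<dots> = (\<Sum>p\<in>?I. \<phi> (y' y (h p)) (g (h p)))"
    by (rule sum.reindex_bij_betw[OF h(1), symmetric])
  also have "\<dots> = (\<Sum>p\<in>?I. \<phi> (y p) (f p))"
  proof (rule sum.cong[OF refl])
    fix p assume p: "p \<in> ?I"
    then have "h p \<in> ?J" using h(1) unfolding bij_betw_def by blast
    moreover have "the_inv_into ?I h (h p) = p" using h(1) p unfolding bij_betw_def by (intro the_inv_into_f_f) auto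
    ultimately show "\<phi> (y' y (h p)) (g (h p)) = \<phi> (y p) (f p)" using h(2) p by (simp add: y'_def)
  qed
  also have "\<dots> \<le> (\<Sum>p\<in>I. \<phi> (y p) (f p))"
    by (rule sum_mono2) (use fin \<phi> in auto)
  finally show ?thesis .
qed


lemma vertex_bijection:
  fixes d :: int
  assumes fs: "\<forall>f\<in>set fs. cusp f" and gs: "\<forall>g\<in>set gs. cusp g"
    and mset: "(\<Sum>f\<leftarrow>fs. mset (multiplicity_sequence f)) = (\<Sum>g\<leftarrow>gs. mset (multiplicity_sequence g))"
  obtains h where
    "bij_betw h {p \<in> surgery_verts d fs - {Plus}. vertex_mult fs p \<noteq> 1} {q \<in> surgery_verts d gs - {Plus}. vertex_mult gs q \<noteq> 1}"
    "\<forall>p\<in>{p \<in> surgery_verts d fs - {Plus}. vertex_mult fs p \<noteq> 1}. vertex_mult gs (h p) = vertex_mult fs p"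
proof -
  have fin: "finite (surgery_verts d fs - {Plus})" "finite (surgery_verts d gs - {Plus})"
    by (simp_all add: finite_surgery_verts)
  have "card {p \<in> surgery_verts d fs - {Plus}. vertex_mult fs p = c} = card {q \<in> surgery_verts d gs - {Plus}. vertex_mult gs q = c}" if "c \<noteq> 1" for c
    using card_vertex_mult[OF fs that, of d] card_vertex_mult[OF gs that, of d] mset by simp
  from fibre_bijection[OF fin this] show ?thesis using that by blast
qed

lemma delta_total_transfer_le:
  fixes d :: int
  assumes fs: "\<forall>f\<in>set fs. cusp f" and gs: "\<forall>g\<in>set gs. cusp g"
    and mset: "(\<Sum>f\<leftarrow>fs. mset (multiplicity_sequence f)) = (\<Sum>g\<leftarrow>gs. mset (multiplicity_sequence g))"
    and d: "d > 0"
  shows "surgery.delta_total d gs \<le> surgery.delta_total d fs"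
proof -
  interpret F: surgery d fs by unfold_locales (use fs d in auto)
  interpret G: surgery d gs by unfold_locales (use gs d in auto)
  obtain h where h:
    "bij_betw h {p \<in> surgery_verts d fs - {Plus}. vertex_mult fs p \<noteq> 1} {q \<in> surgery_verts d gs - {Plus}. vertex_mult gs q \<noteq> 1}"
    "\<forall>p\<in>{p \<in> surgery_verts d fs - {Plus}. vertex_mult fs p \<noteq> 1}. vertex_mult gs (h p) = vertex_mult fs p"
    by (rule vertex_bijection[OF fs gs mset])
  have fin: "finite (surgery_verts d fs - {Plus})" "finite (surgery_verts d gs - {Plus})"
    by (simp_all add: finite_surgery_verts)
  show ?thesis
    unfolding F.delta_total_def G.delta_total_def
    by (rule transfer_sum[OF fin h, of "\<lambda>_ n. tri (- int n)"]) (simp_all add: tri_nonneg)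
qed

lemma slice_edge_transfer:
  fixes d :: int
  assumes fs: "\<forall>f\<in>set fs. cusp f" and gs: "\<forall>g\<in>set gs. cusp g"
    and mset: "(\<Sum>f\<leftarrow>fs. mset (multiplicity_sequence f)) = (\<Sum>g\<leftarrow>gs. mset (multiplicity_sequence g))"
    and y: "b + (\<Sum>p\<in>surgery_verts d fs - {Plus}. tri (y p)) \<le> n"
      "c + (\<Sum>p\<in>surgery_verts d fs - {Plus}. tri (y p - int (vertex_mult fs p))) \<le> n"
  shows "\<exists>y. b + (\<Sum>p\<in>surgery_verts d gs - {Plus}. tri (y p)) \<le> n \<and>
      c + (\<Sum>p\<in>surgery_verts d gs - {Plus}. tri (y p - int (vertex_mult gs p))) \<le> n"
proof -
  let ?I = "{p \<in> surgery_verts d fs - {Plus}. vertex_mult fs p \<noteq> 1}"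
  let ?J = "{q \<in> surgery_verts d gs - {Plus}. vertex_mult gs q \<noteq> 1}"
  obtain h where h: "bij_betw h ?I ?J" "\<forall>p\<in>?I. vertex_mult gs (h p) = vertex_mult fs p"
    by (rule vertex_bijection[OF fs gs mset])
  have fin: "finite (surgery_verts d fs - {Plus})" "finite (surgery_verts d gs - {Plus})"
    by (simp_all add: finite_surgery_verts)
  define y' where "y' q = (if q \<in> ?J then y (the_inv_into ?I h q) else 0)" for q
  have "(\<Sum>q\<in>surgery_verts d gs - {Plus}. tri (y' q)) \<le> (\<Sum>p\<in>surgery_verts d fs - {Plus}. tri (y p))"
    unfolding y'_def by (rule transfer_sum[OF fin h, of "\<lambda>y n. tri y"]) (simp_all add: tri_nonneg)
  moreover have "(\<Sum>q\<in>surgery_verts d gs - {Plus}. tri (y' q - int (vertex_mult gs q)))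
      \<le> (\<Sum>p\<in>surgery_verts d fs - {Plus}. tri (y p - int (vertex_mult fs p)))"
    unfolding y'_def by (rule transfer_sum[OF fin h, of "\<lambda>y n. tri (y - int n)"]) (simp_all add: tri_nonneg)
  ultimately show ?thesis using y by (intro exI[of _ y']) linarith
qed

theorem corollary5p1p4:
  fixes fs gs :: "series2 list" and d a :: int
  assumes "\<forall>f\<in>set fs. cusp f"
    and "\<forall>g\<in>set gs. cusp g"
    and "(\<Sum>f\<leftarrow>fs. mset (multiplicity_sequence f)) = (\<Sum>g\<leftarrow>gs. mset (multiplicity_sequence g))"
    and "d > 0"
    and "a \<in> {0..d - 1}"
  shows "lattice_cohomology0_isomorphic
           (surgery_verts d fs) (surgery_weight d fs a)
           (surgery_verts d gs) (surgery_weight d gs a) \<and>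
         eu0 (surgery_verts d fs) (surgery_weight d fs a)
           = eu0 (surgery_verts d gs) (surgery_weight d gs a)"
proof -
  note fs = assms(1) and gs = assms(2)
  interpret F: surgery d fs by unfold_locales (use fs assms(4) in auto)
  interpret G: surgery d gs by unfold_locales (use gs assms(4) in auto)
  interpret FS: slice_lattice "surgery_verts d fs" "surgery_matrix fs" surgery_rank Plus "\<lambda>p. int (vertex_mult fs p)"
      "F.line_weight a" "surgery_weight d fs a" by (rule F.surgery_slice_lattice)
  interpret GS: slice_lattice "surgery_verts d gs" "surgery_matrix gs" surgery_rank Plus "\<lambda>p. int (vertex_mult gs p)"
      "G.line_weight a" "surgery_weight d gs a" by (rule G.surgery_slice_lattice)
  have A: "F.line_weight a = G.line_weight a"
    using delta_total_transfer_le[OF fs gs assms(3,4)] delta_total_transfer_le[OF gs fs assms(3)[symmetric] assms(4)]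
    by (intro ext) (simp add: F.line_weight_def G.line_weight_def)
  have "FS.slice_edge n x \<longleftrightarrow> GS.slice_edge n x" for n x
    unfolding FS.slice_edge_def GS.slice_edge_def unfolding A
    using slice_edge_transfer[OF fs gs assms(3)] slice_edge_transfer[OF gs fs assms(3)[symmetric]] by blast
  then have E: "FS.slice_edge = GS.slice_edge" by (intro ext)
  obtain x0 where x0: "\<And>x. F.line_weight a x0 \<le> F.line_weight a x" using F.line_weight_has_min by blast
  have "min_weight (surgery_verts d fs) (surgery_weight d fs a) = min_weight (surgery_verts d gs) (surgery_weight d gs a)"
    using FS.min_weight_eq[OF x0] GS.min_weight_eq[of x0] x0 unfolding A by simp
  from two_line_reductions[OF FS.line_reduction_axioms GS.line_reduction_axioms[folded A E] this]
  show ?thesis by blast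
qed

end
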